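(* Let $\Omega,\Sigma$ be measurable subsets of $\mathbb{R}^{d+1}_+$, let $1\leq p\leq 2$, let $\varepsilon_\Omega,\varepsilon_\Sigma\ge 0$, and let $\varphi\in L^p_\alpha(\mathbb{R}^{d+1}_+)$ be nonzero. If $\varphi$ is $\varepsilon_\Omega$-concentrated to $\Omega$ in $L^p_\alpha$-norm and $\varepsilon_\Sigma$-bandlimited to $\Sigma$ in $L^p_\alpha$-norm, then $$1-\varepsilon_\Omega-\varepsilon_\Sigma\leq(1+\varepsilon_\Sigma)\left(\mu_\alpha(\Sigma)\right)^{\frac1p}\left(\mu_\alpha(\Omega)\right)^{\frac1p}.$$
   Context: Fix an integer $d\geq 1$ and a real number $\alpha>-1/2$. Let $\mathbb{R}^{d+1}_+=\mathbb{R}^d\times(0,\infty)$, write $x=(x',x_{d+1})$ with $x'\in\mathbb{R}^d$. Equip $\mathbb{R}^{d+1}_+$ with the measure $$d\mu_\alpha(x)=\frac{x_{d+1}^{2\alpha+1}}{(2\pi)^{d/2}2^{\alpha}\Gamma(\alpha+1)}\,dx .$$ $L^p_\alpha(\mathbb{R}^{d+1}_+)$ is the $L^p$ space of this measure (complex-valued functions), with norm $\|\cdot\|_{\alpha,p}$, $1\le p\le\infty$. The Weinstein kernel is $\Lambda^d_\alpha(\lambda,x)=e^{-i\langle x',\lambda'\rangle}j_\alpha(x_{d+1}\lambda_{d+1})$, where $j_\alpha(r)=\Gamma(\alpha+1)\sum_{k\ge0}\frac{(-1)^k r^{2k}}{2^{2k}k!\,\Gamma(\alpha+k+1)}$ is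 the normalized Bessel function. The Weinstein transform of $\varphi\in L^1_\alpha(\mathbb{R}^{d+1}_+)$ is $$\mathcal{F}_{W,\alpha}(\varphi)(\lambda)=\int_{\mathbb{R}^{d+1}_+}\varphi(x)\Lambda^d_\alpha(x,\lambda)\,d\mu_\alpha(x),\quad \lambda\in\mathbb{R}^{d+1}_+.$$ It extends to an isometric isomorphism of $L^2_\alpha(\mathbb{R}^{d+1}_+)$ and, for $1\le p\le 2$, $q=p/(p-1)$ ($q=\infty$ if $p=1$), to a bounded linear map $L^p_\alpha\to L^q_\alpha$ satisfying $\|\mathcal{F}_{W,\alpha}(\varphi)\|_{\alpha,q}\le\|\varphi\|_{\alpha,p}$. Time-limiting operator: $P_\Omega\varphi=\varphi\chi_\Omega$. Weinstein integral operator $Q_\Sigma$: defined by $\mathcal{F}_{W,\alpha}(Q_\Sigma\varphi)=\mathcal{F}_{W,\alpha}(\varphi)\chi_\Sigma$. Here $\chi$ denotes a characteristic function. $\varphi$ is $\varepsilon_\Omega$-concentrated to $\Omega$ in $L^p_\alpha$-norm if $\|\varphi-P_\Omega\varphi\|_{\alpha,p}\le\varepsilon_\Omega\|\varphi\|_{\alpha,p}$. A function $\psi\in L^p_\alpha(\mathbb{R}^{d+1}_+)$ is bandlimited to $\Sigma$ if $Q_\Sigma\psi=\psi$, i.e. $\mathcal{F}_{W,\alpha}(\psi)=\mathcal{F}_{W,\alpha}(\psi)\chi_\Sigma$ a.e.; $\mathcal{B}^p_\alpha(\Sigma)$ is the set of such $\psi$. A function $\varphi\in L^p_\alpha(\mathbb{R}^{d+1}_+)$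 is $\varepsilon_\Sigma$-bandlimited to $\Sigma$ in $L^p_\alpha$-norm if there exists $\psi\in\mathcal{B}^p_\alpha(\Sigma)$ with $\|\varphi-\psi\|_{\alpha,p}\le\varepsilon_\Sigma\|\varphi\|_{\alpha,p}$. Convention: measures may be $+\infty$, with $0\cdot\infty=0$. *)

theory Defs
  imports "HOL-Analysis.Analysis" "HOL-Probability.Essential_Supremum"
begin

section \<open>Lebesgue spaces\<close>

text \<open>Only used with \<open>a > 0\<close>, so that \<open>0\<close> is sent to \<open>0\<close> and \<open>\<infinity>\<close> to \<open>\<infinity>\<close>.\<close>

definition enn_powr :: "ennreal \<Rightarrow> real \<Rightarrow> ennreal" where
  "enn_powr t a = (if t = \<infinity> then \<infinity> else ennreal (enn2real t powr a))"

definition lp_norm :: "'a measure \<Rightarrow> ennreal \<Rightarrow> ('a \<Rightarrow> complex) \<Rightarrow> ennreal" where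
  "lp_norm M p f =
     (if p = \<infinity> then esssup M (\<lambda>x. ennreal (norm (f x)))
      else enn_powr (\<integral>\<^sup>+x. ennreal (norm (f x) powr enn2real p) \<partial>M) (1 / enn2real p))"

definition Lp_space :: "'a measure \<Rightarrow> ennreal \<Rightarrow> ('a \<Rightarrow> complex) set" where
  "Lp_space M p = {f \<in> borel_measurable M. lp_norm M p f < \<infinity>}"

definition conj_exponent :: "real \<Rightarrow> ennreal" where
  "conj_exponent p = (if p = 1 then \<infinity> else ennreal (p / (p - 1)))"


section \<open>The Weinstein transform\<close>

text \<open>Points \<open>x = (x', x\<^sub>d\<^sub>+\<^sub>1)\<close> of \<open>\<real>\<^sup>d \<times> \<real>\<close> are pairs of type \<open>(real^'d) \<times> real\<close> with
  \<open>d = CARD('d) \<ge> 1\<close>.\<close>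

definition half_space :: "((real^'d::finite) \<times> real) set" where
  "half_space = {x. 0 < snd x}"

text \<open>The space of this measure is the half space, and its measurable sets are the
  Lebesgue measurable subsets of the half space.\<close>

definition weinstein_measure :: "real \<Rightarrow> ((real^'d::finite) \<times> real) measure" where
  "weinstein_measure \<alpha> =
     density (lebesgue_on half_space)
       (\<lambda>x. ennreal (snd x powr (2 * \<alpha> + 1) /
          ((2 * pi) powr (real CARD('d) / 2) * 2 powr \<alpha> * Gamma (\<alpha> + 1))))"

definition normalized_bessel :: "real \<Rightarrow> real \<Rightarrow> real" where
  "normalized_bessel \<alpha> r =
     Gamma (\<alpha> + 1) *
       (\<Sum>k. (- 1) ^ k * r ^ (2 * k) / (2 ^ (2 * k) * fact k * Gamma (\<alpha> + real k + 1)))"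

definition weinstein_kernel ::
    "real \<Rightarrow> (real^'d::finite) \<times> real \<Rightarrow> (real^'d) \<times> real \<Rightarrow> complex" where
  "weinstein_kernel \<alpha> \<xi> x =
     exp (- \<i> * complex_of_real (fst x \<bullet> fst \<xi>)) *
       complex_of_real (normalized_bessel \<alpha> (snd x * snd \<xi>))"

definition weinstein_transform_L1 ::
    "real \<Rightarrow> ((real^'d::finite) \<times> real \<Rightarrow> complex) \<Rightarrow> ((real^'d) \<times> real \<Rightarrow> complex)" where
  "weinstein_transform_L1 \<alpha> \<phi> \<xi> =
     (\<integral>x. \<phi> x * weinstein_kernel \<alpha> x \<xi> \<partial>weinstein_measure \<alpha>)"

text \<open>Extension by continuity from \<open>L\<^sup>1 \<inter> L\<^sup>p\<close>, which is dense in \<open>L\<^sup>p\<close>: the function \<open>g\<close>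
  represents the transform of \<open>\<phi>\<close> if it is the \<open>L\<^sup>q\<close>-limit of the integral transforms of some
  sequence in \<open>L\<^sup>1 \<inter> L\<^sup>p\<close> that converges to \<open>\<phi>\<close> in \<open>L\<^sup>p\<close>. For \<open>1 \<le> p \<le> 2\<close> and
  \<open>\<phi> \<in> L\<^sup>p\<close> such a \<open>g\<close> exists and is unique up to null sets; if \<open>\<phi> \<in> L\<^sup>1\<close> it is the
  integral transform itself, and for \<open>p = 2\<close> it is the Plancherel transform.\<close>

definition is_weinstein_transform ::
    "real \<Rightarrow> real \<Rightarrow> ((real^'d::finite) \<times> real \<Rightarrow> complex) \<Rightarrow>
      ((real^'d) \<times> real \<Rightarrow> complex) \<Rightarrow> bool" where
  "is_weinstein_transform \<alpha> p \<phi> g \<longleftrightarrow>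
     g \<in> Lp_space (weinstein_measure \<alpha>) (conj_exponent p) \<and>
     (\<exists>\<phi>s :: nat \<Rightarrow> (real^'d) \<times> real \<Rightarrow> complex.
        (\<forall>n. \<phi>s n \<in> Lp_space (weinstein_measure \<alpha>) 1 \<inter> Lp_space (weinstein_measure \<alpha>) (ennreal p)) \<and>
        (\<lambda>n. lp_norm (weinstein_measure \<alpha>) (ennreal p) (\<lambda>x. \<phi>s n x - \<phi> x)) \<longlonglongrightarrow> 0 \<and>
        (\<lambda>n. lp_norm (weinstein_measure \<alpha>) (conj_exponent p)
           (\<lambda>\<xi>. weinstein_transform_L1 \<alpha> (\<phi>s n) \<xi> - g \<xi>)) \<longlonglongrightarrow> 0)"

text \<open>A representative of the transform on \<open>L\<^sup>p\<close>; only its class modulo null sets is meaningful.\<close>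

definition weinstein_transform ::
    "real \<Rightarrow> real \<Rightarrow> ((real^'d::finite) \<times> real \<Rightarrow> complex) \<Rightarrow> ((real^'d) \<times> real \<Rightarrow> complex)" where
  "weinstein_transform \<alpha> p \<phi> = (SOME g. is_weinstein_transform \<alpha> p \<phi> g)"


section \<open>Concentration and band limitation\<close>

definition time_limit ::
    "((real^'d::finite) \<times> real) set \<Rightarrow> ((real^'d) \<times> real \<Rightarrow> complex) \<Rightarrow>
      ((real^'d) \<times> real \<Rightarrow> complex)" where
  "time_limit \<Omega> \<phi> = (\<lambda>x. \<phi> x * indicator \<Omega> x)"

text \<open>The relation \<open>Q\<^sub>\<Sigma> \<phi> = \<psi>\<close> in \<open>L\<^sup>p\<close>. It is a relation because
  \<open>F(\<phi>) \<chi>\<^sub>\<Sigma>\<close> need not be the transform of an element of \<open>L\<^sup>p\<close> when \<open>p < 2\<close>.\<close>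

definition is_weinstein_integral_operator ::
    "real \<Rightarrow> real \<Rightarrow> ((real^'d::finite) \<times> real) set \<Rightarrow> ((real^'d) \<times> real \<Rightarrow> complex) \<Rightarrow>
      ((real^'d) \<times> real \<Rightarrow> complex) \<Rightarrow> bool" where
  "is_weinstein_integral_operator \<alpha> p \<Sigma> \<phi> \<psi> \<longleftrightarrow>
     \<psi> \<in> Lp_space (weinstein_measure \<alpha>) (ennreal p) \<and>
     (AE \<xi> in weinstein_measure \<alpha>.
        weinstein_transform \<alpha> p \<psi> \<xi> = weinstein_transform \<alpha> p \<phi> \<xi> * indicator \<Sigma> \<xi>)"

definition bandlimited_space ::
    "real \<Rightarrow> real \<Rightarrow> ((real^'d::finite) \<times> real) set \<Rightarrow> ((real^'d) \<times> real \<Rightarrow> complex) set" where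
  "bandlimited_space \<alpha> p \<Sigma> =
     {\<psi> \<in> Lp_space (weinstein_measure \<alpha>) (ennreal p). is_weinstein_integral_operator \<alpha> p \<Sigma> \<psi> \<psi>}"

definition eps_concentrated ::
    "real \<Rightarrow> real \<Rightarrow> real \<Rightarrow> ((real^'d::finite) \<times> real) set \<Rightarrow>
      ((real^'d) \<times> real \<Rightarrow> complex) \<Rightarrow> bool" where
  "eps_concentrated \<alpha> p \<epsilon> \<Omega> \<phi> \<longleftrightarrow>
     lp_norm (weinstein_measure \<alpha>) (ennreal p) (\<lambda>x. \<phi> x - time_limit \<Omega> \<phi> x)
       \<le> ennreal \<epsilon> * lp_norm (weinstein_measure \<alpha>) (ennreal p) \<phi>"

definition eps_bandlimited ::
    "real \<Rightarrow> real \<Rightarrow> real \<Rightarrow> ((real^'d::finite) \<times> real) set \<Rightarrow>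
      ((real^'d) \<times> real \<Rightarrow> complex) \<Rightarrow> bool" where
  "eps_bandlimited \<alpha> p \<epsilon> \<Sigma> \<phi> \<longleftrightarrow>
     (\<exists>\<psi> \<in> bandlimited_space \<alpha> p \<Sigma>.
        lp_norm (weinstein_measure \<alpha>) (ennreal p) (\<lambda>x. \<phi> x - \<psi> x)
          \<le> ennreal \<epsilon> * lp_norm (weinstein_measure \<alpha>) (ennreal p) \<phi>)"

end

theory Submission
  imports Defs "HOL-Probability.Characteristic_Functions" "HOL-Real_Asymp.Real_Asymp"
begin

text \<open>The heart of the matter is a bound for a bandlimited function. If the transform \<open>g\<close> of
\<open>\<psi> \<in> L\<^sup>p\<close> vanishes off a set \<open>\<Sigma>\<close> of finite measure, then \<open>\<bar>\<psi>\<bar> \<le> \<mu>(\<Sigma>)\<^bsup>1/p\<^esup> \<parallel>\<psi>\<parallel>\<^sub>p\<close> almost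
everywhere (\<open>bandlimited_bound\<close>). Given this, \<open>\<psi>\<close> has norm at most
\<open>\<mu>(\<Omega>)\<^bsup>1/p\<^esup> \<mu>(\<Sigma>)\<^bsup>1/p\<^esup> \<parallel>\<psi>\<parallel>\<^sub>p\<close> on \<open>\<Omega>\<close>, and the triangle inequality applied to
\<open>\<phi> = (\<phi> - P\<^sub>\<Omega> \<phi>) + P\<^sub>\<Omega> (\<phi> - \<psi>) + P\<^sub>\<Omega> \<psi>\<close> yields the theorem, because
\<open>\<parallel>\<psi>\<parallel>\<^sub>p \<le> (1 + \<epsilon>\<^sub>\<Sigma>) \<parallel>\<phi>\<parallel>\<^sub>p\<close>.

The usual argument for the bound combines \<open>\<bar>\<psi>\<bar> \<le> \<parallel>g\<parallel>\<^sub>1\<close> with Hoelder's inequality and the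
Hausdorff--Young inequality with constant one, which is usually proved by complex interpolation. The
sharp constant can be had from Plancherel's identity alone. Put \<open>B = \<parallel>g\<parallel>\<^sub>1\<close>, which is finite
since \<open>g\<close> is in \<open>L\<^sup>q\<close> and lives on a set of finite measure. The inversion formula gives
\<open>\<bar>\<psi>\<bar> \<le> B\<close>, hence \<open>\<psi> \<in> L\<^sup>2\<close>, and Cauchy--Schwarz and Plancherel give
\<open>B\<^sup>2 \<le> \<mu>(\<Sigma>) \<parallel>g\<parallel>\<^sub>2\<^sup>2 = \<mu>(\<Sigma>) \<parallel>\<psi>\<parallel>\<^sub>2\<^sup>2 \<le> \<mu>(\<Sigma>) B\<^bsup>2-p\<^esup> \<parallel>\<psi>\<parallel>\<^sub>p\<^sup>p\<close>,
so that \<open>B\<^sup>p \<le> \<mu>(\<Sigma>) \<parallel>\<psi>\<parallel>\<^sub>p\<^sup>p\<close>. A Hausdorff--Young inequality is then needed only to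
know that every \<open>\<psi> \<in> L\<^sup>p\<close> has a transform, and any constant will do; Marcinkiewicz' real
interpolation between \<open>L\<^sup>1 \<rightarrow> L\<^sup>\<infinity>\<close> and \<open>L\<^sup>2 \<rightarrow> L\<^sup>2\<close> provides one
(\<open>weak_Hausdorff_Young\<close>, \<open>extends_transform_ex\<close>).

Inversion and Plancherel's inequality both come from Gaussians. Poisson's integral shows that the
kernel is bounded by one (\<open>abs_normalized_bessel_le_1\<close>). The adjoint transform maps a Gaussian
\<open>exp (- s \<bar>x\<bar>\<^sup>2 / 2 + b \<bullet> x')\<close> to a modulated Gaussian, and the transform maps that one back
(\<open>gaussian_inverted\<close>); and the span of these Gaussians is rich enough, by the theorem of
Stone and Weierstrass, to approximate bounded functions of bounded support in \<open>L\<^sup>1\<close> and \<open>L\<^sup>2\<close>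
simultaneously (\<open>gaussian_span_dense\<close>) and to separate functions (\<open>gaussian_span_total\<close>). What follows from these properties holds for
every bounded symmetric kernel that has them, and is proved in that generality in the locale
\<open>plancherel_kernel\<close>.\<close>

section \<open>The normalized Bessel function\<close>

lemma has_bochner_integral_sums:
  fixes f :: "nat \<Rightarrow> 'a \<Rightarrow> real"
  assumes f: "\<And>k. has_bochner_integral M (f k) (c k)" and fs: "\<And>x. (\<lambda>k. f k x) sums F x"
    and sn: "\<And>x. summable (\<lambda>k. norm (f k x))" and si: "summable (\<lambda>k. \<integral>x. norm (f k x) \<partial>M)"
    and c: "c sums C"
  shows "has_bochner_integral M F C"
proof -
  have F: "(\<lambda>x. \<Sum>k. f k x) = F" by (intro ext sums_unique[symmetric] fs)
  have I: "integral\<^sup>L M (f k) = c k" for k using f by (rule has_bochner_integral_integral_eq)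
  have int: "integrable M (f k)" for k using f by (auto simp: has_bochner_integral_iff)
  have "(\<lambda>k. integral\<^sup>L M (f k)) sums (\<integral>x. (\<Sum>k. f k x) \<partial>M)" "integrable M (\<lambda>x. \<Sum>k. f k x)"
    using sums_integral[OF int _ si] integrable_suminf[OF int _ si] sn by auto
  note this[unfolded F I]
  with sums_unique2[OF this(1) c] show ?thesis by (simp add: has_bochner_integral_iff)
qed

definition bessel_coeff :: "real \<Rightarrow> nat \<Rightarrow> real" where
  "bessel_coeff \<alpha> k = Gamma (\<alpha> + 1) / (2 ^ (2 * k) * fact k * Gamma (\<alpha> + real k + 1))"

text \<open>The probability density of Poisson's integral for the Bessel function, in the variable
\<open>u = t\<^sup>2\<close>, which makes its moments Beta integrals.\<close>

definition poisson_density :: "real \<Rightarrow> real \<Rightarrow> real" where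
  "poisson_density \<alpha> u =
     indicator {0..1} u * (u powr (- 1 / 2) * (1 - u) powr (\<alpha> - 1 / 2)) / Beta (1 / 2) (\<alpha> + 1 / 2)"

lemma poisson_density_nonneg: "\<alpha> > - 1 / 2 \<Longrightarrow> 0 \<le> poisson_density \<alpha> u"
  by (auto simp: poisson_density_def Beta_def indicator_def intro!: divide_nonneg_nonneg mult_nonneg_nonneg Gamma_real_nonneg)

lemma poisson_density_measurable [measurable]: "poisson_density \<alpha> \<in> borel_measurable borel"
  unfolding poisson_density_def by measurable

text \<open>The moment is a quotient of Beta functions, and the duplication formula
\<open>(2k)! = 4\<^sup>k (1/2)\<^sub>k k!\<close> turns it into a Bessel coefficient.\<close>

lemma poisson_density_moment:
  assumes a: "\<alpha> > - 1 / 2"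
  shows "has_bochner_integral lborel (\<lambda>u. poisson_density \<alpha> u * u ^ k) (fact (2 * k) * bessel_coeff \<alpha> k)"
proof -
  have "((\<lambda>t. t powr ((k + 1/2) - 1) * (1 - t) powr ((\<alpha> + 1/2) - 1)) has_integral Beta (k + 1/2) (\<alpha> + 1/2)) {0..1}"
    by (rule has_integral_Beta_real) (use a in auto)
  then have "(\<integral>\<^sup>+t. ennreal (indicator {0..1} t * (t powr ((k + 1/2) - 1) * (1 - t) powr ((\<alpha> + 1/2) - 1))) \<partial>lborel)
      = ennreal (Beta (k + 1/2) (\<alpha> + 1/2))"
    by (intro nn_integral_has_integral_lebesgue) auto
  then have 1: "has_bochner_integral lborel (\<lambda>t. indicator {0..1} t * (t powr ((k + 1/2) - 1) * (1 - t) powr ((\<alpha> + 1/2) - 1)))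
      (Beta (k + 1/2) (\<alpha> + 1/2))"
    using a by (intro has_bochner_integral_nn_integral) (auto simp: Beta_def intro!: divide_nonneg_nonneg Gamma_real_nonneg mult_nonneg_nonneg)
  have "Gamma (k + 1/2) = pochhammer (1/2) k * Gamma (1/2 :: real)"
  proof -
    have "(1/2::real) \<notin> \<int>\<^sub>\<le>\<^sub>0" using nonpos_Ints_nonpos[of "1/2::real"] by auto
    from pochhammer_Gamma[OF this, of k] show ?thesis
      by (simp add: add.commute Gamma_one_half_real)
  qed
  moreover have "Gamma (\<alpha> + k + 1) > 0" "Gamma (\<alpha> + 1) > 0" "Gamma (\<alpha> + 1/2) > 0"
    using a by (auto intro!: Gamma_real_pos)
  moreover have "(fact (2 * k) :: real) = 2 ^ (2 * k) * pochhammer (1 / 2) k * fact k"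
    by (rule fact_double)
  moreover have e: "real k + 1/2 + (\<alpha> + 1/2) = \<alpha> + k + 1" "1/2 + (\<alpha> + 1/2) = \<alpha> + 1" by auto
  ultimately have 2: "Beta (k + 1/2) (\<alpha> + 1/2) / Beta (1/2) (\<alpha> + 1/2) = fact (2 * k) * bessel_coeff \<alpha> k"
    by (simp only: Beta_def bessel_coeff_def e) (simp add: divide_simps Gamma_one_half_real)
  show ?thesis
    unfolding 2[symmetric]
  proof (rule has_bochner_integral_cong_AE[THEN iffD1])
    show "has_bochner_integral lborel (\<lambda>t. indicator {0..1} t * (t powr ((k + 1/2) - 1) * (1 - t) powr ((\<alpha> + 1/2) - 1)) / Beta (1/2) (\<alpha> + 1/2))
      (Beta (k + 1/2) (\<alpha> + 1/2) / Beta (1/2) (\<alpha> + 1/2))"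
      using 1 by (rule has_bochner_integral_divide_zero)
    show "AE u in lborel. indicator {0..1} u * (u powr (real k + 1 / 2 - 1) * (1 - u) powr (\<alpha> + 1 / 2 - 1)) / Beta (1 / 2) (\<alpha> + 1 / 2)
       = poisson_density \<alpha> u * u ^ k"
      using AE_lborel_singleton[of 0]
    proof eventually_elim
      fix u :: real assume "u \<noteq> 0"
      then show "indicator {0..1} u * (u powr (real k + 1 / 2 - 1) * (1 - u) powr (\<alpha> + 1 / 2 - 1)) / Beta (1 / 2) (\<alpha> + 1 / 2)
       = poisson_density \<alpha> u * u ^ k"
        by (cases "u > 0") (auto simp: poisson_density_def indicator_def powr_realpow[symmetric] powr_add[symmetric])
    qed
  qed auto
qed

lemma bessel_coeff_nonneg: "\<alpha> > - 1 / 2 \<Longrightarrow> 0 \<le> bessel_coeff \<alpha> k"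
  by (auto simp: bessel_coeff_def intro!: divide_nonneg_nonneg mult_nonneg_nonneg Gamma_real_nonneg)

lemma bessel_coeff_0: "\<alpha> > - 1 / 2 \<Longrightarrow> bessel_coeff \<alpha> 0 = 1"
  using Gamma_real_pos[of "\<alpha> + 1"] by (simp add: bessel_coeff_def less_imp_neq[THEN not_sym])

text \<open>The moments of a probability measure on \<open>[0, 1]\<close> are at most one. This compares the Bessel series
with that of the hyperbolic cosine.\<close>

lemma bessel_coeff_le:
  assumes a: "\<alpha> > - 1 / 2"
  shows "bessel_coeff \<alpha> k \<le> 1 / fact (2 * k)"
proof -
  have 0: "has_bochner_integral lborel (\<lambda>u. poisson_density \<alpha> u * u ^ 0) 1"
    using poisson_density_moment[OF a, of 0] bessel_coeff_0[OF a] by simp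
  have "fact (2 * k) * bessel_coeff \<alpha> k \<le> 1"
    unfolding has_bochner_integral_integral_eq[OF poisson_density_moment[OF a, of k], symmetric]
      has_bochner_integral_integral_eq[OF 0, symmetric]
  proof (rule integral_mono)
    fix u :: real
    show "poisson_density \<alpha> u * u ^ k \<le> poisson_density \<alpha> u * u ^ 0"
    proof (cases "u \<in> {0..1}")
      case True then show ?thesis
        using poisson_density_nonneg[OF a, of u] by (intro mult_left_mono) (auto simp: power_le_one)
    qed (simp add: poisson_density_def)
  qed (use 0 poisson_density_moment[OF a, of k] in \<open>auto simp: has_bochner_integral_iff\<close>)
  then show ?thesis by (simp add: field_simps)
qed

lemma bessel_terms_summable:
  assumes a: "\<alpha> > - 1 / 2"
  shows "summable (\<lambda>k. \<bar>r\<bar> ^ (2 * k) * bessel_coeff \<alpha> k)"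
proof -
  have "summable (\<lambda>k. inverse (fact k) * \<bar>r\<bar> ^ k)" by (rule summable_exp)
  then have "summable ((\<lambda>k. inverse (fact k) * \<bar>r\<bar> ^ k) \<circ> (\<lambda>k. 2 * k))"
    by (rule summable_reindex) (auto simp: inj_def)
  then show ?thesis
  proof (rule summable_comparison_test'[where N=0])
    fix k :: nat
    show "norm (\<bar>r\<bar> ^ (2 * k) * bessel_coeff \<alpha> k) \<le> ((\<lambda>k. inverse (fact k) * \<bar>r\<bar> ^ k) \<circ> (\<lambda>k. 2 * k)) k"
      using mult_left_mono[OF bessel_coeff_le[OF a, of k], of "\<bar>r\<bar> ^ (2 * k)"] bessel_coeff_nonneg[OF a, of k]
      by (auto simp: abs_mult power_abs field_simps)
  qed
qed

lemma normalized_bessel_sums: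
  assumes a: "\<alpha> > - 1 / 2"
  shows "(\<lambda>k. (- 1) ^ k * r ^ (2 * k) * bessel_coeff \<alpha> k) sums normalized_bessel \<alpha> r"
proof -
  have "summable (\<lambda>k. (- 1) ^ k * r ^ (2 * k) * bessel_coeff \<alpha> k)"
    using bessel_terms_summable[OF a, of r] bessel_coeff_nonneg[OF a]
    by (intro summable_norm_cancel[of "\<lambda>k. (- 1) ^ k * r ^ (2 * k) * bessel_coeff \<alpha> k"])
       (simp add: abs_mult power_abs)
  then have s: "(\<lambda>k. (- 1) ^ k * r ^ (2 * k) * bessel_coeff \<alpha> k) sums (\<Sum>k. (- 1) ^ k * r ^ (2 * k) * bessel_coeff \<alpha> k)"
    by (rule summable_sums)
  moreover have "(\<Sum>k. (- 1) ^ k * r ^ (2 * k) * bessel_coeff \<alpha> k) = normalized_bessel \<alpha> r"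
  proof -
    have G: "Gamma (\<alpha> + 1) > 0" using a by (intro Gamma_real_pos) auto
    define h where "h k = (- 1) ^ k * r ^ (2 * k) * bessel_coeff \<alpha> k" for k
    have "normalized_bessel \<alpha> r = Gamma (\<alpha> + 1) * (\<Sum>k. h k / Gamma (\<alpha> + 1))"
      unfolding normalized_bessel_def h_def bessel_coeff_def using G
      by (intro arg_cong2[where f="(*)"] refl arg_cong[where f=suminf] ext) simp
    also have "\<dots> = (\<Sum>k. h k)"
      using G sums_summable[OF s] unfolding h_def[symmetric] by (simp add: suminf_divide)
    finally show ?thesis by (simp add: h_def)
  qed
  ultimately show ?thesis by simp
qed

text \<open>Integrate the cosine series term by term. Poisson's integral exhibits the Bessel function as an
average of cosines, and that is the reason for its bound by one.\<close>

lemma normalized_bessel_poisson: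
  assumes a: "\<alpha> > - 1 / 2"
  shows "has_bochner_integral lborel (\<lambda>u. poisson_density \<alpha> u * cos (r * sqrt u)) (normalized_bessel \<alpha> r)"
proof -
  define f where "f k u = (- 1) ^ k * r ^ (2 * k) / fact (2 * k) * (poisson_density \<alpha> u * u ^ k)" for k u
  note m = poisson_density_moment[OF a]
  have f: "has_bochner_integral lborel (f k) ((- 1) ^ k * r ^ (2 * k) * bessel_coeff \<alpha> k)" for k
  proof -
    have "has_bochner_integral lborel (\<lambda>u. (- 1) ^ k * r ^ (2 * k) / fact (2 * k) * (poisson_density \<alpha> u * u ^ k))
      ((- 1) ^ k * r ^ (2 * k) / fact (2 * k) * (fact (2 * k) * bessel_coeff \<alpha> k))"
      by (intro has_bochner_integral_mult_right m)
    then show ?thesis by (simp add: f_def[abs_def] mult.assoc)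
  qed
  have nf: "norm (f k u) = \<bar>r\<bar> ^ (2 * k) / fact (2 * k) * (poisson_density \<alpha> u * u ^ k)" for k u
  proof (cases "u \<in> {0..1}")
    case True
    then show ?thesis
      using poisson_density_nonneg[OF a, of u] by (auto simp: f_def abs_mult power_abs)
  qed (simp add: f_def poisson_density_def)
  have 1: "f k u = poisson_density \<alpha> u * ((- 1) ^ k / fact (2 * k) * (r * sqrt u) ^ (2 * k))" for k u
  proof (cases "u \<ge> 0")
    case True
    then have "sqrt u ^ (2 * k) = u ^ k" by (simp add: power_mult)
    then show ?thesis by (simp add: f_def power_mult_distrib)
  qed (simp add: f_def poisson_density_def)
  have cs: "(\<lambda>k. (- 1) ^ k / fact (2 * k) * x ^ (2 * k)) sums cos x" for x :: real
  using cos_paired[of x] .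
  have fs: "(\<lambda>k. f k u) sums (poisson_density \<alpha> u * cos (r * sqrt u))" for u
    unfolding 1 by (intro sums_mult cs)
  have sn: "summable (\<lambda>k. norm (f k u))" for u
  proof -
    have "summable (\<lambda>k. poisson_density \<alpha> u * (inverse (fact (2 * k)) * \<bar>r * sqrt u\<bar> ^ (2 * k)))"
      using summable_reindex[OF summable_exp[of "\<bar>r * sqrt u\<bar>"], of "\<lambda>k. 2 * k"]
      by (intro summable_mult) (auto simp: inj_def o_def)
    moreover have "norm (f k u) = poisson_density \<alpha> u * (inverse (fact (2 * k)) * \<bar>r * sqrt u\<bar> ^ (2 * k))" for k
      using poisson_density_nonneg[OF a, of u] by (simp add: 1 abs_mult power_abs field_simps)
    ultimately show ?thesis by simp
  qed
  have si: "summable (\<lambda>k. \<integral>u. norm (f k u) \<partial>lborel)"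
    unfolding nf using m bessel_terms_summable[OF a, of r] by (simp add: has_bochner_integral_iff)
  show ?thesis
    by (rule has_bochner_integral_sums[OF f fs sn si normalized_bessel_sums[OF a]])
qed

lemma abs_normalized_bessel_le_1:
  assumes a: "\<alpha> > - 1 / 2"
  shows "\<bar>normalized_bessel \<alpha> r\<bar> \<le> 1"
proof -
  have 0: "has_bochner_integral lborel (\<lambda>u. poisson_density \<alpha> u) 1"
    using poisson_density_moment[OF a, of 0] bessel_coeff_0[OF a] by simp
  note r = normalized_bessel_poisson[OF a, of r]
  have "\<bar>normalized_bessel \<alpha> r\<bar> = norm (\<integral>u. poisson_density \<alpha> u * cos (r * sqrt u) \<partial>lborel)"
    using r by (simp add: has_bochner_integral_iff)
  also have "\<dots> \<le> (\<integral>u. poisson_density \<alpha> u \<partial>lborel)"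
  proof (rule order_trans[OF integral_norm_bound integral_mono])
    show "norm (poisson_density \<alpha> u * cos (r * sqrt u)) \<le> poisson_density \<alpha> u" for u
      using poisson_density_nonneg[OF a, of u] by (simp add: abs_mult mult_left_le)
  qed (use 0 r in \<open>auto simp: has_bochner_integral_iff\<close>)
  finally show ?thesis using 0 by (simp add: has_bochner_integral_iff)
qed

lemma normalized_bessel_measurable [measurable]: "normalized_bessel \<alpha> \<in> borel_measurable borel"
  unfolding normalized_bessel_def by measurable


section \<open>One-dimensional Gaussian integrals\<close>

lemma has_bochner_integral_gaussian_fourier:
  assumes s: "s > 0"
  shows "has_bochner_integral lborel
    (\<lambda>x. complex_of_real (exp (- (s * x\<^sup>2) / 2)) * exp (- \<i> * complex_of_real (x * y)))
    (complex_of_real (sqrt (2 * pi / s) * exp (- y\<^sup>2 / (2 * s))))"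
proof -
  define t where "t = - y / sqrt s"
  have i: "integrable std_normal_distribution (\<lambda>x. iexp (t * x))"
    by (rule prob_space.integrable_iexp) (auto intro: real_distribution.axioms(1)[OF real_dist_normal_dist])
  have "has_bochner_integral lborel (\<lambda>x. std_normal_density x *\<^sub>R iexp (t * x)) (complex_of_real (exp (- (t\<^sup>2) / 2)))"
    using i fun_cong[OF char_std_normal_distribution, of t]
    by (auto simp: has_bochner_integral_iff char_def integrable_density integral_density normal_density_nonneg)
  then have "has_bochner_integral lborel (\<lambda>x. std_normal_density (0 + sqrt s * x) *\<^sub>R iexp (t * (0 + sqrt s * x)))
      (complex_of_real (exp (- (t\<^sup>2) / 2)) /\<^sub>R \<bar>sqrt s\<bar>)"
    using s by (subst (asm) lborel_has_bochner_integral_real_affine_iff[where c="sqrt s" and t=0]) auto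
  then have "has_bochner_integral lborel
       (\<lambda>x. complex_of_real (sqrt (2 * pi)) * (std_normal_density (0 + sqrt s * x) *\<^sub>R iexp (t * (0 + sqrt s * x))))
      (complex_of_real (sqrt (2 * pi)) * (complex_of_real (exp (- (t\<^sup>2) / 2)) /\<^sub>R \<bar>sqrt s\<bar>))"
    by (rule has_bochner_integral_mult_right)
  also have "(\<lambda>x. complex_of_real (sqrt (2 * pi)) * (std_normal_density (0 + sqrt s * x) *\<^sub>R iexp (t * (0 + sqrt s * x))))
     = (\<lambda>x. complex_of_real (exp (- (s * x\<^sup>2) / 2)) * exp (- \<i> * complex_of_real (x * y)))"
    using s by (auto simp: std_normal_density_def scaleR_conv_of_real power_mult_distrib real_sqrt_mult t_def fun_eq_iff mult_ac)
  also have "complex_of_real (sqrt (2 * pi)) * (complex_of_real (exp (- (t\<^sup>2) / 2)) /\<^sub>R \<bar>sqrt s\<bar>)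
     = complex_of_real (sqrt (2 * pi / s) * exp (- y\<^sup>2 / (2 * s)))"
    using s by (auto simp: t_def power_divide real_sqrt_divide scaleR_conv_of_real field_simps)
  finally show ?thesis .
qed

text \<open>The substitution \<open>t = s r\<^sup>2 / 2\<close> reduces the moment to the Gamma integral.\<close>

lemma has_bochner_integral_gaussian_moment:
  fixes \<beta> :: real
  assumes b: "\<beta> > - 1" and s: "s > 0"
  shows "has_bochner_integral lborel (\<lambda>r. indicator {0<..} r * (r powr (2 * \<beta> + 1) * exp (- (s * r\<^sup>2) / 2)))
    (2 powr \<beta> * Gamma (\<beta> + 1) / s powr (\<beta> + 1))"
proof -
  define f where "f t = t powr \<beta> / exp t" for t :: real
  define g where "g r = s * r\<^sup>2 / 2" for r :: real
  have g': "(g has_field_derivative (s * r)) (at r within {0<..})" for r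
    unfolding g_def by (auto intro!: derivative_eq_intros)
  have inj: "inj_on g {0<..}" using s by (auto simp: inj_on_def g_def power2_eq_iff)
  have im: "g ` {0<..} = {0<..}"
  proof safe
    fix t :: real assume "t > 0"
    then show "t \<in> g ` {0<..}" using s by (intro image_eqI[of _ _ "sqrt (2 * t / s)"]) (auto simp: g_def)
  qed (use s in \<open>auto simp: g_def\<close>)
  have hi: "(f has_integral Gamma (\<beta> + 1)) {0<..}"
  proof -
    have "(f has_integral Gamma (\<beta> + 1)) {0..}" using Gamma_integral_real[of "\<beta> + 1"] b by (simp add: f_def[abs_def])
    then show ?thesis
      by (rule has_integral_spike_set_eq[THEN iffD1, rotated 2]) (auto intro: negligible_subset[of "{0}"])
  qed
  then have "f absolutely_integrable_on {0<..}"
    by (intro nonnegative_absolutely_integrable_1) (auto simp: f_def integrable_on_def)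
  with hi have "(\<lambda>r. \<bar>s * r\<bar> * f (g r)) absolutely_integrable_on {0<..} \<and>
        integral {0<..} (\<lambda>r. \<bar>s * r\<bar> * f (g r)) = Gamma (\<beta> + 1)"
    using has_absolute_integral_change_of_variables_1'[of "{0<..}" g "\<lambda>r. s * r" f "Gamma (\<beta> + 1)"] g' inj im
    by (auto simp: integral_unique)
  then have 1: "has_bochner_integral lebesgue (\<lambda>r. indicator {0<..} r *\<^sub>R (\<bar>s * r\<bar> * f (g r))) (Gamma (\<beta> + 1))"
    using set_lebesgue_integral_eq_integral(2)[of "{0<..}" "\<lambda>r. \<bar>s * r\<bar> * f (g r)"]
    by (auto simp: has_bochner_integral_iff set_integrable_def set_lebesgue_integral_def)
  have m: "(\<lambda>r. indicator {0<..} r *\<^sub>R (\<bar>s * r\<bar> * f (g r))) \<in> borel_measurable lborel"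
    unfolding f_def g_def by measurable
  have "has_bochner_integral lborel (\<lambda>r. indicator {0<..} r *\<^sub>R (\<bar>s * r\<bar> * f (g r))) (Gamma (\<beta> + 1))"
    using 1 unfolding has_bochner_integral_iff integrable_completion[OF m] integral_completion[OF m] .
  then have "has_bochner_integral lborel
      (\<lambda>r. (2 powr \<beta> / s powr (\<beta> + 1)) * (indicator {0<..} r *\<^sub>R (\<bar>s * r\<bar> * f (g r)))) ((2 powr \<beta> / s powr (\<beta> + 1)) * Gamma (\<beta> + 1))"
    by (rule has_bochner_integral_mult_right)
  also have "(\<lambda>r. (2 powr \<beta> / s powr (\<beta> + 1)) * (indicator {0<..} r *\<^sub>R (\<bar>s * r\<bar> * f (g r))))
     = (\<lambda>r. indicator {0<..} r * (r powr (2 * \<beta> + 1) * exp (- (s * r\<^sup>2) / 2)))"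
  proof
    fix r :: real
    show "(2 powr \<beta> / s powr (\<beta> + 1)) * (indicator {0<..} r *\<^sub>R (\<bar>s * r\<bar> * f (g r)))
      = indicator {0<..} r * (r powr (2 * \<beta> + 1) * exp (- (s * r\<^sup>2) / 2))"
    proof (cases "r > 0")
      case True
      have "r powr (2 * \<beta> + 1) = r * (r\<^sup>2) powr \<beta>"
        using True by (simp add: powr_add powr_powr[symmetric] powr_numeral)
      then show ?thesis
        using True s by (simp add: f_def g_def powr_mult powr_divide powr_add exp_minus field_simps)
    qed simp
  qed
  finally show ?thesis by (simp add: mult_ac)
qed

text \<open>In the Bessel series, the factor \<open>\<Gamma>(\<alpha> + k + 1)\<close> of the \<open>k\<close>-th coefficient cancels
against the Gaussian moment, so that integration term by term leaves an exponential series.\<close>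

lemma has_bochner_integral_hankel_gaussian:
  assumes a: "\<alpha> > - 1 / 2" and s: "s > 0"
  shows "has_bochner_integral lborel
    (\<lambda>r. indicator {0<..} r * (r powr (2 * \<alpha> + 1) * exp (- (s * r\<^sup>2) / 2)) * normalized_bessel \<alpha> (r * \<rho>))
    (2 powr \<alpha> * Gamma (\<alpha> + 1) / s powr (\<alpha> + 1) * exp (- \<rho>\<^sup>2 / (2 * s)))"
proof -
  define w where "w r = indicator {0<..} r * (r powr (2 * \<alpha> + 1) * exp (- (s * r\<^sup>2) / 2))" for r
  define C where "C = 2 powr \<alpha> * Gamma (\<alpha> + 1) / s powr (\<alpha> + 1)"
  define f where "f k r = ((- 1) ^ k * \<rho> ^ (2 * k) * bessel_coeff \<alpha> k) * (w r * r ^ (2 * k))" for k r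
  have w: "w r \<ge> 0" for r by (simp add: w_def indicator_def)
  have G: "Gamma (\<alpha> + 1) > 0" "\<And>k. Gamma (\<alpha> + real k + 1) > 0" using a by (auto intro!: Gamma_real_pos)
  have m: "has_bochner_integral lborel (\<lambda>r. w r * r ^ (2 * k))
     (2 powr (\<alpha> + k) * Gamma (\<alpha> + k + 1) / s powr (\<alpha> + k + 1))" for k
  proof -
    have "w r * r ^ (2 * k) = indicator {0<..} r * (r powr (2 * (\<alpha> + k) + 1) * exp (- (s * r\<^sup>2) / 2))" for r
      by (auto simp: w_def indicator_def powr_add distrib_left powr_realpow[symmetric])
    then show ?thesis
      using has_bochner_integral_gaussian_moment[of "\<alpha> + k" s] a s by simp
  qed
  have cm: "bessel_coeff \<alpha> k * (2 powr (\<alpha> + k) * Gamma (\<alpha> + k + 1) / s powr (\<alpha> + k + 1)) = C * (1 / (2 * s)) ^ k / fact k" for k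
    using s G(1) G(2)[of k]
    by (simp add: bessel_coeff_def C_def powr_add powr_realpow power_mult power_divide power_mult_distrib divide_simps)
       (simp add: power_mult_distrib[symmetric])
  have f: "has_bochner_integral lborel (f k) (C * ((- \<rho>\<^sup>2 / (2 * s)) ^ k / fact k))" for k
  proof -
    have "has_bochner_integral lborel (f k) (((- 1) ^ k * \<rho> ^ (2 * k) * bessel_coeff \<alpha> k) *
        (2 powr (\<alpha> + k) * Gamma (\<alpha> + k + 1) / s powr (\<alpha> + k + 1)))"
      unfolding f_def by (intro has_bochner_integral_mult_right m)
    also have "((- 1) ^ k * \<rho> ^ (2 * k) * bessel_coeff \<alpha> k) *
        (2 powr (\<alpha> + k) * Gamma (\<alpha> + k + 1) / s powr (\<alpha> + k + 1)) =
       (- 1) ^ k * \<rho> ^ (2 * k) * (C * (1 / (2 * s)) ^ k / fact k)"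
      unfolding cm[symmetric] by (simp only: mult.assoc)
    also have "\<dots> = C * ((- \<rho>\<^sup>2 / (2 * s)) ^ k / fact k)"
    proof -
      have "(- \<rho>\<^sup>2 / (2 * s)) ^ k = ((-1) * \<rho>\<^sup>2 * (1 / (2 * s))) ^ k" by simp
      also have "\<dots> = (- 1) ^ k * \<rho> ^ (2 * k) * (1 / (2 * s)) ^ k"
        by (simp only: power_mult_distrib power_mult)
      finally show ?thesis by simp
    qed
    finally show ?thesis .
  qed
  have nf: "norm (f k r) = \<bar>\<rho>\<bar> ^ (2 * k) * bessel_coeff \<alpha> k * (w r * r ^ (2 * k))" for k r
    using w[of r] bessel_coeff_nonneg[OF a, of k] by (simp add: f_def abs_mult power_abs power_mult)
  have inf: "(\<integral>r. norm (f k r) \<partial>lborel) = C * ((\<rho>\<^sup>2 / (2 * s)) ^ k / fact k)" for k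
  proof -
    have "(\<integral>r. norm (f k r) \<partial>lborel) = \<bar>\<rho>\<bar> ^ (2 * k) * bessel_coeff \<alpha> k * (2 powr (\<alpha> + k) * Gamma (\<alpha> + k + 1) / s powr (\<alpha> + k + 1))"
      unfolding nf using m by (simp add: has_bochner_integral_iff)
    also have "\<dots> = \<bar>\<rho>\<bar> ^ (2 * k) * (C * (1 / (2 * s)) ^ k / fact k)" unfolding cm[symmetric] by (simp only: mult.assoc)
    finally show ?thesis by (simp add: power_mult power_divide)
  qed
  have fs: "(\<lambda>k. f k r) sums (w r * normalized_bessel \<alpha> (r * \<rho>))" for r
  proof -
    have "(\<lambda>k. w r * ((- 1) ^ k * (r * \<rho>) ^ (2 * k) * bessel_coeff \<alpha> k)) sums (w r * normalized_bessel \<alpha> (r * \<rho>))"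
      by (intro sums_mult normalized_bessel_sums a)
    moreover have "w r * ((- 1) ^ k * (r * \<rho>) ^ (2 * k) * bessel_coeff \<alpha> k) = f k r" for k
      by (simp add: f_def power_mult_distrib)
    ultimately show ?thesis by simp
  qed
  have sn: "summable (\<lambda>k. norm (f k r))" for r
  proof -
    have "summable (\<lambda>k. w r * (\<bar>r * \<rho>\<bar> ^ (2 * k) * bessel_coeff \<alpha> k))"
      by (intro summable_mult bessel_terms_summable a)
    moreover have "w r * (\<bar>r * \<rho>\<bar> ^ (2 * k) * bessel_coeff \<alpha> k) = norm (f k r)" for k
      unfolding nf by (simp add: power_mult_distrib abs_mult power_mult)
    ultimately show ?thesis by simp
  qed
  have e: "(\<lambda>k. C * (x ^ k / fact k)) sums (C * exp x)" for x :: real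
    using exp_converges[of x] by (intro sums_mult) (simp add: divide_inverse mult.commute)
  have si: "summable (\<lambda>k. \<integral>r. norm (f k r) \<partial>lborel)"
    unfolding inf by (rule sums_summable[OF e])
  have "has_bochner_integral lborel (\<lambda>r. w r * normalized_bessel \<alpha> (r * \<rho>)) (C * exp (- \<rho>\<^sup>2 / (2 * s)))"
    by (rule has_bochner_integral_sums[OF f fs sn si e])
  then show ?thesis by (simp add: w_def[abs_def] C_def)
qed

lemma has_bochner_integral_lborel_prod:
  fixes f :: "'a::euclidean_space \<Rightarrow> real \<Rightarrow> complex"
  assumes f: "\<And>b. b \<in> Basis \<Longrightarrow> has_bochner_integral lborel (f b) (F b)"
  shows "has_bochner_integral lborel (\<lambda>x. \<Prod>b\<in>Basis. f b (x \<bullet> b)) (\<Prod>b\<in>Basis. F b)"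
proof -
  interpret product_sigma_finite "\<lambda>_::'a. lborel :: real measure" by standard
  define P where "P = (\<Pi>\<^sub>M b\<in>(Basis::'a set). lborel :: real measure)"
  have int: "\<And>b. b \<in> Basis \<Longrightarrow> integrable lborel (f b)" using f by (auto simp: has_bochner_integral_iff)
  have [measurable]: "\<And>b. b \<in> Basis \<Longrightarrow> f b \<in> borel_measurable borel"
    using borel_measurable_integrable[OF int] by simp
  have m: "(\<lambda>g. \<Sum>b\<in>Basis. g b *\<^sub>R b) \<in> P \<rightarrow>\<^sub>M (borel :: 'a measure)" unfolding P_def by measurable
  have *: "(\<lambda>g. \<Prod>b\<in>Basis. f b ((\<Sum>b\<in>Basis. g b *\<^sub>R b) \<bullet> b)) = (\<lambda>g. \<Prod>b\<in>(Basis::'a set). f b (g b))"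
    by (intro ext prod.cong refl) (simp add: inner_sum_left inner_Basis if_distrib cong: if_cong)
  have "has_bochner_integral P (\<lambda>g. \<Prod>b\<in>(Basis::'a set). f b (g b)) (\<Prod>b\<in>Basis. F b)"
    unfolding P_def has_bochner_integral_iff using f
    by (auto intro!: product_integrable_prod int prod.cong simp: product_integral_prod[OF finite_Basis int] has_bochner_integral_integral_eq)
  then have "has_bochner_integral P (\<lambda>g. \<Prod>b\<in>Basis. f b ((\<Sum>b\<in>Basis. g b *\<^sub>R b) \<bullet> b)) (\<Prod>b\<in>Basis. F b)"
    by (simp only: *)
  then have "has_bochner_integral (distr P borel (\<lambda>g. \<Sum>b\<in>Basis. g b *\<^sub>R b)) (\<lambda>x. \<Prod>b\<in>(Basis::'a set). f b (x \<bullet> b)) (\<Prod>b\<in>Basis. F b)"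
    by (subst has_bochner_integral_distr[OF _ m]) auto
  then show ?thesis unfolding P_def lborel_eq[symmetric] .
qed


section \<open>The Weinstein measure and the transform of a centred Gaussian\<close>

text \<open>The density of the Weinstein measure with respect to \<open>lborel\<close> on the whole space. It lets
integrals of Borel functions over the half space be computed without the completion.\<close>

definition weinstein_weight :: "real \<Rightarrow> (real^'d::finite) \<times> real \<Rightarrow> real" where
  "weinstein_weight \<alpha> x = indicator half_space x *
     (snd x powr (2 * \<alpha> + 1) / ((2 * pi) powr (real CARD('d) / 2) * 2 powr \<alpha> * Gamma (\<alpha> + 1)))"

lemma borel_measurable_fst_snd [measurable]:
  "fst \<in> borel_measurable (borel :: ('a::second_countable_topology \<times> 'b::second_countable_topology) measure)"
  "snd \<in> borel_measurable (borel :: ('a::second_countable_topology \<times> 'b::second_countable_topology) measure)"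
  by (intro borel_measurable_continuous_onI continuous_intros)+

lemma half_space_borel [measurable]: "half_space \<in> sets borel"
  unfolding half_space_def by measurable

lemma half_space_lebesgue [measurable]: "half_space \<in> sets lebesgue"
  by (simp add: half_space_borel)

lemma weinstein_weight_measurable [measurable]: "weinstein_weight \<alpha> \<in> borel_measurable borel"
  unfolding weinstein_weight_def by measurable

lemma space_weinstein_measure [simp]: "space (weinstein_measure \<alpha>) = half_space"
  by (simp add: weinstein_measure_def)

lemma sets_weinstein_measure: "sets (weinstein_measure \<alpha>) = sets (lebesgue_on half_space)"
  by (simp add: weinstein_measure_def)

lemma measurable_weinstein_ident: "(\<lambda>x. x) \<in> weinstein_measure \<alpha> \<rightarrow>\<^sub>M borel"
proof -
  have "(\<lambda>x. x) \<in> lebesgue_on half_space \<rightarrow>\<^sub>M (borel :: ((real^'d) \<times> real) measure)"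
    by (intro measurable_restrict_space1 measurable_completion) simp
  then show ?thesis by (simp add: measurable_def sets_weinstein_measure)
qed

lemma measurable_weinstein_borel: "f \<in> borel \<rightarrow>\<^sub>M N \<Longrightarrow> f \<in> weinstein_measure \<alpha> \<rightarrow>\<^sub>M N"
  by (rule measurable_compose[OF measurable_weinstein_ident])

lemma has_bochner_integral_weinstein:
  fixes f :: "(real^'d::finite) \<times> real \<Rightarrow> 'b::{banach, second_countable_topology}"
  assumes a: "\<alpha> > - 1 / 2" and f [measurable]: "f \<in> borel_measurable borel"
  shows "has_bochner_integral (weinstein_measure \<alpha>) f y \<longleftrightarrow>
     has_bochner_integral lborel (\<lambda>x. weinstein_weight \<alpha> x *\<^sub>R f x) y"
proof -
  let ?c = "(2 * pi) powr (real CARD('d) / 2) * 2 powr \<alpha> * Gamma (\<alpha> + 1)"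
  let ?w = "\<lambda>x::(real^'d) \<times> real. snd x powr (2 * \<alpha> + 1) / ?c"
  have w: "?w x \<ge> 0" for x using a by (auto intro!: divide_nonneg_nonneg mult_nonneg_nonneg Gamma_real_nonneg)
  have m: "g \<in> borel_measurable borel \<Longrightarrow> g \<in> borel_measurable (lebesgue_on half_space)" for g :: "(real^'d) \<times> real \<Rightarrow> 'c::topological_space"
    by (intro measurable_restrict_space1 measurable_completion) simp
  have e: "indicator half_space x *\<^sub>R ?w x *\<^sub>R f x = weinstein_weight \<alpha> x *\<^sub>R f x" for x
    by (simp add: weinstein_weight_def)
  have e': "indicator half_space x * snd x powr (2 * \<alpha> + 1) / ?c = weinstein_weight \<alpha> x" for x :: "(real^'d) \<times> real"
    by (simp add: weinstein_weight_def)
  have "integrable (weinstein_measure \<alpha>) f \<longleftrightarrow> integrable lborel (\<lambda>x. weinstein_weight \<alpha> x *\<^sub>R f x)"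
    unfolding weinstein_measure_def
    by (subst integrable_density) (auto simp: w e e' m integrable_restrict_space integrable_completion)
  moreover have "integral\<^sup>L (weinstein_measure \<alpha>) f = integral\<^sup>L lborel (\<lambda>x. weinstein_weight \<alpha> x *\<^sub>R f x)"
    unfolding weinstein_measure_def
    by (subst integral_density) (auto simp: w e e' m integral_restrict_space integral_completion)
  ultimately show ?thesis by (simp add: has_bochner_integral_iff)
qed

lemma weinstein_kernel_commute: "weinstein_kernel \<alpha> x y = weinstein_kernel \<alpha> y x"
  by (simp add: weinstein_kernel_def inner_commute mult.commute)

lemma norm_weinstein_kernel_le_1: "\<alpha> > - 1 / 2 \<Longrightarrow> norm (weinstein_kernel \<alpha> x y) \<le> 1"
  using abs_normalized_bessel_le_1[of \<alpha> "snd y * snd x"]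
  by (simp add: weinstein_kernel_def norm_mult)

lemma weinstein_kernel_measurable_borel [measurable]:
  "(\<lambda>p. weinstein_kernel \<alpha> (fst p) (snd p)) \<in> borel_measurable (borel \<Otimes>\<^sub>M borel)"
  unfolding weinstein_kernel_def by measurable

text \<open>Gaussians centred at points \<open>(a, 0)\<close>, written with \<open>b = s a\<close>: in this form the product of two
of them is again one of them.\<close>

definition gaussian :: "real \<Rightarrow> real^'d \<Rightarrow> (real^'d::finite) \<times> real \<Rightarrow> real" where
  "gaussian s b x = exp (- (s * (x \<bullet> x)) / 2 + b \<bullet> fst x)"

lemma gaussian_measurable [measurable]: "gaussian s b \<in> borel_measurable borel"
  unfolding gaussian_def by measurable

lemma prod_Basis_prod:
  fixes f :: "'a::euclidean_space \<times> real \<Rightarrow> complex"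
  shows "(\<Prod>b\<in>Basis. f b) = (\<Prod>b\<in>Basis. f (b, 0)) * f (0, 1)"
proof -
  have "(\<Prod>b\<in>Basis. f b) = (\<Prod>b\<in>(\<lambda>u. (u, 0)) ` (Basis :: 'a set). f b) * (\<Prod>b\<in>(\<lambda>v. (0, v)) ` (Basis :: real set). f b)"
    unfolding Basis_prod_def by (subst prod.union_disjoint) auto
  also have "(\<Prod>b\<in>(\<lambda>u. (u, 0)) ` (Basis :: 'a set). f b) = (\<Prod>b\<in>Basis. f (b, 0))"
    by (subst prod.reindex) (auto simp: inj_on_def)
  finally show ?thesis by simp
qed

definition gaussian_factor :: "real \<Rightarrow> 'd::finite itself \<Rightarrow> real \<Rightarrow> real" where
  "gaussian_factor \<alpha> d s = s powr - (real CARD('d) / 2 + \<alpha> + 1)"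

lemma gaussian_factor_inverse: "s > 0 \<Longrightarrow> gaussian_factor \<alpha> d s * gaussian_factor \<alpha> d (1 / s) = 1"
  by (simp add: gaussian_factor_def powr_divide)

text \<open>The integrand is a product of functions of the single coordinates: \<open>d\<close> Fourier integrals of
Gaussians and one Hankel integral.\<close>

lemma has_bochner_integral_gaussian_kernel:
  fixes y :: "real^'d::finite" and \<rho> :: real
  assumes a: "\<alpha> > - 1 / 2" and s: "s > 0"
  shows "has_bochner_integral (weinstein_measure \<alpha>)
     (\<lambda>x. complex_of_real (gaussian s 0 x) * weinstein_kernel \<alpha> x (y, \<rho>))
     (complex_of_real (gaussian_factor \<alpha> TYPE('d) s * gaussian (1 / s) 0 (y, \<rho>)))"
proof -
  let ?c = "(2 * pi) powr (real CARD('d) / 2) * 2 powr \<alpha> * Gamma (\<alpha> + 1)"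
  have G: "Gamma (\<alpha> + 1) > 0" using a by (intro Gamma_real_pos) auto
  define g where "g u t = complex_of_real (exp (- (s * t\<^sup>2) / 2)) * exp (- \<i> * complex_of_real (t * u))" for u t :: real
  define h where "h t = complex_of_real (indicator {0<..} t * (t powr (2 * \<alpha> + 1) * exp (- (s * t\<^sup>2) / 2)) * normalized_bessel \<alpha> (t * \<rho>))" for t
  define f where "f b = (if b = (0, 1) then h else g (fst b \<bullet> y))" for b :: "(real^'d) \<times> real"
  define F where "F b = complex_of_real (if b = (0, 1) then 2 powr \<alpha> * Gamma (\<alpha> + 1) / s powr (\<alpha> + 1) * exp (- \<rho>\<^sup>2 / (2 * s))
      else sqrt (2 * pi / s) * exp (- (fst b \<bullet> y)\<^sup>2 / (2 * s)))" for b :: "(real^'d) \<times> real"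
  have nz: "(b, 0) \<noteq> (0, 1::real)" for b :: "real^'d" by simp
  have fF: "has_bochner_integral lborel (f b) (F b)" for b
    using has_bochner_integral_gaussian_fourier[OF s, of "fst b \<bullet> y"]
      has_bochner_integral_of_real[where 'a=complex, OF has_bochner_integral_hankel_gaussian[OF a s, of \<rho>]]
    by (auto simp: f_def F_def g_def[abs_def] h_def[abs_def])
  have 1: "has_bochner_integral lborel (\<lambda>x. \<Prod>b\<in>Basis. f b (x \<bullet> b)) (\<Prod>b\<in>Basis. F b)"
    by (rule has_bochner_integral_lborel_prod) (rule fF)
  have sq: "(\<Sum>b\<in>Basis. (z \<bullet> b)\<^sup>2) = z \<bullet> z" for z :: "real^'d"
    by (simp add: euclidean_inner[of z z] power2_eq_square)
  have "(\<Prod>b\<in>Basis. F b) = complex_of_real ((\<Prod>b\<in>(Basis :: (real^'d) set). sqrt (2 * pi / s) * exp (- (y \<bullet> b)\<^sup>2 / (2 * s))) *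
     (2 powr \<alpha> * Gamma (\<alpha> + 1) / s powr (\<alpha> + 1) * exp (- \<rho>\<^sup>2 / (2 * s))))"
    by (simp add: prod_Basis_prod F_def inner_commute)
  also have "(\<Prod>b\<in>(Basis :: (real^'d) set). sqrt (2 * pi / s) * exp (- (y \<bullet> b)\<^sup>2 / (2 * s)))
     = (2 * pi / s) powr (real CARD('d) / 2) * exp (- (y \<bullet> y) / (2 * s))"
  proof -
    have "(\<Prod>b\<in>(Basis :: (real^'d) set). exp (- (y \<bullet> b)\<^sup>2 / (2 * s))) = exp (- (y \<bullet> y) / (2 * s))"
      by (simp add: exp_sum[symmetric] sum_divide_distrib[symmetric] sum_negf sq)
    moreover have "sqrt (2 * pi / s) ^ CARD('d) = (2 * pi / s) powr (real CARD('d) / 2)"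
      using s by (simp add: powr_half_sqrt[symmetric] powr_realpow[symmetric] powr_powr)
    ultimately show ?thesis by (simp add: prod.distrib)
  qed
  also have "((2 * pi / s) powr (real CARD('d) / 2) * exp (- (y \<bullet> y) / (2 * s))) *
     (2 powr \<alpha> * Gamma (\<alpha> + 1) / s powr (\<alpha> + 1) * exp (- \<rho>\<^sup>2 / (2 * s)))
     = ?c * (gaussian_factor \<alpha> TYPE('d) s * gaussian (1 / s) 0 (y, \<rho>))"
  proof -
    have "gaussian (1 / s) 0 (y, \<rho>) = exp (- (y \<bullet> y) / (2 * s)) * exp (- \<rho>\<^sup>2 / (2 * s))"
      by (simp add: gaussian_def exp_add[symmetric] add_divide_distrib power2_eq_square)
    moreover have "gaussian_factor \<alpha> TYPE('d) s = 1 / (s powr (real CARD('d) / 2) * s powr (\<alpha> + 1))"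
      by (simp only: gaussian_factor_def powr_add[symmetric] powr_minus_divide add.assoc)
    ultimately show ?thesis using s by (simp add: powr_divide)
  qed
  finally have FF: "(\<Prod>b\<in>Basis. F b) = complex_of_real (?c * (gaussian_factor \<alpha> TYPE('d) s * gaussian (1 / s) 0 (y, \<rho>)))" .
  have ff: "(\<Prod>b\<in>Basis. f b (x \<bullet> b)) = complex_of_real ?c * (weinstein_weight \<alpha> x *\<^sub>R (complex_of_real (gaussian s 0 x) * weinstein_kernel \<alpha> x (y, \<rho>)))" for x
  proof -
    have "(\<Prod>b\<in>Basis. f b (x \<bullet> b)) = (\<Prod>b\<in>Basis. g (b \<bullet> y) (fst x \<bullet> b)) * h (snd x)"
      by (simp add: prod_Basis_prod f_def inner_prod_def)
    also have "(\<Prod>b\<in>Basis. g (b \<bullet> y) (fst x \<bullet> b)) = complex_of_real (exp (- (s * (fst x \<bullet> fst x)) / 2)) * exp (- \<i> * complex_of_real (fst x \<bullet> y))"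
    proof -
      have "(\<Prod>b\<in>Basis. exp (- (s * (fst x \<bullet> b)\<^sup>2) / 2)) = exp (- (s * (fst x \<bullet> fst x)) / 2)"
        by (simp add: exp_sum[symmetric] sum_divide_distrib[symmetric] sum_negf sum_distrib_left[symmetric] sq)
      moreover have xy: "(\<Sum>b\<in>Basis. (fst x \<bullet> b) * (b \<bullet> y)) = fst x \<bullet> y"
        by (simp add: euclidean_inner[of "fst x" y] inner_commute[of y])
      moreover have "(\<Prod>b\<in>Basis. exp (- \<i> * complex_of_real ((fst x \<bullet> b) * (b \<bullet> y)))) = exp (- \<i> * complex_of_real (fst x \<bullet> y))"
        by (simp only: exp_sum[OF finite_Basis, symmetric] sum_distrib_left[symmetric] of_real_sum[symmetric] xy)
      ultimately show ?thesis
        unfolding g_def prod.distrib of_real_prod[symmetric] by simp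
    qed
    also have "\<dots> * h (snd x) = complex_of_real ?c * (weinstein_weight \<alpha> x *\<^sub>R (complex_of_real (gaussian s 0 x) * weinstein_kernel \<alpha> x (y, \<rho>)))"
    proof -
      have "gaussian s 0 x = exp (- (s * (fst x \<bullet> fst x)) / 2) * exp (- (s * (snd x)\<^sup>2) / 2)"
        by (simp add: gaussian_def exp_add[symmetric] inner_prod_def add_divide_distrib distrib_left power2_eq_square)
      then show ?thesis using G
        by (simp add: h_def weinstein_kernel_def weinstein_weight_def half_space_def indicator_def inner_commute mult.commute scaleR_conv_of_real)
    qed
    finally show ?thesis .
  qed
  have c: "complex_of_real ?c \<noteq> 0" using G by simp
  have [measurable]: "(\<lambda>x. weinstein_kernel \<alpha> x (y, \<rho>)) \<in> borel_measurable borel"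
    unfolding weinstein_kernel_def by measurable
  from 1 have "has_bochner_integral lborel (\<lambda>x. (1 / complex_of_real ?c) * (\<Prod>b\<in>Basis. f b (x \<bullet> b))) ((1 / complex_of_real ?c) * (\<Prod>b\<in>Basis. F b))"
    by (rule has_bochner_integral_mult_right)
  then show ?thesis
    unfolding FF ff using c
    by (subst has_bochner_integral_weinstein[OF a]) (auto simp: mult.assoc[symmetric])
qed


section \<open>Bounded symmetric kernels and Plancherel's inequality\<close>

lemma cnj_measurable [measurable]: "cnj \<in> borel_measurable borel"
  by (intro borel_measurable_continuous_onI continuous_intros)

definition integrable_bounded :: "'a measure \<Rightarrow> ('a \<Rightarrow> complex) \<Rightarrow> bool" where
  "integrable_bounded M f \<longleftrightarrow> integrable M f \<and> (\<exists>B. \<forall>x\<in>space M. norm (f x) \<le> B)"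

lemma integrable_boundedD [dest]: "integrable_bounded M f \<Longrightarrow> integrable M f"
  by (simp add: integrable_bounded_def)

lemma integrable_bounded_add:
  "integrable_bounded M f \<Longrightarrow> integrable_bounded M g \<Longrightarrow> integrable_bounded M (\<lambda>x. f x + g x)"
  unfolding integrable_bounded_def
  by (auto intro: order_trans[OF norm_triangle_ineq add_mono])

lemma integrable_bounded_mult: "integrable_bounded M f \<Longrightarrow> integrable_bounded M (\<lambda>x. c * f x)"
  unfolding integrable_bounded_def
  by (auto simp: norm_mult) (meson mult_left_mono norm_ge_zero)

lemma integrable_mult_integrable_bounded:
  assumes f: "integrable_bounded M f" and g: "g \<in> borel_measurable M" "\<And>x. x \<in> space M \<Longrightarrow> norm (g x) \<le> B"
  shows "integrable M (\<lambda>x. f x * g x)"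
proof (rule Bochner_Integration.integrable_bound)
  have f': "integrable M f" using f by auto
  note [measurable] = borel_measurable_integrable[OF f'] g(1)
  show "integrable M (\<lambda>x. of_real B * f x)" using f' by simp
  show "(\<lambda>x. f x * g x) \<in> borel_measurable M" by measurable
  show "AE x in M. norm (f x * g x) \<le> norm (of_real B * f x)"
  proof (intro AE_I2)
    fix x assume "x \<in> space M"
    with g(2)[of x] have "norm (g x) * norm (f x) \<le> \<bar>B\<bar> * norm (f x)" by (intro mult_right_mono) auto
    then show "norm (f x * g x) \<le> norm (of_real B * f x)" by (simp add: norm_mult mult.commute)
  qed
qed

lemma nn_integral_norm_square:
  assumes "integrable M (\<lambda>x. f x * cnj (f x))"
  shows "(\<integral>\<^sup>+x. ennreal ((norm (f x))\<^sup>2) \<partial>M) = ennreal (Re (\<integral>x. f x * cnj (f x) \<partial>M))"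
proof -
  have e: "f x * cnj (f x) = complex_of_real ((norm (f x))\<^sup>2)" for x by (rule complex_norm_square[symmetric])
  have "integrable M (\<lambda>x. (norm (f x))\<^sup>2)" using integrable_Re[OF assms] by (simp add: e)
  then show ?thesis
    unfolding e integral_complex_of_real Re_complex_of_real by (subst nn_integral_eq_integral) auto
qed

text \<open>This measures the size of a function in \<open>L\<^sup>1\<close> and in \<open>L\<^sup>2\<close> at once. It is not a norm, but tends
to zero exactly if both norms do.\<close>

definition l12 :: "'a measure \<Rightarrow> ('a \<Rightarrow> complex) \<Rightarrow> ennreal" where
  "l12 M f = (\<integral>\<^sup>+x. ennreal (norm (f x) + (norm (f x))\<^sup>2) \<partial>M)"

text \<open>The operator \<open>T\<close> below is the transform with kernel \<open>K\<close>, and \<open>T'\<close> the one with the conjugate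
kernel, which is its adjoint and, in the end, its inverse.\<close>

locale symmetric_kernel = sigma_finite_measure M for M :: "'a measure" +
  fixes K :: "'a \<Rightarrow> 'a \<Rightarrow> complex"
  assumes kernel_measurable [measurable]: "(\<lambda>p. K (fst p) (snd p)) \<in> borel_measurable (M \<Otimes>\<^sub>M M)"
    and kernel_commute: "K x y = K y x"
    and norm_kernel_le_1: "x \<in> space M \<Longrightarrow> y \<in> space M \<Longrightarrow> norm (K x y) \<le> 1"
begin

definition T :: "('a \<Rightarrow> complex) \<Rightarrow> 'a \<Rightarrow> complex" where
  "T f y = (\<integral>x. f x * K x y \<partial>M)"

definition T' :: "('a \<Rightarrow> complex) \<Rightarrow> 'a \<Rightarrow> complex" where
  "T' f y = (\<integral>x. f x * cnj (K x y) \<partial>M)"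

lemma T'_conv_T: "T' f y = cnj (T (\<lambda>x. cnj (f x)) y)"
  by (simp add: T'_def T_def Bochner_Integration.integral_cnj[symmetric] del: Bochner_Integration.integral_cnj)

lemma kernel_section_measurable: "y \<in> space M \<Longrightarrow> (\<lambda>x. K x y) \<in> borel_measurable M"
proof -
  assume y: "y \<in> space M"
  have "(\<lambda>x. (x, y)) \<in> M \<rightarrow>\<^sub>M M \<Otimes>\<^sub>M M" using y by measurable
  from measurable_compose[OF this kernel_measurable] show ?thesis by simp
qed

lemma T_measurable [measurable]:
  assumes [measurable]: "f \<in> borel_measurable M"
  shows "T f \<in> borel_measurable M"
proof -
  have "(\<lambda>p. f (snd p) * K (fst p) (snd p)) \<in> borel_measurable (M \<Otimes>\<^sub>M M)" by measurable
  then have "(\<lambda>y. \<integral>x. f x * K y x \<partial>M) \<in> borel_measurable M"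
    by (intro borel_measurable_lebesgue_integral) (simp add: case_prod_beta)
  then show ?thesis unfolding T_def[abs_def] using kernel_commute by simp
qed

lemma T'_measurable [measurable]:
  assumes [measurable]: "f \<in> borel_measurable M"
  shows "T' f \<in> borel_measurable M"
  unfolding T'_conv_T[abs_def] by measurable

lemma integrable_mult_kernel:
  assumes "integrable M f" "y \<in> space M"
  shows "integrable M (\<lambda>x. f x * K x y)"
proof (rule Bochner_Integration.integrable_bound)
  note [measurable] = kernel_section_measurable[OF assms(2)] borel_measurable_integrable[OF assms(1)]
  show "integrable M (\<lambda>x. norm (f x))" using assms by simp
  show "(\<lambda>x. f x * K x y) \<in> borel_measurable M" by measurable
  show "AE x in M. norm (f x * K x y) \<le> norm (norm (f x))"
    using norm_kernel_le_1[OF _ assms(2)] by (intro AE_I2) (simp add: norm_mult mult_left_le)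
qed

lemma norm_T_le:
  assumes "integrable M f" "y \<in> space M"
  shows "norm (T f y) \<le> (\<integral>x. norm (f x) \<partial>M)"
  unfolding T_def
proof (rule order_trans[OF integral_norm_bound integral_mono])
  show "integrable M (\<lambda>x. norm (f x * K x y))" using integrable_mult_kernel[OF assms] by simp
  show "integrable M (\<lambda>x. norm (f x))" using assms by simp
  fix x assume "x \<in> space M"
  with norm_kernel_le_1[OF this assms(2)] show "norm (f x * K x y) \<le> norm (f x)"
    by (simp add: norm_mult mult_left_le)
qed

lemma norm_T'_le: "integrable M f \<Longrightarrow> y \<in> space M \<Longrightarrow> norm (T' f y) \<le> (\<integral>x. norm (f x) \<partial>M)"
  using norm_T_le[of "\<lambda>x. cnj (f x)" y] by (simp add: T'_conv_T)

lemma T_add: "integrable M f \<Longrightarrow> integrable M g \<Longrightarrow> y \<in> space M \<Longrightarrow> T (\<lambda>x. f x + g x) y = T f y + T g y"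
  using integrable_mult_kernel[of f y] integrable_mult_kernel[of g y] by (simp add: T_def distrib_right)

lemma T_diff: "integrable M f \<Longrightarrow> integrable M g \<Longrightarrow> y \<in> space M \<Longrightarrow> T (\<lambda>x. f x - g x) y = T f y - T g y"
  using integrable_mult_kernel[of f y] integrable_mult_kernel[of g y] by (simp add: T_def left_diff_distrib)

lemma T_mult: "T (\<lambda>x. c * f x) y = c * T f y"
  by (simp add: T_def mult.assoc)

lemma T'_add: "integrable M f \<Longrightarrow> integrable M g \<Longrightarrow> y \<in> space M \<Longrightarrow> T' (\<lambda>x. f x + g x) y = T' f y + T' g y"
  by (simp add: T'_conv_T T_add)

lemma T'_diff: "integrable M f \<Longrightarrow> integrable M g \<Longrightarrow> y \<in> space M \<Longrightarrow> T' (\<lambda>x. f x - g x) y = T' f y - T' g y"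
  by (simp add: T'_conv_T T_diff)

lemma T'_mult: "T' (\<lambda>x. c * f x) y = c * T' f y"
  by (simp add: T'_def mult.assoc)

lemma integrable_T_mult:
  assumes f: "integrable M f" and g: "integrable M g"
  shows "integrable M (\<lambda>y. T f y * g y)"
proof (rule Bochner_Integration.integrable_bound)
  note [measurable] = borel_measurable_integrable[OF f] borel_measurable_integrable[OF g]
  show "integrable M (\<lambda>y. (\<integral>x. norm (f x) \<partial>M) * norm (g y))" using g by simp
  show "(\<lambda>y. T f y * g y) \<in> borel_measurable M" by measurable
  show "AE y in M. norm (T f y * g y) \<le> norm ((\<integral>x. norm (f x) \<partial>M) * norm (g y))"
    using norm_T_le[OF f] by (intro AE_I2) (auto simp: norm_mult abs_mult intro!: mult_right_mono order_trans[OF _ abs_ge_self])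
qed

lemma T_self_adjoint:
  assumes f: "integrable M f" and g: "integrable M g"
  shows "(\<integral>y. T f y * g y \<partial>M) = (\<integral>x. f x * T g x \<partial>M)"
proof -
  interpret P: pair_sigma_finite M M ..
  note [measurable] = borel_measurable_integrable[OF f] borel_measurable_integrable[OF g]
  have "integrable (M \<Otimes>\<^sub>M M) (\<lambda>(x, y). f x * K x y * g y)"
  proof (rule P.Fubini_integrable)
    have m: "(\<lambda>p. f (fst p) * K (fst p) (snd p) * g (snd p)) \<in> borel_measurable (M \<Otimes>\<^sub>M M)" by measurable
    then show m': "(\<lambda>(x, y). f x * K x y * g y) \<in> borel_measurable (M \<Otimes>\<^sub>M M)" by (simp add: case_prod_beta)
    have s: "integrable M (\<lambda>y. f x * K x y * g y)" if "x \<in> space M" for x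
      using integrable_mult_kernel[OF g that] kernel_commute[of x] by (simp add: mult.assoc mult.commute[of "g _"])
    then show "AE x in M. integrable M (\<lambda>y. case (x, y) of (x, y) \<Rightarrow> f x * K x y * g y)" by (intro AE_I2) simp
    show "integrable M (\<lambda>x. \<integral>y. norm (case (x, y) of (x, y) \<Rightarrow> f x * K x y * g y) \<partial>M)"
    proof (rule Bochner_Integration.integrable_bound)
      show "integrable M (\<lambda>x. norm (f x) * (\<integral>y. norm (g y) \<partial>M))" using f by simp
      show "(\<lambda>x. \<integral>y. norm (case (x, y) of (x, y) \<Rightarrow> f x * K x y * g y) \<partial>M) \<in> borel_measurable M"
        using m by (intro borel_measurable_lebesgue_integral) (simp add: case_prod_beta)
      show "AE x in M. norm (\<integral>y. norm (case (x, y) of (x, y) \<Rightarrow> f x * K x y * g y) \<partial>M) \<le> norm (norm (f x) * (\<integral>y. norm (g y) \<partial>M))"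
      proof (intro AE_I2)
        fix x assume x: "x \<in> space M"
        have "(\<integral>y. norm (f x * K x y * g y) \<partial>M) \<le> (\<integral>y. norm (f x) * norm (g y) \<partial>M)"
        proof (rule integral_mono)
          show "integrable M (\<lambda>y. norm (f x * K x y * g y))" using s[OF x] by simp
          show "integrable M (\<lambda>y. norm (f x) * norm (g y))" using g by simp
          fix y assume "y \<in> space M"
          from norm_kernel_le_1[OF x this] show "norm (f x * K x y * g y) \<le> norm (f x) * norm (g y)"
            by (auto simp: norm_mult mult_left_le intro!: mult_right_mono)
        qed
        then show "norm (\<integral>y. norm (case (x, y) of (x, y) \<Rightarrow> f x * K x y * g y) \<partial>M) \<le> norm (norm (f x) * (\<integral>y. norm (g y) \<partial>M))"
          by simp
      qed
    qed
  qed
  from P.Fubini_integral[OF this]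
  have "(\<integral>y. (\<integral>x. f x * K x y * g y \<partial>M) \<partial>M) = (\<integral>x. (\<integral>y. f x * K x y * g y \<partial>M) \<partial>M)" by simp
  moreover have "(\<integral>y. f x * K x y * g y \<partial>M) = f x * T g x" for x
    unfolding T_def by (simp add: mult.assoc mult.commute[of "g _"] kernel_commute[of x])
  moreover have "(\<integral>x. f x * K x y * g y \<partial>M) = T f y * g y" for y
    unfolding T_def by (rule integral_mult_left_zero)
  ultimately show ?thesis by (simp only:)
qed

lemma T'_self_adjoint:
  assumes f: "integrable M f" and g: "integrable M g"
  shows "(\<integral>y. T' f y * g y \<partial>M) = (\<integral>x. f x * T' g x \<partial>M)"
proof -
  have "cnj (\<integral>y. T' f y * g y \<partial>M) = cnj (\<integral>x. f x * T' g x \<partial>M)"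
    using T_self_adjoint[of "\<lambda>x. cnj (f x)" "\<lambda>x. cnj (g x)"] f g
    by (simp add: T'_conv_T Bochner_Integration.integral_cnj[symmetric] del: Bochner_Integration.integral_cnj)
  then show ?thesis by simp
qed

text \<open>A function is called inverted if the inversion formula is known for it, with all functions
involved bounded and integrable. For these functions Plancherel's identity is formal.\<close>

definition inverted :: "('a \<Rightarrow> complex) \<Rightarrow> bool" where
  "inverted h \<longleftrightarrow> integrable_bounded M h \<and> (\<exists>k. integrable_bounded M k \<and>
     (\<forall>x\<in>space M. T k x = h x) \<and> (\<forall>x\<in>space M. T' h x = k x))"

lemma inverted_add: "inverted f \<Longrightarrow> inverted g \<Longrightarrow> inverted (\<lambda>x. f x + g x)"
  unfolding inverted_def
  apply (safe intro!: integrable_bounded_add)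
  subgoal for k l
    by (rule exI[of _ "\<lambda>x. k x + l x"]) (auto intro!: integrable_bounded_add simp: T_add T'_add integrable_boundedD)
  done

lemma inverted_mult: "inverted f \<Longrightarrow> inverted (\<lambda>x. c * f x)"
  unfolding inverted_def
  apply (safe intro!: integrable_bounded_mult)
  subgoal for k
    by (rule exI[of _ "\<lambda>x. c * k x"]) (auto intro!: integrable_bounded_mult simp: T_mult T'_mult)
  done

lemma inverted_Plancherel:
  assumes "inverted h"
  shows "(\<integral>\<^sup>+x. ennreal ((norm (T' h x))\<^sup>2) \<partial>M) = (\<integral>\<^sup>+x. ennreal ((norm (h x))\<^sup>2) \<partial>M)"
proof -
  from assms obtain k where h: "integrable_bounded M h" and k: "integrable_bounded M k"
    and Tk: "\<And>x. x \<in> space M \<Longrightarrow> T k x = h x" and Th: "\<And>x. x \<in> space M \<Longrightarrow> T' h x = k x"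
    by (auto simp: inverted_def)
  have sq: "integrable M (\<lambda>x. f x * cnj (f x))" if "integrable_bounded M f" for f
  proof -
    from that obtain B where "\<forall>x\<in>space M. norm (f x) \<le> B" by (auto simp: integrable_bounded_def)
    with that show ?thesis by (intro integrable_mult_integrable_bounded[of M f _ B]) auto
  qed
  have "(\<integral>x. k x * cnj (k x) \<partial>M) = (\<integral>x. T' h x * cnj (k x) \<partial>M)"
    by (intro Bochner_Integration.integral_cong) (auto simp: Th)
  also have "\<dots> = (\<integral>x. h x * T' (\<lambda>x. cnj (k x)) x \<partial>M)"
    using h k by (intro T'_self_adjoint) auto
  also have "\<dots> = (\<integral>x. h x * cnj (h x) \<partial>M)"
    by (intro Bochner_Integration.integral_cong) (auto simp: T'_conv_T Tk)
  finally have "(\<integral>x. k x * cnj (k x) \<partial>M) = (\<integral>x. h x * cnj (h x) \<partial>M)" .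
  moreover have "(\<integral>\<^sup>+x. ennreal ((norm (T' h x))\<^sup>2) \<partial>M) = (\<integral>\<^sup>+x. ennreal ((norm (k x))\<^sup>2) \<partial>M)"
    by (intro nn_integral_cong) (simp add: Th)
  ultimately show ?thesis using nn_integral_norm_square[OF sq[OF h]] nn_integral_norm_square[OF sq[OF k]] by simp
qed

end

text \<open>A triangle inequality for squared norms whose first constant can be taken arbitrarily close to one.\<close>

lemma norm_add_square_le:
  fixes a b :: "'a::real_normed_vector"
  assumes "\<eta> > 0"
  shows "(norm (a + b))\<^sup>2 \<le> (1 + \<eta>) * (norm a)\<^sup>2 + (1 + 1 / \<eta>) * (norm b)\<^sup>2"
proof -
  have "(norm (a + b))\<^sup>2 \<le> (norm a + norm b)\<^sup>2" by (intro power_mono norm_triangle_ineq) auto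
  also have "\<dots> = (norm a)\<^sup>2 + (norm b)\<^sup>2 + 2 * (norm a * norm b)" by (simp add: power2_sum)
  also have "2 * (norm a * norm b) \<le> \<eta> * (norm a)\<^sup>2 + (norm b)\<^sup>2 / \<eta>"
  proof -
    have "0 \<le> (\<eta> * norm a - norm b)\<^sup>2 / \<eta>" using assms by simp
    also have "\<dots> = \<eta> * (norm a)\<^sup>2 + (norm b)\<^sup>2 / \<eta> - 2 * (norm a * norm b)"
      using assms by (simp add: power2_diff power_mult_distrib field_simps power2_eq_square)
    finally show ?thesis by simp
  qed
  finally show ?thesis by (simp add: algebra_simps)
qed

definition bounded_on :: "'a measure \<Rightarrow> 'a set \<Rightarrow> ('a \<Rightarrow> complex) \<Rightarrow> bool" where
  "bounded_on M A f \<longleftrightarrow> f \<in> borel_measurable M \<and> (\<exists>B. \<forall>x\<in>space M. norm (f x) \<le> B) \<and> (\<forall>x\<in>space M - A. f x = 0)"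

text \<open>What is asked of the inverted functions: they contain a set \<open>G\<close> which is dense among the bounded
functions supported in some \<open>E n\<close>, and which separates functions. The second property does
not follow from the first by duality, since \<open>F\<close> in \<open>G_total\<close> need not be square integrable.\<close>

locale plancherel_kernel = symmetric_kernel M K for M :: "'a measure" and K +
  fixes E :: "nat \<Rightarrow> 'a set" and G :: "('a \<Rightarrow> complex) set"
  assumes E_sets [measurable]: "E n \<in> sets M" and E_finite: "emeasure M (E n) < \<infinity>"
    and E_mono: "m \<le> n \<Longrightarrow> E m \<subseteq> E n" and E_exhaust: "(\<Union>n. E n) = space M"
    and G_inverted: "h \<in> G \<Longrightarrow> inverted h"
    and G_dense: "bounded_on M (E n) f \<Longrightarrow> 0 < e \<Longrightarrow> \<exists>h\<in>G. l12 M (\<lambda>x. f x - h x) < e"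
    and G_total: "F \<in> borel_measurable M \<Longrightarrow> (\<And>h. h \<in> G \<Longrightarrow> integrable M (\<lambda>x. F x * h x)) \<Longrightarrow>
      (\<And>h. h \<in> G \<Longrightarrow> (\<integral>x. F x * h x \<partial>M) = 0) \<Longrightarrow> AE x in M. F x = 0"
begin

lemma bounded_on_integrable:
  assumes "bounded_on M (E n) f"
  shows "integrable M f"
proof -
  from assms obtain B where B: "\<And>x. x \<in> space M \<Longrightarrow> norm (f x) \<le> B" and f[measurable]: "f \<in> borel_measurable M"
    and z: "\<And>x. x \<in> space M - E n \<Longrightarrow> f x = 0"
    unfolding bounded_on_def by blast
  show ?thesis
  proof (rule Bochner_Integration.integrable_bound)
    show "integrable M (\<lambda>x. B * indicator (E n) x)" using E_finite[of n] by simp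
    show "AE x in M. norm (f x) \<le> norm (B * indicator (E n) x)"
      using B z by (intro AE_I2) (auto simp: indicator_def intro: order_trans[OF _ abs_ge_self])
  qed fact
qed

text \<open>Approximate \<open>f\<close> by functions of \<open>G\<close> in \<open>L\<^sup>1\<close> and \<open>L\<^sup>2\<close>. Convergence in \<open>L\<^sup>1\<close> gives pointwise
convergence of the transforms, convergence in \<open>L\<^sup>2\<close> keeps their norms under control, and Fatou's
lemma passes to the limit.\<close>

lemma T'_contraction:
  assumes f: "bounded_on M (E n) f"
  shows "(\<integral>\<^sup>+x. ennreal ((norm (T' f x))\<^sup>2) \<partial>M) \<le> (\<integral>\<^sup>+x. ennreal ((norm (f x))\<^sup>2) \<partial>M)"
proof (cases "(\<integral>\<^sup>+x. ennreal ((norm (f x))\<^sup>2) \<partial>M) = \<infinity>")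
  case False
  then obtain A where A: "(\<integral>\<^sup>+x. ennreal ((norm (f x))\<^sup>2) \<partial>M) = ennreal A" "A \<ge> 0"
    by (cases "(\<integral>\<^sup>+x. ennreal ((norm (f x))\<^sup>2) \<partial>M)") auto
  have fi: "integrable M f" by (rule bounded_on_integrable[OF f])
  note [measurable] = borel_measurable_integrable[OF fi]
  have "\<forall>m. \<exists>h\<in>G. l12 M (\<lambda>x. f x - h x) < ennreal (1 / (real m + 1)\<^sup>2)"
    by (intro allI G_dense[OF f]) simp
  then obtain h where hG: "\<And>m. h m \<in> G" and hl: "\<And>m. l12 M (\<lambda>x. f x - h m x) < ennreal (1 / (real m + 1)\<^sup>2)"
    by metis
  have inv: "inverted (h m)" for m by (rule G_inverted[OF hG])
  then have hi: "integrable M (h m)" for m by (auto simp: inverted_def)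
  note [measurable] = borel_measurable_integrable[OF hi]
  have l1: "(\<integral>x. norm (f x - h m x) \<partial>M) \<le> 1 / (real m + 1)\<^sup>2" for m
  proof -
    have "ennreal (\<integral>x. norm (f x - h m x) \<partial>M) = (\<integral>\<^sup>+x. ennreal (norm (f x - h m x)) \<partial>M)"
      using fi hi[of m] by (subst nn_integral_eq_integral) auto
    also have "\<dots> \<le> l12 M (\<lambda>x. f x - h m x)"
      unfolding l12_def by (intro nn_integral_mono ennreal_leI) simp
    finally show ?thesis using hl[of m] by (meson ennreal_le_iff le_less_trans less_imp_le zero_le_divide_1_iff zero_le_power2)
  qed
  have l2: "(\<integral>\<^sup>+x. ennreal ((norm (f x - h m x))\<^sup>2) \<partial>M) \<le> ennreal (1 / (real m + 1)\<^sup>2)" for m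
  proof -
    have "(\<integral>\<^sup>+x. ennreal ((norm (f x - h m x))\<^sup>2) \<partial>M) \<le> l12 M (\<lambda>x. f x - h m x)"
      unfolding l12_def by (intro nn_integral_mono ennreal_leI) simp
    with hl[of m] show ?thesis by (meson le_less_trans less_imp_le)
  qed
  \<comment> \<open>With \<open>\<eta> = 1 / (m + 1)\<close>, the large constant \<open>1 + 1 / \<eta>\<close> is beaten by the error \<open>1 / (m + 1)\<^sup>2\<close>.\<close>
  have hn: "(\<integral>\<^sup>+x. ennreal ((norm (h m x))\<^sup>2) \<partial>M) \<le> ennreal ((1 + 1 / (real m + 1)) * A + (real m + 2) / (real m + 1)\<^sup>2)" for m
  proof -
    let ?\<eta> = "1 / (real m + 1)"
    have "(\<integral>\<^sup>+x. ennreal ((norm (h m x))\<^sup>2) \<partial>M) \<le>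
        (\<integral>\<^sup>+x. ennreal (1 + ?\<eta>) * ennreal ((norm (f x))\<^sup>2) + ennreal (1 + 1 / ?\<eta>) * ennreal ((norm (f x - h m x))\<^sup>2) \<partial>M)"
    proof (rule nn_integral_mono)
      fix x
      have "(norm (f x + (h m x - f x)))\<^sup>2 \<le> (1 + ?\<eta>) * (norm (f x))\<^sup>2 + (1 + 1 / ?\<eta>) * (norm (h m x - f x))\<^sup>2"
        by (rule norm_add_square_le) simp
      then show "ennreal ((norm (h m x))\<^sup>2) \<le> ennreal (1 + ?\<eta>) * ennreal ((norm (f x))\<^sup>2) + ennreal (1 + 1 / ?\<eta>) * ennreal ((norm (f x - h m x))\<^sup>2)"
        by (subst ennreal_mult[symmetric], simp, simp)+ (simp add: ennreal_plus[symmetric] norm_minus_commute del: ennreal_plus)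
    qed
    also have "\<dots> = ennreal (1 + ?\<eta>) * ennreal A + ennreal (1 + 1 / ?\<eta>) * (\<integral>\<^sup>+x. ennreal ((norm (f x - h m x))\<^sup>2) \<partial>M)"
      by (simp add: nn_integral_add nn_integral_cmult A)
    also have "\<dots> \<le> ennreal (1 + ?\<eta>) * ennreal A + ennreal (1 + 1 / ?\<eta>) * ennreal (1 / (real m + 1)\<^sup>2)"
      by (intro add_left_mono mult_left_mono l2) simp
    also have "\<dots> = ennreal ((1 + 1 / (real m + 1)) * A + (real m + 2) / (real m + 1)\<^sup>2)"
      using A(2) by (subst ennreal_mult[symmetric], simp, simp)+ (simp add: ennreal_plus[symmetric] del: ennreal_plus)
    finally show ?thesis .
  qed
  have lim: "(\<lambda>m. ennreal ((1 + 1 / (real m + 1)) * A + (real m + 2) / (real m + 1)\<^sup>2)) \<longlonglongrightarrow> ennreal A"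
    by (intro tendsto_ennrealI) real_asymp
  have conv: "(\<lambda>m. T' (h m) x) \<longlonglongrightarrow> T' f x" if x: "x \<in> space M" for x
  proof (rule LIM_zero_cancel, rule Lim_null_comparison)
    show "\<forall>\<^sub>F m in sequentially. norm (T' (h m) x - T' f x) \<le> 1 / (real m + 1)\<^sup>2"
    proof (intro always_eventually allI)
      fix m
      have "norm (T' (h m) x - T' f x) = norm (T' (\<lambda>x. f x - h m x) x)"
        using fi hi x by (simp add: T'_diff norm_minus_commute)
      also have "\<dots> \<le> 1 / (real m + 1)\<^sup>2"
        using norm_T'_le[OF Bochner_Integration.integrable_diff[OF fi hi[of m]] x] l1[of m] by (rule order_trans)
      finally show "norm (T' (h m) x - T' f x) \<le> 1 / (real m + 1)\<^sup>2" .
    qed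
    show "(\<lambda>m. 1 / (real m + 1)\<^sup>2) \<longlonglongrightarrow> 0" by real_asymp
  qed
  have "(\<integral>\<^sup>+x. ennreal ((norm (T' f x))\<^sup>2) \<partial>M) = (\<integral>\<^sup>+x. liminf (\<lambda>m. ennreal ((norm (T' (h m) x))\<^sup>2)) \<partial>M)"
    by (intro nn_integral_cong lim_imp_Liminf[symmetric] tendsto_ennrealI tendsto_intros conv) auto
  also have "\<dots> \<le> liminf (\<lambda>m. \<integral>\<^sup>+x. ennreal ((norm (T' (h m) x))\<^sup>2) \<partial>M)"
    by (rule nn_integral_liminf) measurable
  also have "\<dots> = liminf (\<lambda>m. \<integral>\<^sup>+x. ennreal ((norm (h m x))\<^sup>2) \<partial>M)"
    by (simp add: inverted_Plancherel[OF inv])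
  also have "\<dots> \<le> liminf (\<lambda>m. ennreal ((1 + 1 / (real m + 1)) * A + (real m + 2) / (real m + 1)\<^sup>2))"
    by (intro Liminf_mono always_eventually allI hn)
  also have "\<dots> = ennreal A" by (rule lim_imp_Liminf[OF _ lim]) simp
  finally show ?thesis using A by simp
qed simp

lemma T_contraction:
  assumes f: "bounded_on M (E n) f"
  shows "(\<integral>\<^sup>+x. ennreal ((norm (T f x))\<^sup>2) \<partial>M) \<le> (\<integral>\<^sup>+x. ennreal ((norm (f x))\<^sup>2) \<partial>M)"
proof -
  have "bounded_on M (E n) (\<lambda>x. cnj (f x))" using f unfolding bounded_on_def by (auto intro!: measurable_compose[OF _ cnj_measurable])
  from T'_contraction[OF this] show ?thesis by (simp add: T'_conv_T)
qed

end


section \<open>A monotone class theorem for polynomials in given functions\<close>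

text \<open>Polynomials give continuous functions by Stone--Weierstrass on the compact closure of the range
of \<open>\<Phi>\<close>, these give indicators of open sets, then of Borel sets by Dynkin's lemma, and finally
bounded Borel functions. Only limits of uniformly bounded sequences are used, which is what
dominated convergence can supply in the two applications.\<close>

lemma bounded_class_contains_borel:
  fixes \<Phi> :: "'a \<Rightarrow> 'b::euclidean_space" and V :: "('a \<Rightarrow> real) set" and v :: "'b \<Rightarrow> real"
  assumes bdd: "bounded (range \<Phi>)"
    and poly: "\<And>p. real_polynomial_function p \<Longrightarrow> (\<lambda>x. p (\<Phi> x)) \<in> V"
    and add: "\<And>u v. u \<in> V \<Longrightarrow> v \<in> V \<Longrightarrow> (\<lambda>x. u x + v x) \<in> V"
    and scale: "\<And>c u. u \<in> V \<Longrightarrow> (\<lambda>x. c * u x) \<in> V"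
    and lim: "\<And>u w B. (\<And>n::nat. u n \<in> V) \<Longrightarrow> (\<And>n x. \<bar>u n x\<bar> \<le> B) \<Longrightarrow>
        (\<And>x. (\<lambda>n. u n x) \<longlonglongrightarrow> w x) \<Longrightarrow> w \<in> V"
    and v: "v \<in> borel_measurable borel" "\<And>y. 0 \<le> v y" "\<And>y. v y \<le> B"
  shows "(\<lambda>x. v (\<Phi> x)) \<in> V"
proof -
  define S where "S = closure (range \<Phi>)"
  have S: "compact S" unfolding S_def compact_closure by (rule bdd)
  have inS: "\<Phi> x \<in> S" for x unfolding S_def by (rule subsetD[OF closure_subset]) (rule rangeI)
  have cont: "(\<lambda>x. g (\<Phi> x)) \<in> V" if g: "continuous_on UNIV g" for g :: "'b \<Rightarrow> real"
  proof -
    have gS: "continuous_on S g" using g continuous_on_subset by blast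
    have "\<exists>p. real_polynomial_function p \<and> (\<forall>y\<in>S. \<bar>g y - p y\<bar> < 1 / (real n + 1))" for n
      by (rule Stone_Weierstrass_real_polynomial_function[OF S gS, of "1 / (real n + 1)"]) auto
    then obtain p where p: "\<And>n. real_polynomial_function (p n)"
      and gp: "\<And>n y. y \<in> S \<Longrightarrow> \<bar>g y - p n y\<bar> < 1 / (real n + 1)" by metis
    obtain C where C: "\<And>y. y \<in> S \<Longrightarrow> \<bar>g y\<bar> \<le> C"
      using compact_imp_bounded[OF compact_continuous_image[OF gS S]] by (auto simp: bounded_iff)
    show ?thesis
    proof (rule lim[where u="\<lambda>n x. p n (\<Phi> x)" and B="C + 1"])
      show "(\<lambda>x. p n (\<Phi> x)) \<in> V" for n by (rule poly[OF p])
      show "\<bar>p n (\<Phi> x)\<bar> \<le> C + 1" for n x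
      proof -
        have "1 / (real n + 1) \<le> 1" by simp
        with gp[OF inS[of x], of n] C[OF inS[of x]] show ?thesis by linarith
      qed
      show "(\<lambda>n. p n (\<Phi> x)) \<longlonglongrightarrow> g (\<Phi> x)" for x
      proof (rule LIM_zero_cancel, rule Lim_null_comparison)
        show "\<forall>\<^sub>F n in sequentially. norm (p n (\<Phi> x) - g (\<Phi> x)) \<le> 1 / (real n + 1)"
          using gp[OF inS[of x]] by (intro always_eventually allI) (simp add: abs_minus_commute less_imp_le)
        show "(\<lambda>n. 1 / (real n + 1)) \<longlonglongrightarrow> 0" by real_asymp
      qed
    qed
  qed
  have const: "(\<lambda>x. c) \<in> V" for c :: real using cont[of "\<lambda>_. c"] by simp
  have open_ind: "(\<lambda>x. indicator U (\<Phi> x)) \<in> V" if U: "open U" for U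
  proof (cases "U = UNIV")
    case True then show ?thesis using const[of 1] by simp
  next
    case False
    \<comment> \<open>Continuous functions that increase to the indicator of \<open>U\<close>.\<close>
    define g where "g n y = min 1 (real n * infdist y (- U))" for n y
    show ?thesis
    proof (rule lim[where u="\<lambda>n x. g n (\<Phi> x)" and B=1])
      show "(\<lambda>x. g n (\<Phi> x)) \<in> V" for n
        unfolding g_def by (intro cont continuous_intros)
      show "\<bar>g n (\<Phi> x)\<bar> \<le> 1" for n x
        using mult_nonneg_nonneg[OF of_nat_0_le_iff[of n] infdist_nonneg[of "\<Phi> x" "- U"]] by (simp add: g_def abs_if min_def)
      show "(\<lambda>n. g n (\<Phi> x)) \<longlonglongrightarrow> indicator U (\<Phi> x)" for x
      proof (cases "\<Phi> x \<in> U")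
        case False
        then show ?thesis by (simp add: g_def)
      next
        case True
        then have "infdist (\<Phi> x) (- U) \<noteq> 0"
          using U \<open>U \<noteq> UNIV\<close> in_closed_iff_infdist_zero[of "- U" "\<Phi> x"] by auto
        then have i: "infdist (\<Phi> x) (- U) > 0" using infdist_nonneg[of "\<Phi> x" "- U"] by linarith
        obtain N where N: "real N * infdist (\<Phi> x) (- U) > 1"
          using reals_Archimedean3[OF i] by blast
        have "g n (\<Phi> x) = 1" if "n \<ge> N" for n
        proof -
          have "real N * infdist (\<Phi> x) (- U) \<le> real n * infdist (\<Phi> x) (- U)"
            using that i by (intro mult_right_mono) auto
          then show ?thesis using N by (simp add: g_def)
        qed
        then show ?thesis
          using True by (intro tendsto_eventually) (auto simp: eventually_sequentially)
      qed
    qed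
  qed
  have ind: "(\<lambda>x. indicator A (\<Phi> x)) \<in> V" if A: "A \<in> sets borel" for A
  proof -
    have "Int_stable {U::'b set. open U}" by (auto simp: Int_stable_def)
    moreover have "{U::'b set. open U} \<subseteq> Pow UNIV" by auto
    moreover have "A \<in> sigma_sets UNIV {U. open U}" using A by (simp add: borel_def)
    ultimately show ?thesis
    proof (induction rule: sigma_sets_induct_disjoint)
      case (basic A) then show ?case using open_ind by auto
    next
      case empty then show ?case using const[of 0] by simp
    next
      case (compl A)
      have "(\<lambda>x. 1 + (- 1) * indicator A (\<Phi> x)) \<in> V" by (intro add const scale compl.IH)
      also have "(\<lambda>x. 1 + (- 1) * indicator A (\<Phi> x)) = (\<lambda>x. indicator (UNIV - A) (\<Phi> x) :: real)"
        by (auto simp: indicator_def fun_eq_iff)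
      finally show ?case .
    next
      case (union A)
      have s: "(\<lambda>x. \<Sum>i<n. indicator (A i) (\<Phi> x)) \<in> V" for n
      proof (induction n)
        case 0 then show ?case using const[of 0] by simp
      next
        case (Suc n) from add[OF this union.IH[of n]] show ?case by simp
      qed
      have e: "(\<Sum>i<n. indicator (A i) y) = (indicator (\<Union>i<n. A i) y :: real)" for n y
        by (rule indicator_UN_disjoint[symmetric]) (use union(1) in \<open>auto simp: disjoint_family_on_def\<close>)
      show ?case
      proof (rule lim[OF s, where B=1])
        show "\<bar>\<Sum>i<n. indicator (A i) (\<Phi> x)\<bar> \<le> (1::real)" for n x
          unfolding e by (simp add: indicator_def)
        show "(\<lambda>n. \<Sum>i<n. indicator (A i) (\<Phi> x)) \<longlonglongrightarrow> (indicator (\<Union>i. A i) (\<Phi> x) :: real)" for x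
          unfolding e by (rule LIMSEQ_indicator_UN)
      qed
    qed
  qed
  have "\<forall>B. (\<forall>y. v y \<le> B) \<longrightarrow> (\<lambda>x. v (\<Phi> x)) \<in> V" using v(1,2)
  proof (induction rule: borel_measurable_induct_real)
    case (set A) then show ?case using ind by simp
  next
    case (mult u c)
    show ?case
    proof (intro allI impI)
      fix B assume B: "\<forall>y. c * u y \<le> B"
      show "(\<lambda>x. c * u (\<Phi> x)) \<in> V"
      proof (cases "c = 0")
        case False
        with mult have "\<forall>y. u y \<le> B / c" using B by (simp add: field_simps)
        with mult show ?thesis by (intro scale) auto
      qed (use const[of 0] in simp)
    qed
  next
    case (add u w)
    show ?case
    proof (intro allI impI)
      fix B assume B: "\<forall>y. w y + u y \<le> B"
      have "w y \<le> B" "u y \<le> B" for y using B[rule_format, of y] add.hyps(2)[of y] add.hyps(4)[of y] by linarith+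
      then show "(\<lambda>x. w (\<Phi> x) + u (\<Phi> x)) \<in> V" using add.IH by (intro assms(3)) auto
    qed
  next
    case (seq U)
    show ?case
    proof (intro allI impI)
      fix B assume B: "\<forall>y. v y \<le> B"
      have U: "U i y \<le> B" for i y
      proof -
        have "incseq (\<lambda>i. U i y)" using seq.hyps(3) by (auto simp: incseq_def le_fun_def)
        then have "U i y \<le> v y" using seq.hyps(4)[of y] incseq_le by auto
        then show ?thesis using B order_trans by blast
      qed
      show "(\<lambda>x. v (\<Phi> x)) \<in> V"
      proof (rule lim[where u="\<lambda>i x. U i (\<Phi> x)" and B=B])
        show "(\<lambda>x. U i (\<Phi> x)) \<in> V" for i using seq.IH[of i] U by blast
        show "\<bar>U i (\<Phi> x)\<bar> \<le> B" for i x using U[of i "\<Phi> x"] seq.hyps(2)[of i "\<Phi> x"] by auto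
        show "(\<lambda>i. U i (\<Phi> x)) \<longlonglongrightarrow> v (\<Phi> x)" for x using seq.hyps(4) by auto
      qed
    qed
  qed
  with v(3) show ?thesis by blast
qed

section \<open>Gaussians are inverted by the transform\<close>

text \<open>The Weinstein measure is invariant under translations parallel to the boundary.\<close>

lemma has_bochner_integral_weinstein_shift:
  fixes f :: "(real^'d::finite) \<times> real \<Rightarrow> complex"
  assumes a: "\<alpha> > - 1 / 2" and [measurable]: "f \<in> borel_measurable borel"
    and f: "has_bochner_integral (weinstein_measure \<alpha>) f y"
  shows "has_bochner_integral (weinstein_measure \<alpha>) (\<lambda>x. f (x - (c, 0))) y"
proof -
  define g where "g x = weinstein_weight \<alpha> x *\<^sub>R f x" for x
  have [measurable]: "g \<in> borel_measurable borel" unfolding g_def by measurable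
  have "has_bochner_integral lborel g y"
    using f by (simp add: has_bochner_integral_weinstein[OF a] g_def[abs_def])
  then have "has_bochner_integral (distr lborel borel ((+) (- (c, 0)))) g y"
    unfolding lborel_distr_plus .
  moreover have "(+) (- (c, 0)) \<in> lborel \<rightarrow>\<^sub>M (borel :: ((real^'d) \<times> real) measure)" by measurable
  ultimately have "has_bochner_integral lborel (\<lambda>x. g (- (c, 0) + x)) y"
    unfolding has_bochner_integral_iff by (subst (asm) integrable_distr_eq, simp, simp, subst (asm) integral_distr) auto
  also have "(\<lambda>x. g (- (c, 0) + x)) = (\<lambda>x. weinstein_weight \<alpha> x *\<^sub>R f (x - (c, 0)))"
    by (auto simp: g_def weinstein_weight_def half_space_def indicator_def fun_eq_iff)
  finally show ?thesis by (simp add: has_bochner_integral_weinstein[OF a])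
qed

lemma gaussian_shift:
  assumes "s > 0"
  shows "gaussian s b x = exp (b \<bullet> b / (2 * s)) * gaussian s 0 (x - ((1 / s) *\<^sub>R b, 0))"
proof -
  have "(x - ((1 / s) *\<^sub>R b, 0)) \<bullet> (x - ((1 / s) *\<^sub>R b, 0)) = x \<bullet> x - 2 * (b \<bullet> fst x) / s + b \<bullet> b / s\<^sup>2"
    by (simp add: inner_prod_def inner_diff_left inner_diff_right inner_commute[of "fst x" b] power2_eq_square
      diff_divide_distrib)
  then show ?thesis
    using assms by (simp only: gaussian_def exp_add[symmetric]) (simp add: field_simps power2_eq_square)
qed

lemma weinstein_kernel_shift:
  "weinstein_kernel \<alpha> (x - (c, 0)) \<eta> = exp (\<i> * complex_of_real (c \<bullet> fst \<eta>)) * weinstein_kernel \<alpha> x \<eta>"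
  by (simp add: weinstein_kernel_def exp_add[symmetric] inner_diff_right inner_commute[of c] algebra_simps exp_diff exp_minus field_simps)

lemma cnj_weinstein_kernel: "cnj (weinstein_kernel \<alpha> x (y, \<rho>)) = weinstein_kernel \<alpha> x (- y, \<rho>)"
  by (simp add: weinstein_kernel_def exp_cnj)

lemma normalized_bessel_0:
  assumes a: "\<alpha> > - 1 / 2"
  shows "normalized_bessel \<alpha> 0 = 1"
proof -
  have "(\<lambda>k. (- 1) ^ k * 0 ^ (2 * k) * bessel_coeff \<alpha> k) = (\<lambda>k. if k = 0 then 1 else 0)"
    by (auto simp: fun_eq_iff bessel_coeff_0[OF a])
  with normalized_bessel_sums[OF a, of 0] sums_single[of 0 "\<lambda>_. 1::real"] show ?thesis
    by (metis sums_unique2)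
qed

lemma weinstein_kernel_0: "\<alpha> > - 1 / 2 \<Longrightarrow> weinstein_kernel \<alpha> x 0 = 1"
  by (simp add: weinstein_kernel_def normalized_bessel_0)

lemma weinstein_kernel_section_measurable [measurable]: "(\<lambda>x. weinstein_kernel \<alpha> x \<eta>) \<in> borel_measurable borel"
  unfolding weinstein_kernel_def by measurable

lemma has_bochner_integral_gaussian_b_kernel:
  fixes \<eta> :: "(real^'d::finite) \<times> real"
  assumes a: "\<alpha> > - 1 / 2" and s: "s > 0"
  shows "has_bochner_integral (weinstein_measure \<alpha>)
     (\<lambda>x. complex_of_real (gaussian s b x) * weinstein_kernel \<alpha> x \<eta>)
     (complex_of_real (exp (b \<bullet> b / (2 * s)) * gaussian_factor \<alpha> TYPE('d) s * gaussian (1 / s) 0 \<eta>)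
       * exp (- \<i> * complex_of_real ((b \<bullet> fst \<eta>) / s)))"
proof -
  define c where "c = (1 / s) *\<^sub>R b"
  define A where "A = complex_of_real (exp (b \<bullet> b / (2 * s))) * exp (- \<i> * complex_of_real (c \<bullet> fst \<eta>))"
  have "has_bochner_integral (weinstein_measure \<alpha>)
     (\<lambda>x. complex_of_real (gaussian s 0 (x - (c, 0))) * weinstein_kernel \<alpha> (x - (c, 0)) \<eta>)
     (complex_of_real (gaussian_factor \<alpha> TYPE('d) s * gaussian (1 / s) 0 \<eta>))"
    using has_bochner_integral_gaussian_kernel[OF a s, of "fst \<eta>" "snd \<eta>"]
    by (intro has_bochner_integral_weinstein_shift[OF a]) auto
  then have "has_bochner_integral (weinstein_measure \<alpha>)
     (\<lambda>x. A * (complex_of_real (gaussian s 0 (x - (c, 0))) * weinstein_kernel \<alpha> (x - (c, 0)) \<eta>))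
     (A * complex_of_real (gaussian_factor \<alpha> TYPE('d) s * gaussian (1 / s) 0 \<eta>))"
    by (rule has_bochner_integral_mult_right)
  also have "(\<lambda>x. A * (complex_of_real (gaussian s 0 (x - (c, 0))) * weinstein_kernel \<alpha> (x - (c, 0)) \<eta>))
     = (\<lambda>x. complex_of_real (gaussian s b x) * weinstein_kernel \<alpha> x \<eta>)"
    unfolding weinstein_kernel_shift gaussian_shift[OF s, of b] A_def c_def[symmetric]
    by (auto simp: exp_minus)
  finally show ?thesis by (simp add: A_def c_def mult_ac)
qed

lemma gaussian_integrable:
  fixes b :: "real^'d::finite"
  assumes "\<alpha> > - 1 / 2" "s > 0"
  shows "integrable (weinstein_measure \<alpha>) (\<lambda>x. complex_of_real (gaussian s b x))"
  using has_bochner_integral_gaussian_b_kernel[OF assms, of b 0]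
  by (simp add: has_bochner_integral_iff weinstein_kernel_0[OF assms(1)])

lemma gaussian_le:
  assumes "s > 0"
  shows "gaussian s b x \<le> exp (b \<bullet> b / (2 * s))"
  unfolding gaussian_shift[OF assms, of b] using assms by (simp add: gaussian_def)

definition truncated_half_space :: "nat \<Rightarrow> ((real^'d::finite) \<times> real) set" where
  "truncated_half_space n = {x \<in> half_space. norm x \<le> real n}"

lemma truncated_half_space_borel [measurable]: "truncated_half_space n \<in> sets borel"
  unfolding truncated_half_space_def by measurable

lemma borel_subset_half_space_sets:
  assumes "A \<in> sets borel" "A \<subseteq> half_space"
  shows "A \<in> sets (weinstein_measure \<alpha>)"
  using measurable_sets[OF measurable_weinstein_ident[of \<alpha>] assms(1)] assms(2) by (simp add: Int_absorb2)

lemma truncated_half_space_sets [measurable]: "truncated_half_space n \<in> sets (weinstein_measure \<alpha>)"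
  by (rule borel_subset_half_space_sets) (auto simp: truncated_half_space_def[of n])

lemma gaussian_ge_on_truncated: "x \<in> truncated_half_space n \<Longrightarrow> exp (- (real n)\<^sup>2 / 2) \<le> gaussian 1 0 x"
  by (auto simp: truncated_half_space_def gaussian_def power2_norm_eq_inner[symmetric] intro!: power_mono)

text \<open>On a truncated half space a Gaussian, which is integrable, is bounded below by a positive constant.\<close>

lemma emeasure_truncated_half_space:
  assumes a: "\<alpha> > - 1 / 2"
  shows "emeasure (weinstein_measure \<alpha>) (truncated_half_space n :: ((real^'d::finite) \<times> real) set) < \<infinity>"
proof -
  let ?M = "weinstein_measure \<alpha> :: ((real^'d) \<times> real) measure"
  let ?A = "truncated_half_space n :: ((real^'d) \<times> real) set"
  have "integrable ?M (\<lambda>x. complex_of_real (gaussian 1 0 x))" by (rule gaussian_integrable[OF a]) simp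
  then have i: "integrable ?M (\<lambda>x. exp ((real n)\<^sup>2 / 2) * gaussian 1 0 x)"
    by (simp only: complex_of_real_integrable_eq integrable_mult_right)
  have "emeasure ?M ?A = (\<integral>\<^sup>+x. indicator ?A x \<partial>?M)" by simp
  also have "\<dots> \<le> (\<integral>\<^sup>+x. ennreal (norm (exp ((real n)\<^sup>2 / 2) * gaussian 1 0 x)) \<partial>?M)"
  proof (rule nn_integral_mono)
    fix x :: "(real^'d) \<times> real"
    show "indicator ?A x \<le> ennreal (norm (exp ((real n)\<^sup>2 / 2) * gaussian 1 0 x))"
    proof (cases "x \<in> ?A")
      case True
      from mult_left_mono[OF gaussian_ge_on_truncated[OF this], of "exp ((real n)\<^sup>2 / 2)"]
      have "1 \<le> exp ((real n)\<^sup>2 / 2) * gaussian 1 0 x" by (simp add: exp_minus)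
      then show ?thesis using True by simp
    qed simp
  qed
  also have "\<dots> < \<infinity>" using i unfolding integrable_iff_bounded by blast
  finally show ?thesis .
qed

lemma UN_truncated_half_space: "(\<Union>n. truncated_half_space n) = half_space"
  by (auto simp: truncated_half_space_def intro: real_nat_ceiling_ge)

lemma sigma_finite_weinstein: 
  assumes a: "\<alpha> > - 1 / 2"
  shows "sigma_finite_measure (weinstein_measure \<alpha> :: ((real^'d::finite) \<times> real) measure)"
proof
  show "\<exists>A::((real^'d) \<times> real) set set. countable A \<and> A \<subseteq> sets (weinstein_measure \<alpha>) \<and> \<Union> A = space (weinstein_measure \<alpha>) \<and>
     (\<forall>a\<in>A. emeasure (weinstein_measure \<alpha>) a \<noteq> \<infinity>)"
    using emeasure_truncated_half_space[OF a, where 'd='d] UN_truncated_half_space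
    by (intro exI[of _ "range truncated_half_space"]) (auto simp: less_top)
qed


inductive_set gaussian_span :: "((real^'d::finite) \<times> real \<Rightarrow> complex) set" where
  gaussian: "s > 0 \<Longrightarrow> (\<lambda>x. complex_of_real (gaussian s b x)) \<in> gaussian_span"
| add: "f \<in> gaussian_span \<Longrightarrow> g \<in> gaussian_span \<Longrightarrow> (\<lambda>x. f x + g x) \<in> gaussian_span"
| scale: "f \<in> gaussian_span \<Longrightarrow> (\<lambda>x. c * f x) \<in> gaussian_span"

lemma symmetric_kernel_weinstein:
  assumes a: "\<alpha> > - 1 / 2"
  shows "symmetric_kernel (weinstein_measure \<alpha> :: ((real^'d::finite) \<times> real) measure) (weinstein_kernel \<alpha>)"
proof (intro symmetric_kernel.intro symmetric_kernel_axioms.intro sigma_finite_weinstein a)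
  let ?M = "weinstein_measure \<alpha> :: ((real^'d) \<times> real) measure"
  have "(\<lambda>p. (fst p, snd p)) \<in> ?M \<Otimes>\<^sub>M ?M \<rightarrow>\<^sub>M borel \<Otimes>\<^sub>M borel"
    by (intro measurable_Pair measurable_compose[OF measurable_fst measurable_weinstein_ident]
        measurable_compose[OF measurable_snd measurable_weinstein_ident])
  from measurable_compose[OF this weinstein_kernel_measurable_borel]
  show "(\<lambda>p. weinstein_kernel \<alpha> (fst p) (snd p)) \<in> borel_measurable (?M \<Otimes>\<^sub>M ?M)" by simp
qed (use weinstein_kernel_commute norm_weinstein_kernel_le_1[OF a] in auto)

lemma integrable_bounded_modulated_gaussian:
  fixes b :: "real^'d::finite"
  assumes a: "\<alpha> > - 1 / 2" and s: "s > 0"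
  shows "integrable_bounded (weinstein_measure \<alpha>) (\<lambda>x. exp (\<i> * complex_of_real (c \<bullet> fst x)) * complex_of_real (gaussian s b x))"
  unfolding integrable_bounded_def
proof (intro conjI exI ballI)
  let ?M = "weinstein_measure \<alpha> :: ((real^'d) \<times> real) measure"
  show "integrable ?M (\<lambda>x. exp (\<i> * complex_of_real (c \<bullet> fst x)) * complex_of_real (gaussian s b x))"
  proof (rule Bochner_Integration.integrable_bound[OF gaussian_integrable[OF a s, of b]])
    show "(\<lambda>x. exp (\<i> * complex_of_real (c \<bullet> fst x)) * complex_of_real (gaussian s b x)) \<in> borel_measurable ?M"
      by (rule measurable_weinstein_borel) measurable
    show "AE x in ?M. norm (exp (\<i> * complex_of_real (c \<bullet> fst x)) * complex_of_real (gaussian s b x)) \<le> norm (complex_of_real (gaussian s b x))"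
      by (simp add: norm_mult)
  qed
  show "norm (exp (\<i> * complex_of_real (c \<bullet> fst x)) * complex_of_real (gaussian s b x)) \<le> exp (b \<bullet> b / (2 * s))" for x
    using gaussian_le[OF s, of b x] by (simp add: norm_mult) (simp add: gaussian_def)
qed

text \<open>A translation of the Gaussian becomes a modulation of its transform, and modulating a Gaussian
translates its transform. The two factors \<open>s\<close> and \<open>1/s\<close> to the power \<open>d/2 + \<alpha> + 1\<close> cancel.\<close>

lemma gaussian_inverted:
  fixes b :: "real^'d::finite"
  assumes a: "\<alpha> > - 1 / 2" and s: "s > 0"
  shows "symmetric_kernel.inverted (weinstein_measure \<alpha>) (weinstein_kernel \<alpha>) (\<lambda>x. complex_of_real (gaussian s b x))"
proof -
  interpret symmetric_kernel "weinstein_measure \<alpha> :: ((real^'d) \<times> real) measure" "weinstein_kernel \<alpha>"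
    by (rule symmetric_kernel_weinstein[OF a])
  let ?A = "complex_of_real (exp (b \<bullet> b / (2 * s)) * gaussian_factor \<alpha> TYPE('d) s)"
  let ?c = "(1 / s) *\<^sub>R b"
  define k where "k \<xi> = ?A * (exp (\<i> * complex_of_real (?c \<bullet> fst \<xi>)) * complex_of_real (gaussian (1 / s) 0 \<xi>))" for \<xi> :: "(real^'d) \<times> real"
  have k: "integrable_bounded (weinstein_measure \<alpha>) k"
    unfolding k_def using s by (intro integrable_bounded_mult integrable_bounded_modulated_gaussian a) simp
  have g: "integrable_bounded (weinstein_measure \<alpha>) (\<lambda>x. complex_of_real (gaussian s b x))"
    using integrable_bounded_modulated_gaussian[OF a s, of 0 b] by simp
  have Tk: "T k x = complex_of_real (gaussian s b x)" for x
  proof -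
    have "k \<xi> * weinstein_kernel \<alpha> \<xi> x = ?A * (complex_of_real (gaussian (1 / s) 0 \<xi>) * weinstein_kernel \<alpha> \<xi> (x - (?c, 0)))" for \<xi>
      unfolding k_def weinstein_kernel_commute[of \<alpha> \<xi>] weinstein_kernel_shift by simp
    then have "T k x = ?A * (\<integral>\<xi>. complex_of_real (gaussian (1 / s) 0 \<xi>) * weinstein_kernel \<alpha> \<xi> (x - (?c, 0)) \<partial>weinstein_measure \<alpha>)"
      unfolding T_def by (simp only: integral_mult_right_zero)
    also have "(\<integral>\<xi>. complex_of_real (gaussian (1 / s) 0 \<xi>) * weinstein_kernel \<alpha> \<xi> (x - (?c, 0)) \<partial>weinstein_measure \<alpha>)
       = complex_of_real (gaussian_factor \<alpha> TYPE('d) (1 / s) * gaussian (1 / (1 / s)) 0 (x - (?c, 0)))"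
    proof (rule has_bochner_integral_integral_eq)
      define z where "z = x - (?c, 0)"
      have "has_bochner_integral (weinstein_measure \<alpha>)
         (\<lambda>\<xi>. complex_of_real (gaussian (1 / s) 0 \<xi>) * weinstein_kernel \<alpha> \<xi> z)
         (complex_of_real (gaussian_factor \<alpha> TYPE('d) (1 / s) * gaussian (1 / (1 / s)) 0 z))"
        using has_bochner_integral_gaussian_kernel[OF a, of "1 / s" "fst z" "snd z"] s by simp
      then show "has_bochner_integral (weinstein_measure \<alpha>)
         (\<lambda>\<xi>. complex_of_real (gaussian (1 / s) 0 \<xi>) * weinstein_kernel \<alpha> \<xi> (x - (?c, 0)))
         (complex_of_real (gaussian_factor \<alpha> TYPE('d) (1 / s) * gaussian (1 / (1 / s)) 0 (x - (?c, 0))))"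
        by (simp only: z_def)
    qed
    also have "?A * \<dots> = complex_of_real (exp (b \<bullet> b / (2 * s)) * (gaussian_factor \<alpha> TYPE('d) s * gaussian_factor \<alpha> TYPE('d) (1 / s)) * gaussian s 0 (x - (?c, 0)))"
      by simp
    also have "\<dots> = complex_of_real (gaussian s b x)"
      unfolding gaussian_factor_inverse[OF s] gaussian_shift[OF s, of b x] by simp
    finally show ?thesis .
  qed
  have Tg: "T' (\<lambda>x. complex_of_real (gaussian s b x)) \<xi> = k \<xi>" for \<xi>
  proof -
    have "T' (\<lambda>x. complex_of_real (gaussian s b x)) \<xi> = (\<integral>x. complex_of_real (gaussian s b x) * weinstein_kernel \<alpha> x (- fst \<xi>, snd \<xi>) \<partial>weinstein_measure \<alpha>)"
      unfolding T'_def cnj_weinstein_kernel[of \<alpha> _ "fst \<xi>" "snd \<xi>", simplified] ..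
    also have "\<dots> = complex_of_real (exp (b \<bullet> b / (2 * s)) * gaussian_factor \<alpha> TYPE('d) s * gaussian (1 / s) 0 (- fst \<xi>, snd \<xi>))
       * exp (- \<i> * complex_of_real ((b \<bullet> fst (- fst \<xi>, snd \<xi>)) / s))"
      by (rule has_bochner_integral_integral_eq) (rule has_bochner_integral_gaussian_b_kernel[OF a s])
    also have "\<dots> = k \<xi>"
      by (simp add: k_def gaussian_def inner_prod_def)
    finally show ?thesis .
  qed
  show ?thesis
    unfolding inverted_def using g k Tk Tg by blast
qed

lemma gaussian_span_inverted:
  assumes a: "\<alpha> > - 1 / 2" and h: "h \<in> gaussian_span"
  shows "symmetric_kernel.inverted (weinstein_measure \<alpha>) (weinstein_kernel \<alpha>) (h :: (real^'d::finite) \<times> real \<Rightarrow> complex)"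
proof -
  interpret symmetric_kernel "weinstein_measure \<alpha> :: ((real^'d) \<times> real) measure" "weinstein_kernel \<alpha>"
    by (rule symmetric_kernel_weinstein[OF a])
  show ?thesis using h
    by induction (auto intro: gaussian_inverted[OF a] inverted_add inverted_mult)
qed

lemma gaussian_mult: "gaussian s b x * gaussian t c x = gaussian (s + t) (b + c) x"
  by (simp add: gaussian_def exp_add[symmetric] inner_add_left field_simps)

lemma gaussian_mult_span:
  assumes s: "s > 0" and f: "f \<in> gaussian_span"
  shows "(\<lambda>x. complex_of_real (gaussian s b x) * f x) \<in> gaussian_span"
  using f
proof induction
  case (gaussian t c)
  then show ?case
    using s gaussian_span.gaussian[of "s + t" "b + c"] by (simp only: of_real_mult[symmetric] gaussian_mult add_pos_pos)
next
  case (add f g)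
  then show ?case using gaussian_span.add by (auto simp: distrib_left)
next
  case (scale f c)
  then show ?case using gaussian_span.scale[of "\<lambda>x. complex_of_real (gaussian s b x) * f x" c] by (simp add: mult_ac)
qed

section \<open>The span of the Gaussians is dense and total\<close>

text \<open>Coordinates on the half space that are bounded and whose polynomials are combinations of
Gaussians, up to the constants. They determine the point \<open>(x', r)\<close>: quotients of them give the
coordinates of \<open>x'\<close>, the last one gives \<open>\<bar>x'\<bar>\<^sup>2 + r\<^sup>2\<close>, and \<open>r\<close> is positive.\<close>

definition gaussian_coords :: "(real^'d::finite) \<times> real \<Rightarrow> (real^'d) \<times> real" where
  "gaussian_coords x = (\<chi> i. gaussian 1 (axis i 1) x, gaussian 1 0 x)"

lemma gaussian_coords_bounded: "bounded (range (gaussian_coords :: (real^'d::finite) \<times> real \<Rightarrow> _))"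
proof (rule boundedI)
  fix y :: "(real^'d) \<times> real" assume "y \<in> range gaussian_coords"
  then obtain x where y: "y = gaussian_coords x" by auto
  have 1: "\<bar>gaussian 1 b x\<bar> \<le> exp (b \<bullet> b / 2)" for b
    using gaussian_le[of 1 b x] by (simp add: gaussian_def)
  have "norm (gaussian_coords x) \<le> norm (\<chi> i. (gaussian 1 (axis i 1) x :: real)) + norm (gaussian 1 0 x)"
    unfolding gaussian_coords_def by (rule norm_Pair_le)
  also have "norm (\<chi> i. (gaussian 1 (axis i 1) x :: real)) \<le> (\<Sum>i\<in>(UNIV::'d set). \<bar>gaussian 1 (axis i 1) x\<bar>)"
    using norm_le_l1_cart[of "\<chi> i. (gaussian 1 (axis i 1) x :: real)"] by simp
  also have "\<dots> \<le> (\<Sum>i\<in>(UNIV::'d set). exp (1 / 2))"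
    using 1[of "axis _ 1"] by (intro sum_mono) (simp add: inner_axis_axis)
  also have "norm (gaussian 1 0 x) \<le> 1" using 1[of 0] by simp
  finally show "norm y \<le> (\<Sum>i\<in>(UNIV::'d set). exp (1 / 2)) + 1" by (simp add: y)
qed

definition gaussian_coords_inv :: "(real^'d::finite) \<times> real \<Rightarrow> (real^'d) \<times> real" where
  "gaussian_coords_inv y = (let x' = (\<chi> i. ln (fst y $ i) - ln (snd y)) in (x', sqrt (- 2 * ln (snd y) - x' \<bullet> x')))"

lemma gaussian_coords_inv: "x \<in> half_space \<Longrightarrow> gaussian_coords_inv (gaussian_coords x) = x"
proof -
  assume x: "x \<in> half_space"
  have "(\<chi> i. ln (fst (gaussian_coords x) $ i) - ln (snd (gaussian_coords x))) = fst x"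
    by (simp add: vec_eq_iff gaussian_coords_def gaussian_def inner_axis')
  moreover have "- 2 * ln (snd (gaussian_coords x)) = x \<bullet> x"
    by (simp add: gaussian_coords_def gaussian_def)
  ultimately show ?thesis using x
    by (simp add: gaussian_coords_inv_def Let_def inner_prod_def half_space_def prod_eq_iff)
qed

lemma vec_lambda_measurable:
  assumes "\<And>i. f i \<in> borel_measurable M"
  shows "(\<lambda>x. \<chi> i. (f i x :: real)) \<in> borel_measurable M"
  by (subst borel_measurable_euclidean_space) (use assms in \<open>auto simp: Basis_vec_def inner_axis\<close>)

lemma gaussian_coords_inv_measurable [measurable]: "gaussian_coords_inv \<in> borel_measurable borel"
proof -
  have [measurable]: "(\<lambda>y. \<chi> i. (ln (fst y $ i) - ln (snd y) :: real)) \<in> borel_measurable (borel :: ((real^'d) \<times> real) measure)"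
  proof (rule vec_lambda_measurable)
    fix i :: 'd
    have "(\<lambda>v::real^'d. v $ i) \<in> borel_measurable borel" by measurable
    from measurable_compose[OF borel_measurable_fst_snd(1) this]
    have [measurable]: "(\<lambda>y::(real^'d) \<times> real. fst y $ i) \<in> borel_measurable borel" .
    show "(\<lambda>y. ln (fst y $ i) - ln (snd y)) \<in> borel_measurable (borel :: ((real^'d) \<times> real) measure)" by measurable
  qed
  show ?thesis unfolding gaussian_coords_inv_def[abs_def] Let_def by measurable
qed

text \<open>The factor \<open>f\<close> absorbs the constant term, which by itself is not a combination of Gaussians.
Quantifying over all \<open>f\<close> makes the induction step for products immediate.\<close>

lemma polynomial_gaussian_span:
  fixes f :: "(real^'d::finite) \<times> real \<Rightarrow> complex"
  assumes "real_polynomial_function p" "f \<in> gaussian_span"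
  shows "(\<lambda>x. complex_of_real (p (gaussian_coords x)) * f x) \<in> gaussian_span"
  using assms
proof (induction arbitrary: f rule: real_polynomial_function.induct)
  case (linear L)
  then interpret L: bounded_linear L by simp
  have e: "L y = (\<Sum>b\<in>Basis. (y \<bullet> b) * L b)" for y
    by (subst euclidean_representation[of y, symmetric]) (simp only: L.sum L.scaleR real_scaleR_def)
  have b: "(\<lambda>x. complex_of_real (gaussian_coords x \<bullet> b) * f x) \<in> gaussian_span" if "b \<in> Basis" for b
  proof -
    from that consider i where "b = (axis i 1, 0)" | "b = (0, 1)" by (auto simp: Basis_prod_def Basis_vec_def)
    then show ?thesis
    proof cases
      case 1
      then have "gaussian_coords x \<bullet> b = gaussian 1 (axis i 1) x" for x by (simp add: gaussian_coords_def inner_axis)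
      then show ?thesis using linear.prems by (simp add: gaussian_mult_span)
    next
      case 2
      then have "gaussian_coords x \<bullet> b = gaussian 1 0 x" for x by (simp add: gaussian_coords_def)
      then show ?thesis using linear.prems by (simp add: gaussian_mult_span)
    qed
  qed
  have sp: "(\<lambda>x. \<Sum>b\<in>B. complex_of_real (L b) * (complex_of_real (gaussian_coords x \<bullet> b) * f x)) \<in> gaussian_span" if "finite B" "B \<subseteq> Basis" for B
    using that
  proof (induction)
    case empty
    then show ?case using gaussian_span.scale[OF linear.prems, of 0] by simp
  next
    case (insert c B)
    then show ?case by (simp add: gaussian_span.add gaussian_span.scale b)
  qed
  have L: "complex_of_real (L y) = (\<Sum>b\<in>Basis. complex_of_real (y \<bullet> b) * complex_of_real (L b))" for y
    by (subst e) simp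
  note sp[of Basis]
  also have "(\<lambda>x. \<Sum>b\<in>Basis. complex_of_real (L b) * (complex_of_real (gaussian_coords x \<bullet> b) * f x))
     = (\<lambda>x. complex_of_real (L (gaussian_coords x)) * f x)"
    by (subst L[of "gaussian_coords _"]) (simp add: sum_distrib_left mult_ac)
  finally show ?case by simp
next
  case (const c)
  then show ?case by (rule gaussian_span.scale)
next
  case (add p q)
  then show ?case using gaussian_span.add[OF add.IH(1) add.IH(2)] by (simp add: distrib_right)
next
  case (mult p q)
  show ?case using mult.IH(1)[OF mult.IH(2)[OF mult.prems]] by (simp add: mult.assoc)
qed


text \<open>The monotone class theorem in the coordinates of the half space. As these are one-to-one with
Borel inverse, every bounded Borel function is a Borel function of the coordinates.\<close>

lemma polynomial_gaussian_class:
  fixes V :: "((real^'d::finite) \<times> real \<Rightarrow> real) set" and g :: "(real^'d) \<times> real \<Rightarrow> real"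
  assumes poly: "\<And>u. (\<lambda>x. complex_of_real (u x) * complex_of_real (gaussian 1 0 x)) \<in> gaussian_span \<Longrightarrow>
        u \<in> borel_measurable borel \<Longrightarrow> u \<in> V"
    and add: "\<And>u v. u \<in> V \<Longrightarrow> v \<in> V \<Longrightarrow> (\<lambda>x. u x + v x) \<in> V"
    and scale: "\<And>c u. u \<in> V \<Longrightarrow> (\<lambda>x. c * u x) \<in> V"
    and lim: "\<And>u w B. (\<And>n::nat. u n \<in> V) \<Longrightarrow> (\<And>n x. \<bar>u n x\<bar> \<le> B) \<Longrightarrow>
        (\<And>x. (\<lambda>n. u n x) \<longlonglongrightarrow> w x) \<Longrightarrow> w \<in> V"
    and g: "g \<in> borel_measurable borel" "\<And>y. 0 \<le> g y" "\<And>y. g y \<le> B"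
  shows "\<exists>u\<in>V. \<forall>x\<in>half_space. u x = g x"
proof -
  have [measurable]: "gaussian_coords \<in> borel_measurable (borel :: ((real^'d) \<times> real) measure)"
  proof -
    have [measurable]: "(\<lambda>x. \<chi> i. (gaussian 1 (axis i 1) x :: real)) \<in> borel_measurable (borel :: ((real^'d) \<times> real) measure)"
      by (rule vec_lambda_measurable) measurable
    show ?thesis unfolding gaussian_coords_def[abs_def] by measurable
  qed
  have [measurable]: "p \<in> borel_measurable borel" if "real_polynomial_function p" for p :: "(real^'d) \<times> real \<Rightarrow> real"
    using that by (intro borel_measurable_continuous_onI continuous_on_polymonial_function)
      (simp add: real_polynomial_function_eq)
  have "(\<lambda>x. g (gaussian_coords_inv (gaussian_coords x))) \<in> V"
  proof (rule bounded_class_contains_borel[OF gaussian_coords_bounded _ add scale lim,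
      where v="\<lambda>y. g (gaussian_coords_inv y)" and B=B])
    fix p :: "(real^'d) \<times> real \<Rightarrow> real" assume p: "real_polynomial_function p"
    show "(\<lambda>x. p (gaussian_coords x)) \<in> V"
      using p by (intro poly polynomial_gaussian_span gaussian_span.gaussian) auto
  qed (use g in auto)
  then show ?thesis by (rule bexI[rotated]) (simp add: gaussian_coords_inv)
qed

lemma AE_weinstein_measureI:
  assumes "AE x in lborel. P x"
  shows "AE x in weinstein_measure \<alpha>. P (x :: (real^'d::finite) \<times> real)"
proof -
  have "AE x in lebesgue_on half_space. P x"
    using AE_completion[OF assms] by (subst AE_restrict_space_iff) auto
  moreover have "(\<lambda>x::(real^'d) \<times> real. ennreal (snd x powr (2 * \<alpha> + 1) /
          ((2 * pi) powr (real CARD('d) / 2) * 2 powr \<alpha> * Gamma (\<alpha> + 1)))) \<in> borel_measurable (lebesgue_on half_space)"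
    by (intro measurable_restrict_space1 measurable_completion) simp
  ultimately show ?thesis
    unfolding weinstein_measure_def by (subst AE_density) auto
qed

text \<open>Functions are only Lebesgue measurable, while the monotone class argument produces Borel functions.\<close>

lemma weinstein_ex_borel_measurable:
  fixes f :: "(real^'d::finite) \<times> real \<Rightarrow> real"
  assumes "f \<in> borel_measurable (weinstein_measure \<alpha>)"
  shows "\<exists>g\<in>borel_measurable borel. AE x in weinstein_measure \<alpha>. f x = g x"
proof -
  have "f \<in> borel_measurable (lebesgue_on half_space)"
    using assms by (simp add: measurable_def sets_weinstein_measure)
  then have "(\<lambda>x. indicator half_space x *\<^sub>R f x) \<in> borel_measurable lebesgue"
    by (subst (asm) borel_measurable_restrict_space_iff) auto
  from completion_ex_borel_measurable_real[OF this]
  obtain g where g: "g \<in> borel_measurable lborel" "AE x in lborel. indicator half_space x *\<^sub>R f x = g x" by auto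
  have "AE x in weinstein_measure \<alpha>. f x = g x"
    using AE_weinstein_measureI[OF g(2), of \<alpha>] AE_space[of "weinstein_measure \<alpha>"]
    by eventually_elim simp
  with g(1) show ?thesis by auto
qed

lemma l12_add:
  assumes [measurable]: "f \<in> borel_measurable M" "g \<in> borel_measurable M"
  shows "l12 M (\<lambda>x. f x + g x) \<le> 2 * l12 M f + 2 * l12 M g"
proof -
  have "l12 M (\<lambda>x. f x + g x) \<le> (\<integral>\<^sup>+x. 2 * ennreal (norm (f x) + (norm (f x))\<^sup>2) + 2 * ennreal (norm (g x) + (norm (g x))\<^sup>2) \<partial>M)"
    unfolding l12_def
  proof (rule nn_integral_mono)
    fix x
    have "norm (f x + g x) + (norm (f x + g x))\<^sup>2 \<le> 2 * (norm (f x) + (norm (f x))\<^sup>2) + 2 * (norm (g x) + (norm (g x))\<^sup>2)"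
      using norm_triangle_ineq[of "f x" "g x"] norm_add_square_le[of 1 "f x" "g x"] by (simp add: algebra_simps)
        (smt (verit) norm_ge_zero)
    from ennreal_leI[OF this]
    show "ennreal (norm (f x + g x) + (norm (f x + g x))\<^sup>2) \<le> 2 * ennreal (norm (f x) + (norm (f x))\<^sup>2) + 2 * ennreal (norm (g x) + (norm (g x))\<^sup>2)"
      by (simp add: ennreal_mult)
  qed
  also have "\<dots> = 2 * l12 M f + 2 * l12 M g"
    by (simp add: l12_def nn_integral_add nn_integral_cmult)
  finally show ?thesis .
qed

lemma l12_scale:
  assumes [measurable]: "f \<in> borel_measurable M"
  shows "l12 M (\<lambda>x. c * f x) \<le> ennreal (norm c + (norm c)\<^sup>2) * l12 M f"
proof -
  have "l12 M (\<lambda>x. c * f x) \<le> (\<integral>\<^sup>+x. ennreal (norm c + (norm c)\<^sup>2) * ennreal (norm (f x) + (norm (f x))\<^sup>2) \<partial>M)"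
    unfolding l12_def
    by (intro nn_integral_mono) (simp add: ennreal_mult[symmetric] norm_mult power_mult_distrib algebra_simps)
  also have "\<dots> = ennreal (norm c + (norm c)\<^sup>2) * l12 M f"
    by (simp add: l12_def nn_integral_cmult)
  finally show ?thesis .
qed

lemma l12_cong_AE: "AE x in M. f x = g x \<Longrightarrow> l12 M f = l12 M g"
  unfolding l12_def by (rule nn_integral_cong_AE) auto

definition l12_closure :: "'a measure \<Rightarrow> ('a \<Rightarrow> complex) set \<Rightarrow> ('a \<Rightarrow> complex) set" where
  "l12_closure M G = {f \<in> borel_measurable M. \<forall>e>0. \<exists>h\<in>G. l12 M (\<lambda>x. f x - h x) < e}"

lemma ennreal_double_less:
  fixes e :: ennreal
  assumes "0 < e"
  obtains e' where "0 < e'" "\<And>a b. a < e' \<Longrightarrow> b < e' \<Longrightarrow> 2 * a + 2 * b < e"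
proof (cases "e = \<infinity>")
  case True
  show ?thesis by (rule that[of 1]) (auto simp: True ennreal_mult_less_top less_top[symmetric] top_unique ennreal_add_eq_top ennreal_mult_eq_top_iff)
next
  case False
  then obtain r where r: "e = ennreal r" "r > 0" using assms by (cases e) auto
  show ?thesis
  proof (rule that[of "ennreal (r / 4)"])
    show "0 < ennreal (r / 4)" using r by simp
    fix a b assume ab: "a < ennreal (r / 4)" "b < ennreal (r / 4)"
    then obtain a' b' where "a = ennreal a'" "a' \<ge> 0" "b = ennreal b'" "b' \<ge> 0"
      by (metis ennreal_cases ennreal_less_top not_less_iff_gr_or_eq order_less_trans)
    with ab have "a' < r / 4" "b' < r / 4" using r by (auto simp: ennreal_less_iff)
    moreover have "2 * a + 2 * b = ennreal (2 * a' + 2 * b')"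
      using \<open>a = _\<close> \<open>b = _\<close> \<open>a' \<ge> 0\<close> \<open>b' \<ge> 0\<close> by (simp add: ennreal_mult)
    ultimately show "2 * a + 2 * b < e"
      using r \<open>a' \<ge> 0\<close> \<open>b' \<ge> 0\<close> by (simp add: ennreal_less_iff ennreal_plus[symmetric] del: ennreal_plus)
  qed
qed

context
  fixes M :: "'a measure" and G :: "('a \<Rightarrow> complex) set"
  assumes G_measurable: "\<And>h. h \<in> G \<Longrightarrow> h \<in> borel_measurable M"
    and G_add: "\<And>f g. f \<in> G \<Longrightarrow> g \<in> G \<Longrightarrow> (\<lambda>x. f x + g x) \<in> G"
    and G_scale: "\<And>c f. f \<in> G \<Longrightarrow> (\<lambda>x. c * f x) \<in> G"
begin

lemma l12_closure_closed:
  assumes f: "f \<in> borel_measurable M" and ap: "\<And>e. 0 < e \<Longrightarrow> \<exists>g\<in>l12_closure M G. l12 M (\<lambda>x. f x - g x) < e"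
  shows "f \<in> l12_closure M G"
  unfolding l12_closure_def
proof (intro CollectI conjI allI impI f)
  fix e :: ennreal assume "0 < e"
  then obtain e' where e': "0 < e'" "\<And>a b. a < e' \<Longrightarrow> b < e' \<Longrightarrow> 2 * a + 2 * b < e" by (rule ennreal_double_less) blast
  from ap[OF e'(1)] obtain g where g: "g \<in> l12_closure M G" "l12 M (\<lambda>x. f x - g x) < e'" by auto
  with e'(1) obtain h where h: "h \<in> G" "l12 M (\<lambda>x. g x - h x) < e'" by (auto simp: l12_closure_def)
  have [measurable]: "f \<in> borel_measurable M" "g \<in> borel_measurable M" "h \<in> borel_measurable M"
    using f g h G_measurable by (auto simp: l12_closure_def)
  have "l12 M (\<lambda>x. (f x - g x) + (g x - h x)) \<le> 2 * l12 M (\<lambda>x. f x - g x) + 2 * l12 M (\<lambda>x. g x - h x)"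
    by (intro l12_add) measurable
  also have "\<dots> < e" by (intro e' g h)
  finally show "\<exists>h\<in>G. l12 M (\<lambda>x. f x - h x) < e" using h by auto
qed

lemma l12_closure_add:
  assumes "f \<in> l12_closure M G" "g \<in> l12_closure M G"
  shows "(\<lambda>x. f x + g x) \<in> l12_closure M G"
  unfolding l12_closure_def
proof (intro CollectI conjI allI impI)
  have [measurable]: "f \<in> borel_measurable M" "g \<in> borel_measurable M" using assms by (auto simp: l12_closure_def)
  show "(\<lambda>x. f x + g x) \<in> borel_measurable M" by measurable
  fix e :: ennreal assume "0 < e"
  then obtain e' where e': "0 < e'" "\<And>a b. a < e' \<Longrightarrow> b < e' \<Longrightarrow> 2 * a + 2 * b < e" by (rule ennreal_double_less) blast
  from assms e'(1) obtain h k where h: "h \<in> G" "l12 M (\<lambda>x. f x - h x) < e'" and k: "k \<in> G" "l12 M (\<lambda>x. g x - k x) < e'"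
    by (fastforce simp: l12_closure_def)
  have [measurable]: "h \<in> borel_measurable M" "k \<in> borel_measurable M" using h k G_measurable by auto
  have "l12 M (\<lambda>x. (f x - h x) + (g x - k x)) \<le> 2 * l12 M (\<lambda>x. f x - h x) + 2 * l12 M (\<lambda>x. g x - k x)"
    by (intro l12_add) measurable
  also have "\<dots> < e" by (intro e' h k)
  finally show "\<exists>h\<in>G. l12 M (\<lambda>x. f x + g x - h x) < e" using G_add[OF h(1) k(1)] by (auto simp: algebra_simps)
qed

lemma l12_closure_scale:
  assumes "f \<in> l12_closure M G"
  shows "(\<lambda>x. c * f x) \<in> l12_closure M G"
  unfolding l12_closure_def
proof (intro CollectI conjI allI impI)
  have [measurable]: "f \<in> borel_measurable M" using assms by (auto simp: l12_closure_def)
  show "(\<lambda>x. c * f x) \<in> borel_measurable M" by measurable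
  fix e :: ennreal assume e: "0 < e"
  define C where "C = 1 + (norm c + (norm c)\<^sup>2)"
  have C: "C > 0" by (simp add: C_def add_pos_nonneg)
  from e C have "0 < e / ennreal C" by (simp add: ennreal_zero_less_divide)
  with assms obtain h where h: "h \<in> G" "l12 M (\<lambda>x. f x - h x) < e / ennreal C"
    by (auto simp: l12_closure_def)
  have [measurable]: "h \<in> borel_measurable M" using h G_measurable by auto
  have "l12 M (\<lambda>x. c * (f x - h x)) \<le> ennreal (norm c + (norm c)\<^sup>2) * l12 M (\<lambda>x. f x - h x)"
    by (intro l12_scale) measurable
  also have "\<dots> \<le> ennreal C * l12 M (\<lambda>x. f x - h x)" by (intro mult_right_mono) (auto simp: C_def intro!: ennreal_leI)
  also have "\<dots> < e"
  proof -
    have "ennreal C * l12 M (\<lambda>x. f x - h x) < ennreal C * (e / ennreal C)"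
      using h(2) C by (intro ennreal_mult_strict_left_mono) auto
    also have "\<dots> = e" using C by (simp add: ennreal_times_divide ennreal_mult_divide_eq mult.commute)
    finally show ?thesis .
  qed
  finally show "\<exists>h\<in>G. l12 M (\<lambda>x. c * f x - h x) < e"
    using G_scale[OF h(1), of c] by (auto simp: algebra_simps)
qed

end

lemma l12_closure_cong:
  assumes f: "f \<in> l12_closure M G" and g: "g \<in> borel_measurable M" and ae: "AE x in M. f x = g x"
  shows "g \<in> l12_closure M G"
proof -
  have "l12 M (\<lambda>x. g x - h x) = l12 M (\<lambda>x. f x - h x)" for h
    by (rule l12_cong_AE) (use ae in eventually_elim, simp)
  with f g show ?thesis by (simp add: l12_closure_def)
qed

lemma gaussian_span_borel: "h \<in> gaussian_span \<Longrightarrow> h \<in> borel_measurable borel"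
proof (induction rule: gaussian_span.induct)
  case (gaussian s b)
  show ?case by measurable
next
  case (add f g)
  note [measurable] = add.IH
  show ?case by measurable
next
  case (scale f c)
  note [measurable] = scale.IH
  show ?case by measurable
qed

lemma gaussian_span_measurable: "h \<in> gaussian_span \<Longrightarrow> h \<in> borel_measurable (weinstein_measure \<alpha>)"
  by (intro measurable_weinstein_borel gaussian_span_borel)

text \<open>The functions \<open>u\<close> whose product with a fixed Gaussian can be approximated form a class to which
the monotone class theorem applies; multiples of the Gaussian are the dominating functions.\<close>

lemma gaussian_times_bounded_in_closure:
  fixes g :: "(real^'d::finite) \<times> real \<Rightarrow> real"
  assumes a: "\<alpha> > - 1 / 2"
    and g: "g \<in> borel_measurable borel" "\<And>y. 0 \<le> g y" "\<And>y. g y \<le> B"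
  shows "(\<lambda>x. complex_of_real (g x) * complex_of_real (gaussian 1 0 x)) \<in> l12_closure (weinstein_measure \<alpha>) gaussian_span"
proof -
  let ?M = "weinstein_measure \<alpha> :: ((real^'d) \<times> real) measure"
  let ?C = "l12_closure ?M gaussian_span"
  define \<gamma> where "\<gamma> x = complex_of_real (gaussian 1 0 x)" for x :: "(real^'d) \<times> real"
  define V where "V = {u \<in> borel_measurable borel. (\<lambda>x. complex_of_real (u x) * \<gamma> x) \<in> ?C}"
  have [measurable]: "\<gamma> \<in> borel_measurable borel" unfolding \<gamma>_def by measurable
  note cl = gaussian_span_measurable gaussian_span.add gaussian_span.scale
  have addC: "(\<lambda>x. f x + k x) \<in> ?C" if "f \<in> ?C" "k \<in> ?C" for f k
    by (rule l12_closure_add) (use that in \<open>auto intro: cl\<close>)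
  have scaleC: "(\<lambda>x. c * f x) \<in> ?C" if "f \<in> ?C" for f c
    by (rule l12_closure_scale) (use that in \<open>auto intro: cl\<close>)
  have "\<exists>u\<in>V. \<forall>x\<in>half_space. u x = g x"
  proof (rule polynomial_gaussian_class[OF _ _ _ _ g])
    fix u :: "(real^'d) \<times> real \<Rightarrow> real"
    assume "(\<lambda>x. complex_of_real (u x) * complex_of_real (gaussian 1 0 x)) \<in> gaussian_span" "u \<in> borel_measurable borel"
    then show "u \<in> V"
      using gaussian_span_measurable
      by (auto simp: V_def \<gamma>_def l12_closure_def l12_def intro!: bexI[of _ "\<lambda>x. complex_of_real (u x) * complex_of_real (gaussian 1 0 x)"])
  next
    fix u v :: "(real^'d) \<times> real \<Rightarrow> real" assume "u \<in> V" "v \<in> V"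
    then show "(\<lambda>x. u x + v x) \<in> V"
      using addC[of "\<lambda>x. complex_of_real (u x) * \<gamma> x" "\<lambda>x. complex_of_real (v x) * \<gamma> x"]
      by (auto simp: V_def distrib_right)
  next
    fix c and u :: "(real^'d) \<times> real \<Rightarrow> real" assume "u \<in> V"
    then show "(\<lambda>x. c * u x) \<in> V"
      using scaleC[of "\<lambda>x. complex_of_real (u x) * \<gamma> x" "complex_of_real c"]
      by (auto simp: V_def mult.assoc)
  next
    fix u :: "nat \<Rightarrow> (real^'d) \<times> real \<Rightarrow> real" and w B
    assume u: "\<And>n. u n \<in> V" and B: "\<And>n x. \<bar>u n x\<bar> \<le> B" and l: "\<And>x. (\<lambda>n. u n x) \<longlonglongrightarrow> w x"
    have um[measurable]: "u n \<in> borel_measurable borel" for n using u by (simp add: V_def)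
    have wm[measurable]: "w \<in> borel_measurable borel" by (rule borel_measurable_LIMSEQ_real[OF l um])
    have "(\<lambda>x. complex_of_real (w x) * \<gamma> x) \<in> ?C"
    proof (rule l12_closure_closed[OF cl])
      show "(\<lambda>x. complex_of_real (w x) * \<gamma> x) \<in> borel_measurable ?M" by (rule measurable_weinstein_borel) measurable
      fix e :: ennreal assume e: "0 < e"
      define q where "q n x = ennreal (norm (complex_of_real (w x) * \<gamma> x - complex_of_real (u n x) * \<gamma> x) +
          (norm (complex_of_real (w x) * \<gamma> x - complex_of_real (u n x) * \<gamma> x))\<^sup>2)" for n x
      have wB: "\<bar>w x\<bar> \<le> B" for x
        by (rule LIMSEQ_le_const2[OF tendsto_rabs[OF l]]) (use B in auto)
      have B0: "B \<ge> 0" using wB[of 0] by simp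
      have "(\<lambda>n. \<integral>\<^sup>+x. q n x \<partial>?M) \<longlonglongrightarrow> (\<integral>\<^sup>+x. 0 \<partial>?M)"
      proof (rule nn_integral_dominated_convergence)
        show "q n \<in> borel_measurable ?M" for n unfolding q_def by (rule measurable_weinstein_borel) measurable
        show "(\<lambda>x. ennreal (norm (complex_of_real (2 * B + 4 * B\<^sup>2) * \<gamma> x))) \<in> borel_measurable ?M"
          by (rule measurable_weinstein_borel) measurable
        have "integrable ?M (\<lambda>x. complex_of_real (2 * B + 4 * B\<^sup>2) * \<gamma> x)"
          unfolding \<gamma>_def by (intro integrable_mult_right gaussian_integrable[OF a]) simp
        then show "(\<integral>\<^sup>+x. ennreal (norm (complex_of_real (2 * B + 4 * B\<^sup>2) * \<gamma> x)) \<partial>?M) < \<infinity>"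
          unfolding integrable_iff_bounded by blast
        show "AE x in ?M. q n x \<le> ennreal (norm (complex_of_real (2 * B + 4 * B\<^sup>2) * \<gamma> x))" for n
        proof (intro AE_I2)
          fix x :: "(real^'d) \<times> real"
          have \<gamma>: "0 < gaussian 1 0 x" "gaussian 1 0 x \<le> 1" using gaussian_le[of 1 0 x] by (auto simp: gaussian_def)
          define t where "t = \<bar>w x - u n x\<bar>"
          have t: "0 \<le> t" "t \<le> 2 * B" using wB[of x] B[of n x] by (auto simp: t_def)
          have n: "norm (complex_of_real (w x) * \<gamma> x - complex_of_real (u n x) * \<gamma> x) = t * gaussian 1 0 x"
            using \<gamma> unfolding \<gamma>_def t_def left_diff_distrib[symmetric] norm_mult by (simp flip: of_real_diff)
          have "t * gaussian 1 0 x \<le> 2 * B * gaussian 1 0 x" using t \<gamma> by (intro mult_right_mono) auto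
          moreover have "(t * gaussian 1 0 x)\<^sup>2 \<le> 4 * B\<^sup>2 * gaussian 1 0 x"
          proof -
            have "t\<^sup>2 \<le> (2 * B)\<^sup>2" using t by (intro power_mono) auto
            moreover have "(gaussian 1 0 x)\<^sup>2 \<le> gaussian 1 0 x" using \<gamma> by (simp add: power2_eq_square mult_left_le)
            ultimately have "t\<^sup>2 * (gaussian 1 0 x)\<^sup>2 \<le> (2 * B)\<^sup>2 * gaussian 1 0 x" by (intro mult_mono) auto
            then show ?thesis by (simp add: power_mult_distrib)
          qed
          ultimately have "t * gaussian 1 0 x + (t * gaussian 1 0 x)\<^sup>2 \<le> (2 * B + 4 * B\<^sup>2) * gaussian 1 0 x"
            by (simp add: distrib_right)
          also have "\<dots> = norm (complex_of_real (2 * B + 4 * B\<^sup>2) * \<gamma> x)"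
            using B0 \<gamma> unfolding \<gamma>_def norm_mult norm_of_real by simp
          finally show "q n x \<le> ennreal (norm (complex_of_real (2 * B + 4 * B\<^sup>2) * \<gamma> x))"
            unfolding q_def n by (rule ennreal_leI)
        qed
        show "AE x in ?M. (\<lambda>n. q n x) \<longlonglongrightarrow> 0"
        proof (intro AE_I2)
          fix x :: "(real^'d) \<times> real"
          have "(\<lambda>n. q n x) \<longlonglongrightarrow> ennreal (norm (complex_of_real (w x) * \<gamma> x - complex_of_real (w x) * \<gamma> x) +
              (norm (complex_of_real (w x) * \<gamma> x - complex_of_real (w x) * \<gamma> x))\<^sup>2)"
            unfolding q_def by (intro tendsto_ennrealI tendsto_intros l)
          then show "(\<lambda>n. q n x) \<longlonglongrightarrow> 0" by simp
        qed
      qed simp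
      then have "(\<lambda>n. \<integral>\<^sup>+x. q n x \<partial>?M) \<longlonglongrightarrow> 0" by simp
      from order_tendstoD(2)[OF this e] obtain n where n: "(\<integral>\<^sup>+x. q n x \<partial>?M) < e"
        by (auto simp: eventually_sequentially)
      show "\<exists>g\<in>?C. l12 ?M (\<lambda>x. complex_of_real (w x) * \<gamma> x - g x) < e"
        using u[of n] n by (intro bexI[of _ "\<lambda>x. complex_of_real (u n x) * \<gamma> x"]) (auto simp: V_def l12_def q_def)
    qed auto
    then show "w \<in> V" by (simp add: V_def)
  qed
  then obtain u where u: "u \<in> V" "\<And>x. x \<in> half_space \<Longrightarrow> u x = g x" by blast
  show ?thesis
    unfolding \<gamma>_def[symmetric]
  proof (rule l12_closure_cong)
    show "(\<lambda>x. complex_of_real (u x) * \<gamma> x) \<in> ?C" using u by (simp add: V_def)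
    show "(\<lambda>x. complex_of_real (g x) * \<gamma> x) \<in> borel_measurable ?M" using g(1) by (intro measurable_weinstein_borel borel_measurable_times) auto
    show "AE x in ?M. complex_of_real (u x) * \<gamma> x = complex_of_real (g x) * \<gamma> x" using u(2) by (intro AE_I2) simp
  qed
qed

lemma bounded_nonneg_in_closure:
  fixes f :: "(real^'d::finite) \<times> real \<Rightarrow> real"
  assumes a: "\<alpha> > - 1 / 2"
    and f: "f \<in> borel_measurable (weinstein_measure \<alpha>)" "\<And>x. x \<in> half_space \<Longrightarrow> 0 \<le> f x" "\<And>x. x \<in> half_space \<Longrightarrow> f x \<le> B"
      "\<And>x. x \<in> half_space - truncated_half_space n \<Longrightarrow> f x = 0"
  shows "(\<lambda>x. complex_of_real (f x)) \<in> l12_closure (weinstein_measure \<alpha>) gaussian_span"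
proof -
  let ?M = "weinstein_measure \<alpha> :: ((real^'d) \<times> real) measure"
  from weinstein_ex_borel_measurable[OF f(1)] obtain g
    where [measurable]: "g \<in> borel_measurable borel" and g: "AE x in ?M. f x = g x" by auto
  define u where "u x = min \<bar>B\<bar> (max 0 (g x)) * indicator (truncated_half_space n) x / gaussian 1 0 x" for x
  have \<gamma>: "0 < gaussian 1 0 x" for x :: "(real^'d) \<times> real" by (simp add: gaussian_def)
  have "(\<lambda>x. complex_of_real (u x) * complex_of_real (gaussian 1 0 x)) \<in> l12_closure ?M gaussian_span"
  proof (rule gaussian_times_bounded_in_closure[OF a, where B="\<bar>B\<bar> * exp ((real n)\<^sup>2 / 2)"])
    show "u \<in> borel_measurable borel" unfolding u_def by measurable
    show "0 \<le> u x" for x using \<gamma>[of x] by (simp add: u_def)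
    show "u x \<le> \<bar>B\<bar> * exp ((real n)\<^sup>2 / 2)" for x
    proof (cases "x \<in> truncated_half_space n")
      case True
      have "u x \<le> \<bar>B\<bar> / exp (- (real n)\<^sup>2 / 2)"
        unfolding u_def
      proof (rule frac_le)
        show "min \<bar>B\<bar> (max 0 (g x)) * indicator (truncated_half_space n) x \<le> \<bar>B\<bar>" using True by simp
        show "exp (- (real n)\<^sup>2 / 2) \<le> gaussian 1 0 x" by (rule gaussian_ge_on_truncated[OF True])
      qed simp_all
      also have "\<dots> = \<bar>B\<bar> * exp ((real n)\<^sup>2 / 2)"
      proof -
        have "exp (- (real n)\<^sup>2 / 2) * exp ((real n)\<^sup>2 / 2) = 1" by (simp flip: exp_add)
        from inverse_unique[OF this] show ?thesis by (subst divide_inverse) (simp only:)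
      qed
      finally show ?thesis .
    qed (simp add: u_def)
  qed
  then show ?thesis
  proof (rule l12_closure_cong)
    show "(\<lambda>x. complex_of_real (f x)) \<in> borel_measurable ?M" using f(1) by measurable
    show "AE x in ?M. complex_of_real (u x) * complex_of_real (gaussian 1 0 x) = complex_of_real (f x)"
      using g AE_space[of ?M]
    proof eventually_elim
      fix x :: "(real^'d) \<times> real" assume x: "f x = g x" "x \<in> space ?M"
      then have "u x * gaussian 1 0 x = f x"
        using \<gamma>[of x] f(2)[of x] f(3)[of x] f(4)[of x] by (auto simp: u_def indicator_def)
      then show "complex_of_real (u x) * complex_of_real (gaussian 1 0 x) = complex_of_real (f x)"
        by (simp flip: of_real_mult)
    qed
  qed
qed

text \<open>Split into positive and negative, real and imaginary parts, and divide by a Gaussian, which is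
bounded away from zero on the support.\<close>

lemma gaussian_span_dense:
  fixes f :: "(real^'d::finite) \<times> real \<Rightarrow> complex"
  assumes a: "\<alpha> > - 1 / 2" and f: "bounded_on (weinstein_measure \<alpha>) (truncated_half_space n) f" and e: "0 < e"
  shows "\<exists>h\<in>gaussian_span. l12 (weinstein_measure \<alpha>) (\<lambda>x. f x - h x) < e"
proof -
  let ?M = "weinstein_measure \<alpha> :: ((real^'d) \<times> real) measure"
  note cl = gaussian_span_measurable gaussian_span.add gaussian_span.scale
  from f obtain B where [measurable]: "f \<in> borel_measurable ?M"
    and B: "\<And>x. x \<in> half_space \<Longrightarrow> norm (f x) \<le> B" and z: "\<And>x. x \<in> half_space - truncated_half_space n \<Longrightarrow> f x = 0"
    unfolding bounded_on_def space_weinstein_measure by blast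
  have addC: "(\<lambda>x. f x + k x) \<in> l12_closure ?M gaussian_span"
    if "f \<in> l12_closure ?M gaussian_span" "k \<in> l12_closure ?M gaussian_span" for f k
    by (rule l12_closure_add) (use that in \<open>auto intro: cl\<close>)
  have scaleC: "(\<lambda>x. c * f x) \<in> l12_closure ?M gaussian_span" if "f \<in> l12_closure ?M gaussian_span" for f c
    by (rule l12_closure_scale) (use that in \<open>auto intro: cl\<close>)
  have p: "(\<lambda>x. complex_of_real (max 0 (r x))) \<in> l12_closure ?M gaussian_span"
    if "r \<in> borel_measurable ?M" "\<And>x. \<bar>r x\<bar> \<le> norm (f x)" for r
  proof (rule bounded_nonneg_in_closure[OF a, where B=B and n=n])
    show "(\<lambda>x. max 0 (r x)) \<in> borel_measurable ?M" using that(1) by measurable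
    fix x :: "(real^'d) \<times> real"
    show "x \<in> half_space \<Longrightarrow> max 0 (r x) \<le> B" using B[of x] that(2)[of x] norm_ge_zero[of "f x"] by linarith
    show "x \<in> half_space - truncated_half_space n \<Longrightarrow> max 0 (r x) = 0" using z[of x] that(2)[of x] by auto
  qed auto
  have r: "(\<lambda>x. complex_of_real (r x)) \<in> l12_closure ?M gaussian_span"
    if "r \<in> borel_measurable ?M" "\<And>x. \<bar>r x\<bar> \<le> norm (f x)" for r
  proof -
    have "(\<lambda>x. complex_of_real (max 0 (r x)) + (- 1) * complex_of_real (max 0 (- r x))) \<in> l12_closure ?M gaussian_span"
      using that by (intro addC scaleC p) auto
    also have "(\<lambda>x. complex_of_real (max 0 (r x)) + (- 1) * complex_of_real (max 0 (- r x))) = (\<lambda>x. complex_of_real (r x))"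
      by (auto simp: max_def fun_eq_iff)
    finally show ?thesis .
  qed
  have "(\<lambda>x. complex_of_real (Re (f x)) + \<i> * complex_of_real (Im (f x))) \<in> l12_closure ?M gaussian_span"
    by (intro addC scaleC r) (auto simp: abs_Re_le_cmod abs_Im_le_cmod)
  then have "f \<in> l12_closure ?M gaussian_span" by (simp add: complex_eq[symmetric])
  with e show ?thesis by (auto simp: l12_closure_def)
qed

text \<open>If \<open>F\<close> annihilates all Gaussians, then \<open>F\<close> times a fixed Gaussian, an integrable function,
annihilates all bounded Borel functions, again by the monotone class theorem.\<close>

lemma gaussian_times_bounded_orthogonal:
  fixes F :: "(real^'d::finite) \<times> real \<Rightarrow> complex" and g :: "(real^'d) \<times> real \<Rightarrow> real"
  assumes int: "\<And>h. h \<in> gaussian_span \<Longrightarrow> integrable (weinstein_measure \<alpha>) (\<lambda>x. F x * h x)"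
    and zero: "\<And>h. h \<in> gaussian_span \<Longrightarrow> (\<integral>x. F x * h x \<partial>weinstein_measure \<alpha>) = 0"
    and F: "F \<in> borel_measurable (weinstein_measure \<alpha>)"
    and g: "g \<in> borel_measurable borel" "\<And>y. 0 \<le> g y" "\<And>y. g y \<le> B"
  shows "has_bochner_integral (weinstein_measure \<alpha>) (\<lambda>x. F x * (complex_of_real (g x) * complex_of_real (gaussian 1 0 x))) 0"
proof -
  let ?M = "weinstein_measure \<alpha> :: ((real^'d) \<times> real) measure"
  define \<gamma> where "\<gamma> x = complex_of_real (gaussian 1 0 x)" for x :: "(real^'d) \<times> real"
  have [measurable]: "\<gamma> \<in> borel_measurable ?M" unfolding \<gamma>_def by (rule measurable_weinstein_borel) measurable
  note [measurable] = F
  have F\<gamma>: "integrable ?M (\<lambda>x. F x * \<gamma> x)" unfolding \<gamma>_def by (intro int gaussian_span.gaussian) simp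
  define V where "V = {u \<in> borel_measurable borel. has_bochner_integral ?M (\<lambda>x. F x * (complex_of_real (u x) * \<gamma> x)) 0}"
  have "\<exists>u\<in>V. \<forall>x\<in>half_space. u x = g x"
  proof (rule polynomial_gaussian_class[OF _ _ _ _ g])
    fix u :: "(real^'d) \<times> real \<Rightarrow> real"
    assume "(\<lambda>x. complex_of_real (u x) * complex_of_real (gaussian 1 0 x)) \<in> gaussian_span" "u \<in> borel_measurable borel"
    then show "u \<in> V" using int zero by (auto simp: V_def \<gamma>_def has_bochner_integral_iff)
  next
    fix u v :: "(real^'d) \<times> real \<Rightarrow> real" assume "u \<in> V" "v \<in> V"
    then show "(\<lambda>x. u x + v x) \<in> V"
      using has_bochner_integral_add[of ?M "\<lambda>x. F x * (complex_of_real (u x) * \<gamma> x)" 0 "\<lambda>x. F x * (complex_of_real (v x) * \<gamma> x)" 0]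
      by (auto simp: V_def algebra_simps)
  next
    fix c and u :: "(real^'d) \<times> real \<Rightarrow> real" assume "u \<in> V"
    then show "(\<lambda>x. c * u x) \<in> V"
      using has_bochner_integral_mult_right[of "complex_of_real c" ?M "\<lambda>x. F x * (complex_of_real (u x) * \<gamma> x)" 0]
      by (auto simp: V_def mult_ac)
  next
    fix u :: "nat \<Rightarrow> (real^'d) \<times> real \<Rightarrow> real" and w B
    assume u: "\<And>n. u n \<in> V" and B: "\<And>n x. \<bar>u n x\<bar> \<le> B" and l: "\<And>x. (\<lambda>n. u n x) \<longlonglongrightarrow> w x"
    have um: "u n \<in> borel_measurable borel" for n using u by (simp add: V_def)
    have wm: "w \<in> borel_measurable borel" by (rule borel_measurable_LIMSEQ_real[OF l um])
    note [measurable] = um[THEN measurable_weinstein_borel, of _ \<alpha>] wm[THEN measurable_weinstein_borel, of \<alpha>]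
    have d: "integrable ?M (\<lambda>x. norm (F x * \<gamma> x) * B)" using F\<gamma> by simp
    have bd: "AE x in ?M. norm (F x * (complex_of_real (u n x) * \<gamma> x)) \<le> norm (F x * \<gamma> x) * B" for n
    proof (intro AE_I2)
      fix x
      have "norm (F x * \<gamma> x) * \<bar>u n x\<bar> \<le> norm (F x * \<gamma> x) * B" by (intro mult_left_mono B) auto
      then show "norm (F x * (complex_of_real (u n x) * \<gamma> x)) \<le> norm (F x * \<gamma> x) * B" by (simp add: norm_mult mult_ac)
    qed
    have lm: "AE x in ?M. (\<lambda>n. F x * (complex_of_real (u n x) * \<gamma> x)) \<longlonglongrightarrow> F x * (complex_of_real (w x) * \<gamma> x)"
      by (intro AE_I2 tendsto_intros l)
    have m1: "(\<lambda>x. F x * (complex_of_real (w x) * \<gamma> x)) \<in> borel_measurable ?M" by measurable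
    have m2: "\<And>n. (\<lambda>x. F x * (complex_of_real (u n x) * \<gamma> x)) \<in> borel_measurable ?M" by measurable
    have "integrable ?M (\<lambda>x. F x * (complex_of_real (w x) * \<gamma> x))"
      by (rule integrable_dominated_convergence[OF m1 m2 d lm bd])
    moreover have "(\<lambda>n. \<integral>x. F x * (complex_of_real (u n x) * \<gamma> x) \<partial>?M) \<longlonglongrightarrow> (\<integral>x. F x * (complex_of_real (w x) * \<gamma> x) \<partial>?M)"
      by (rule integral_dominated_convergence[OF m1 m2 d lm bd])
    moreover have "(\<integral>x. F x * (complex_of_real (u n x) * \<gamma> x) \<partial>?M) = 0" for n
      using u[of n] by (simp add: V_def has_bochner_integral_iff)
    ultimately show "w \<in> V" using wm by (simp add: V_def has_bochner_integral_iff LIMSEQ_const_iff)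
  qed
  then obtain u where u: "u \<in> V" "\<And>x. x \<in> half_space \<Longrightarrow> u x = g x" by blast
  have "has_bochner_integral ?M (\<lambda>x. F x * (complex_of_real (u x) * \<gamma> x)) 0" using u(1) by (simp add: V_def)
  then show ?thesis
    by (rule has_bochner_integral_cong[THEN iffD1, rotated 3]) (auto simp: u(2) \<gamma>_def)
qed

text \<open>Test against the indicators of the sets where \<open>F\<close> is positive and where it is negative.\<close>

lemma real_orthogonal_imp_zero:
  fixes F :: "(real^'d::finite) \<times> real \<Rightarrow> real"
  assumes F: "F \<in> borel_measurable (weinstein_measure \<alpha>)"
    and z: "\<And>g. g \<in> borel_measurable borel \<Longrightarrow> (\<And>y. 0 \<le> g y) \<Longrightarrow> (\<And>y. g y \<le> 1) \<Longrightarrow>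
      has_bochner_integral (weinstein_measure \<alpha>) (\<lambda>x. F x * (g x * gaussian 1 0 x)) 0"
  shows "AE x in weinstein_measure \<alpha>. F x = 0"
proof -
  let ?M = "weinstein_measure \<alpha> :: ((real^'d) \<times> real) measure"
  have \<gamma>: "0 < gaussian 1 0 x" for x :: "(real^'d) \<times> real" by (simp add: gaussian_def)
  from weinstein_ex_borel_measurable[OF F] obtain R
    where [measurable]: "R \<in> borel_measurable borel" and R: "AE x in ?M. F x = R x" by auto
  have 1: "AE x in ?M. \<sigma> * F x \<le> 0" if "\<sigma> = 1 \<or> \<sigma> = -1" for \<sigma> :: real
  proof -
    define g where "g = (indicator {x. \<sigma> * R x > 0} :: _ \<Rightarrow> real)"
    have "has_bochner_integral ?M (\<lambda>x. F x * (g x * gaussian 1 0 x)) 0"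
      unfolding g_def by (rule z) (auto simp: indicator_def)
    from has_bochner_integral_mult_right[OF this, of \<sigma>]
    have h: "integrable ?M (\<lambda>x. \<sigma> * (F x * (g x * gaussian 1 0 x)))" "(\<integral>x. \<sigma> * (F x * (g x * gaussian 1 0 x)) \<partial>?M) = 0"
      by (auto simp: has_bochner_integral_iff)
    have "AE x in ?M. 0 \<le> \<sigma> * (F x * (g x * gaussian 1 0 x))"
      using R by eventually_elim (use \<gamma> in \<open>auto simp: g_def indicator_def mult.assoc[symmetric] less_imp_le\<close>)
    from integral_nonneg_eq_0_iff_AE[OF h(1) this] h(2)
    have "AE x in ?M. \<sigma> * (F x * (g x * gaussian 1 0 x)) = 0" by simp
    with R show ?thesis
    proof eventually_elim
      fix x assume "F x = R x" "\<sigma> * (F x * (g x * gaussian 1 0 x)) = 0"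
      then show "\<sigma> * F x \<le> 0" using \<gamma>[of x] by (auto simp: g_def indicator_def split: if_splits)
    qed
  qed
  have "AE x in ?M. F x \<le> 0" "AE x in ?M. - F x \<le> 0" using 1[of 1] 1[of "-1"] by auto
  then show ?thesis by eventually_elim simp
qed

lemma gaussian_span_total:
  fixes F :: "(real^'d::finite) \<times> real \<Rightarrow> complex"
  assumes F: "F \<in> borel_measurable (weinstein_measure \<alpha>)"
    and int: "\<And>h. h \<in> gaussian_span \<Longrightarrow> integrable (weinstein_measure \<alpha>) (\<lambda>x. F x * h x)"
    and zero: "\<And>h. h \<in> gaussian_span \<Longrightarrow> (\<integral>x. F x * h x \<partial>weinstein_measure \<alpha>) = 0"
  shows "AE x in weinstein_measure \<alpha>. F x = 0"
proof -
  note 0 = gaussian_times_bounded_orthogonal[OF int zero F]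
  have "AE x in weinstein_measure \<alpha>. Re (F x) = 0"
  proof (rule real_orthogonal_imp_zero)
    fix g :: "(real^'d) \<times> real \<Rightarrow> real" assume "g \<in> borel_measurable borel" "\<And>y. 0 \<le> g y" "\<And>y. g y \<le> 1"
    from has_bochner_integral_Re[OF 0[OF _ _ this]]
    show "has_bochner_integral (weinstein_measure \<alpha>) (\<lambda>x. Re (F x) * (g x * gaussian 1 0 x)) 0"
      by (simp flip: of_real_mult)
  qed (use F in measurable)
  moreover have "AE x in weinstein_measure \<alpha>. Im (F x) = 0"
  proof (rule real_orthogonal_imp_zero)
    fix g :: "(real^'d) \<times> real \<Rightarrow> real" assume "g \<in> borel_measurable borel" "\<And>y. 0 \<le> g y" "\<And>y. g y \<le> 1"
    from has_bochner_integral_Im[OF 0[OF _ _ this]]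
    show "has_bochner_integral (weinstein_measure \<alpha>) (\<lambda>x. Im (F x) * (g x * gaussian 1 0 x)) 0"
      by (simp flip: of_real_mult)
  qed (use F in measurable)
  ultimately show ?thesis by eventually_elim (simp add: complex_eq_iff)
qed

theorem plancherel_kernel_weinstein:
  assumes a: "\<alpha> > - 1 / 2"
  shows "plancherel_kernel (weinstein_measure \<alpha> :: ((real^'d::finite) \<times> real) measure) (weinstein_kernel \<alpha>)
    truncated_half_space gaussian_span"
proof (intro plancherel_kernel.intro plancherel_kernel_axioms.intro symmetric_kernel_weinstein a)
  show "(\<Union>n. truncated_half_space n) = space (weinstein_measure \<alpha> :: ((real^'d) \<times> real) measure)"
    by (simp add: UN_truncated_half_space)
  show "m \<le> n \<Longrightarrow> truncated_half_space m \<subseteq> (truncated_half_space n :: ((real^'d) \<times> real) set)" for m n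
    by (auto simp: truncated_half_space_def)
qed (use emeasure_truncated_half_space[OF a] gaussian_span_inverted[OF a] gaussian_span_dense[OF a]
  in \<open>auto intro: gaussian_span_total\<close>)


section \<open>The inequalities of Hoelder and Minkowski\<close>

lemma enn_powr_ennreal: "0 \<le> x \<Longrightarrow> enn_powr (ennreal x) a = ennreal (x powr a)"
  by (simp add: enn_powr_def)

lemma enn_powr_0 [simp]: "enn_powr 0 a = 0"
  by (simp add: enn_powr_def)

lemma enn_powr_top [simp]: "enn_powr top a = top"
  by (simp add: enn_powr_def)

lemma enn_powr_less_top_iff: "enn_powr t a < \<infinity> \<longleftrightarrow> t < \<infinity>"
  by (simp add: enn_powr_def less_top[symmetric])

lemma enn_powr_one [simp]: "enn_powr t 1 = t"
  by (cases t) (auto simp: enn_powr_def)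

lemma enn_powr_mono: "s \<le> t \<Longrightarrow> 0 \<le> a \<Longrightarrow> enn_powr s a \<le> enn_powr t a"
  by (cases s; cases t) (auto simp: enn_powr_ennreal top_unique intro!: ennreal_leI powr_mono2)

lemma enn_powr_eq_0_iff: "enn_powr t a = 0 \<longleftrightarrow> t = 0"
  by (cases t) (auto simp: enn_powr_ennreal ennreal_eq_0_iff)

lemma enn_powr_tendsto_0:
  assumes "u \<longlonglongrightarrow> 0" "0 < a"
  shows "(\<lambda>n. enn_powr (u n) a) \<longlonglongrightarrow> 0"
proof (rule order_tendstoI)
  fix e :: ennreal assume "0 < e"
  show "\<forall>\<^sub>F n in sequentially. enn_powr (u n) a < e"
  proof (cases e)
    case top
    have "\<forall>\<^sub>F n in sequentially. u n < \<infinity>" by (rule order_tendstoD[OF assms(1)]) simp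
    then show ?thesis by eventually_elim (use enn_powr_less_top_iff top in simp)
  next
    case (real r)
    with \<open>0 < e\<close> have r: "r > 0" by simp
    then have "0 < ennreal (r powr (1 / a))" by simp
    from order_tendstoD(2)[OF assms(1) this] show ?thesis
    proof eventually_elim
      case (elim n)
      then obtain x where x: "u n = ennreal x" "0 \<le> x" "x < r powr (1 / a)"
        by (cases "u n") (auto simp: ennreal_less_iff)
      have "x powr a < (r powr (1 / a)) powr a" using x assms(2) by (intro powr_less_mono2) auto
      with r assms(2) x show ?case by (simp add: enn_powr_ennreal real powr_powr ennreal_less_iff)
    qed
  qed
qed simp

text \<open>The \<open>p\<close>-th power of the norm, which is additive on disjoint supports and suits Fubini and Fatou better
than the norm.\<close>

definition lp_integral :: "'a measure \<Rightarrow> real \<Rightarrow> ('a \<Rightarrow> complex) \<Rightarrow> ennreal" where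
  "lp_integral M p f = (\<integral>\<^sup>+x. ennreal (norm (f x) powr p) \<partial>M)"

lemma lp_norm_ennreal: "0 \<le> p \<Longrightarrow> lp_norm M (ennreal p) f = enn_powr (lp_integral M p f) (1 / p)"
  by (simp add: lp_norm_def lp_integral_def)

lemma lp_norm_top: "lp_norm M top f = esssup M (\<lambda>x. ennreal (norm (f x)))"
  by (simp add: lp_norm_def)

lemma lp_norm_less_top_iff: "0 \<le> p \<Longrightarrow> lp_norm M (ennreal p) f < \<infinity> \<longleftrightarrow> lp_integral M p f < \<infinity>"
  by (simp add: lp_norm_ennreal enn_powr_less_top_iff del: infinity_ennreal_def)

lemma lp_integral_cong_AE: "AE x in M. norm (f x) = norm (g x) \<Longrightarrow> lp_integral M p f = lp_integral M p g"
  unfolding lp_integral_def by (rule nn_integral_cong_AE) auto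

lemma lp_integral_mono_AE: "AE x in M. norm (f x) \<le> norm (g x) \<Longrightarrow> 0 \<le> p \<Longrightarrow> lp_integral M p f \<le> lp_integral M p g"
  unfolding lp_integral_def by (rule nn_integral_mono_AE) (auto intro!: ennreal_leI powr_mono2)

lemma lp_integral_eq_0_iff:
  "f \<in> borel_measurable M \<Longrightarrow> lp_integral M p f = 0 \<longleftrightarrow> (AE x in M. f x = 0)"
  unfolding lp_integral_def by (subst nn_integral_0_iff_AE) (auto simp: ennreal_eq_0_iff)

lemma conj_exponent_one: "conj_exponent 1 = top"
  by (simp add: conj_exponent_def)

lemma conj_exponent_gt: "1 < p \<Longrightarrow> conj_exponent p = ennreal (p / (p - 1))"
  by (simp add: conj_exponent_def)

theorem Hoelder_lp_norm:
  fixes f g :: "'a \<Rightarrow> complex"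
  assumes p: "1 \<le> p" and [measurable]: "f \<in> borel_measurable M" "g \<in> borel_measurable M"
  shows "(\<integral>\<^sup>+x. ennreal (norm (f x * g x)) \<partial>M) \<le> lp_norm M (ennreal p) f * lp_norm M (conj_exponent p) g"
proof (cases "p = 1")
  case True
  have "(\<integral>\<^sup>+x. ennreal (norm (f x * g x)) \<partial>M) \<le> (\<integral>\<^sup>+x. ennreal (norm (f x)) * esssup M (\<lambda>x. ennreal (norm (g x))) \<partial>M)"
    using esssup_AE[of "\<lambda>x. ennreal (norm (g x))" M]
    by (intro nn_integral_mono_AE, eventually_elim) (simp add: norm_mult ennreal_mult mult_left_mono)
  also have "\<dots> = (\<integral>\<^sup>+x. ennreal (norm (f x)) \<partial>M) * esssup M (\<lambda>x. ennreal (norm (g x)))"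
    by (rule nn_integral_multc) measurable
  also have "(\<integral>\<^sup>+x. ennreal (norm (f x)) \<partial>M) = lp_norm M (ennreal p) f"
    by (subst lp_norm_ennreal) (use True in \<open>simp_all add: lp_integral_def\<close>)
  finally show ?thesis using True by (simp only: conj_exponent_one lp_norm_top)
next
  case False
  with p have p1: "p > 1" by simp
  define q where "q = p / (p - 1)"
  have q1: "q > 1" and pq: "1 / p + 1 / q = 1" using p1 by (auto simp: q_def field_simps)
  have ce: "conj_exponent p = ennreal q" using p1 by (simp add: conj_exponent_gt q_def)
  let ?A = "lp_integral M p f" and ?B = "lp_integral M q g"
  have N: "lp_norm M (ennreal p) f = enn_powr ?A (1 / p)" "lp_norm M (conj_exponent p) g = enn_powr ?B (1 / q)"
    using p1 q1 by (auto simp: ce lp_norm_ennreal)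
  consider "?A = 0" | "?B = 0" | "?A \<noteq> 0" "?B \<noteq> 0" "?A = \<infinity> \<or> ?B = \<infinity>" | "?A \<noteq> 0" "?B \<noteq> 0" "?A \<noteq> \<infinity>" "?B \<noteq> \<infinity>" by blast
  then show ?thesis
  proof cases
    case 1
    then have "AE x in M. f x = 0" by (simp add: lp_integral_eq_0_iff)
    then have "(\<integral>\<^sup>+x. ennreal (norm (f x * g x)) \<partial>M) = 0" by (subst nn_integral_0_iff_AE) auto
    then show ?thesis by simp
  next
    case 2
    then have "AE x in M. g x = 0" by (simp add: lp_integral_eq_0_iff)
    then have "(\<integral>\<^sup>+x. ennreal (norm (f x * g x)) \<partial>M) = 0" by (subst nn_integral_0_iff_AE) auto
    then show ?thesis by simp
  next
    case 3
    then have "lp_norm M (ennreal p) f * lp_norm M (conj_exponent p) g = \<infinity>"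
      unfolding N by (auto simp: ennreal_mult_eq_top_iff enn_powr_eq_0_iff)
    then show ?thesis by simp
  next
    case 4
    then obtain A B where A: "?A = ennreal A" "A > 0" and B: "?B = ennreal B" "B > 0"
      by (metis ennreal_cases ennreal_0 infinity_ennreal_def order_le_less)
    define a where "a = A powr (1 / p)"
    define b where "b = B powr (1 / q)"
    have ab: "a > 0" "b > 0" using A B by (auto simp: a_def b_def)
    have ap: "a powr p = A" "b powr q = B" using A B p1 q1 by (auto simp: a_def b_def powr_powr)
    have "(\<integral>\<^sup>+x. ennreal (norm (f x * g x)) \<partial>M)
       \<le> (\<integral>\<^sup>+x. ennreal (a * b / (p * A)) * ennreal (norm (f x) powr p) + ennreal (a * b / (q * B)) * ennreal (norm (g x) powr q) \<partial>M)"
    proof (rule nn_integral_mono)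
      fix x
      have "norm (f x) / a * (norm (g x) / b) \<le> (norm (f x) / a) powr p / p + (norm (g x) / b) powr q / q"
        using ab by (intro Youngs_inequality p1 q1 pq) auto
      then have "norm (f x) / a * (norm (g x) / b) * (a * b) \<le> ((norm (f x) / a) powr p / p + (norm (g x) / b) powr q / q) * (a * b)"
        using ab by (intro mult_right_mono) auto
      then have "norm (f x * g x) \<le> a * b / (p * A) * norm (f x) powr p + a * b / (q * B) * norm (g x) powr q"
        using ab ap by (simp add: norm_mult powr_divide field_simps)
      from ennreal_leI[OF this]
      show "ennreal (norm (f x * g x)) \<le> ennreal (a * b / (p * A)) * ennreal (norm (f x) powr p) + ennreal (a * b / (q * B)) * ennreal (norm (g x) powr q)"
        using ab A B p1 q1 by (simp add: ennreal_mult[symmetric] ennreal_plus[symmetric] del: ennreal_plus)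
    qed
    also have "\<dots> = ennreal (a * b / (p * A)) * ?A + ennreal (a * b / (q * B)) * ?B"
      by (simp add: nn_integral_add nn_integral_cmult lp_integral_def)
    also have "\<dots> = ennreal (a * b / (p * A) * A + a * b / (q * B) * B)"
      using ab A B p1 q1 by (simp add: ennreal_mult[symmetric] ennreal_plus[symmetric] del: ennreal_plus)
    also have "a * b / (p * A) * A + a * b / (q * B) * B = a * b"
    proof -
      have "a * b / (p * A) * A + a * b / (q * B) * B = a * b * (1 / p + 1 / q)" using A B by (simp add: field_simps)
      then show ?thesis by (simp only: pq mult_1_right)
    qed
    finally show ?thesis
      unfolding N A B using A(2) B(2) ab by (simp add: enn_powr_ennreal a_def b_def ennreal_mult)
  qed
qed

text \<open>Convexity of the power, applied to \<open>s + t = (1 - \<theta>) (s / (1 - \<theta>)) + \<theta> (t / \<theta>)\<close>. The choice of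
\<open>\<theta>\<close> as the share of the second norm in the sum of the norms gives Minkowski's inequality.\<close>

lemma add_powr_le_convex:
  fixes p s t \<theta> :: real
  assumes p: "1 \<le> p" and st: "0 \<le> s" "0 \<le> t" and \<theta>: "0 < \<theta>" "\<theta> < 1"
  shows "(s + t) powr p \<le> (1 - \<theta>) powr (1 - p) * s powr p + \<theta> powr (1 - p) * t powr p"
proof -
  have ge1: "1 \<le> \<theta> powr (1 - p)" "1 \<le> (1 - \<theta>) powr (1 - p)"
    using p \<theta> powr_mono2'[of "1 - p" \<theta> 1] powr_mono2'[of "1 - p" "1 - \<theta>" 1] by auto
  consider "s = 0" | "t = 0" | "s > 0" "t > 0" using st by linarith
  then show ?thesis
  proof cases
    case 1
    then show ?thesis using mult_right_mono[OF ge1(1), of "t powr p"] p by simp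
  next
    case 2
    then show ?thesis using mult_right_mono[OF ge1(2), of "s powr p"] p by simp
  next
    case 3
    have "((1 - \<theta>) * (s / (1 - \<theta>)) + \<theta> * (t / \<theta>)) powr p \<le> (1 - \<theta>) * (s / (1 - \<theta>)) powr p + \<theta> * (t / \<theta>) powr p"
      using convex_onD[OF powr_convex[OF p], of \<theta> "s / (1 - \<theta>)" "t / \<theta>"] 3 \<theta> by simp
    moreover have "(1 - \<theta>) * (s / (1 - \<theta>)) powr p = (1 - \<theta>) powr (1 - p) * s powr p"
      "\<theta> * (t / \<theta>) powr p = \<theta> powr (1 - p) * t powr p"
      using \<theta> 3 by (simp_all add: powr_divide powr_diff)
    ultimately show ?thesis using \<theta> by simp
  qed
qed

theorem Minkowski_lp_norm:
  fixes f g :: "'a \<Rightarrow> complex"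
  assumes p: "1 \<le> p" and [measurable]: "f \<in> borel_measurable M" "g \<in> borel_measurable M"
  shows "lp_norm M (ennreal p) (\<lambda>x. f x + g x) \<le> lp_norm M (ennreal p) f + lp_norm M (ennreal p) g"
proof -
  let ?A = "lp_integral M p f" and ?B = "lp_integral M p g"
  have N: "lp_norm M (ennreal p) h = enn_powr (lp_integral M p h) (1 / p)" for h
    using p by (simp add: lp_norm_ennreal)
  consider "?A = 0" | "?B = 0" | "?A = \<infinity> \<or> ?B = \<infinity>" | "?A \<noteq> 0" "?B \<noteq> 0" "?A \<noteq> \<infinity>" "?B \<noteq> \<infinity>" by blast
  then show ?thesis
  proof cases
    case 1
    then have "AE x in M. f x = 0" by (simp add: lp_integral_eq_0_iff)
    then have "lp_integral M p (\<lambda>x. f x + g x) = ?B" by (intro lp_integral_cong_AE) auto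
    then show ?thesis by (simp add: N)
  next
    case 2
    then have "AE x in M. g x = 0" by (simp add: lp_integral_eq_0_iff)
    then have "lp_integral M p (\<lambda>x. f x + g x) = ?A" by (intro lp_integral_cong_AE) auto
    then show ?thesis by (simp add: N)
  next
    case 3
    then show ?thesis by (auto simp: N)
  next
    case 4
    then obtain A B where A: "?A = ennreal A" "A > 0" and B: "?B = ennreal B" "B > 0"
      by (metis ennreal_cases ennreal_0 infinity_ennreal_def order_le_less)
    define a where "a = A powr (1 / p)"
    define b where "b = B powr (1 / p)"
    have ab: "a > 0" "b > 0" using A B by (auto simp: a_def b_def)
    have ap: "A = a powr p" "B = b powr p" using A B p by (auto simp: a_def b_def powr_powr)
    define \<theta> where "\<theta> = b / (a + b)"
    have \<theta>: "0 < \<theta>" "\<theta> < 1" using ab by (auto simp: \<theta>_def)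
    have \<theta>': "1 - \<theta> = a / (a + b)" using ab by (simp add: \<theta>_def field_simps)
    have "lp_integral M p (\<lambda>x. f x + g x) \<le> (\<integral>\<^sup>+x. ennreal ((1 - \<theta>) powr (1 - p)) * ennreal (norm (f x) powr p) +
        ennreal (\<theta> powr (1 - p)) * ennreal (norm (g x) powr p) \<partial>M)"
      unfolding lp_integral_def
    proof (rule nn_integral_mono)
      fix x
      have "norm (f x + g x) powr p \<le> (norm (f x) + norm (g x)) powr p"
        using p by (intro powr_mono2 norm_triangle_ineq) auto
      also have "\<dots> \<le> (1 - \<theta>) powr (1 - p) * norm (f x) powr p + \<theta> powr (1 - p) * norm (g x) powr p"
        using p \<theta> by (intro add_powr_le_convex) auto
      finally show "ennreal (norm (f x + g x) powr p) \<le> ennreal ((1 - \<theta>) powr (1 - p)) * ennreal (norm (f x) powr p) +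
        ennreal (\<theta> powr (1 - p)) * ennreal (norm (g x) powr p)"
        by (simp add: ennreal_mult[symmetric] ennreal_plus[symmetric] ennreal_leI del: ennreal_plus)
    qed
    also have "\<dots> = ennreal ((1 - \<theta>) powr (1 - p)) * ?A + ennreal (\<theta> powr (1 - p)) * ?B"
      by (simp add: nn_integral_add nn_integral_cmult lp_integral_def)
    also have "\<dots> = ennreal ((1 - \<theta>) powr (1 - p) * A + \<theta> powr (1 - p) * B)"
      using A B by (simp add: ennreal_mult[symmetric] ennreal_plus[symmetric] del: ennreal_plus)
    also have "(1 - \<theta>) powr (1 - p) * A + \<theta> powr (1 - p) * B = (a + b) powr p"
    proof -
      have e: "(c / S) powr (1 - p) * c powr p = S powr (p - 1) * c" if "c > 0" "S > 0" for c S :: real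
        using that by (simp add: powr_divide powr_diff)
      have "(a / (a + b)) powr (1 - p) * a powr p = (a + b) powr (p - 1) * a"
        "(b / (a + b)) powr (1 - p) * b powr p = (a + b) powr (p - 1) * b"
        using ab by (auto intro!: e)
      then have "(1 - \<theta>) powr (1 - p) * A + \<theta> powr (1 - p) * B = (a + b) powr (p - 1) * (a + b)"
        unfolding ap \<theta>' by (simp add: \<theta>_def distrib_left)
      also have "\<dots> = (a + b) powr p" using ab by (simp add: powr_diff)
      finally show ?thesis .
    qed
    finally have "lp_integral M p (\<lambda>x. f x + g x) \<le> ennreal ((a + b) powr p)" .
    then have "lp_norm M (ennreal p) (\<lambda>x. f x + g x) \<le> enn_powr (ennreal ((a + b) powr p)) (1 / p)"
      unfolding N using p by (intro enn_powr_mono) auto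
    also have "\<dots> = ennreal a + ennreal b"
      using ab p by (simp add: enn_powr_ennreal powr_powr)
    finally show ?thesis
      unfolding N A B using A(2) B(2) by (simp add: enn_powr_ennreal a_def b_def)
  qed
qed

lemma Hoelder_integrable:
  fixes f g :: "'a \<Rightarrow> complex"
  assumes "1 \<le> p" "f \<in> Lp_space M (ennreal p)" "g \<in> Lp_space M (conj_exponent p)"
  shows "integrable M (\<lambda>x. f x * g x)"
proof (rule integrableI_bounded)
  have m: "f \<in> borel_measurable M" "g \<in> borel_measurable M" using assms by (auto simp: Lp_space_def)
  then show "(\<lambda>x. f x * g x) \<in> borel_measurable M" by measurable
  have "(\<integral>\<^sup>+x. ennreal (norm (f x * g x)) \<partial>M) \<le> lp_norm M (ennreal p) f * lp_norm M (conj_exponent p) g"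
    by (rule Hoelder_lp_norm[OF assms(1) m])
  also have "\<dots> < \<infinity>" using assms by (simp add: Lp_space_def ennreal_mult_less_top)
  finally show "(\<integral>\<^sup>+x. ennreal (norm (f x * g x)) \<partial>M) < \<infinity>" .
qed

lemma tendsto_integral_pairing:
  fixes f :: "nat \<Rightarrow> 'a \<Rightarrow> complex"
  assumes i: "\<And>n. integrable M (\<lambda>x. f n x * h x)" "integrable M (\<lambda>x. g x * h x)"
    and b: "\<And>n. (\<integral>\<^sup>+x. ennreal (norm ((f n x - g x) * h x)) \<partial>M) \<le> N n * H" and N: "N \<longlonglongrightarrow> 0" and H: "H < \<infinity>"
  shows "(\<lambda>n. \<integral>x. f n x * h x \<partial>M) \<longlonglongrightarrow> (\<integral>x. g x * h x \<partial>M)"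
proof (rule tendsto_L1_int[OF i])
  have "(\<lambda>n. N n * H) \<longlonglongrightarrow> 0 * H"
    using H by (intro tendsto_mult_ennreal N tendsto_const) auto
  then have NH: "(\<lambda>n. N n * H) \<longlonglongrightarrow> 0" by simp
  show "(\<lambda>n. \<integral>\<^sup>+x. ennreal (norm (f n x * h x - g x * h x)) \<partial>M) \<longlonglongrightarrow> 0"
    using b by (intro tendsto_sandwich[OF _ _ tendsto_const NH]) (auto simp: left_diff_distrib)
qed

lemma tendsto_integral_Hoelder:
  fixes f :: "nat \<Rightarrow> 'a \<Rightarrow> complex"
  assumes p: "1 \<le> p" and f: "\<And>n. f n \<in> borel_measurable M" and g: "g \<in> borel_measurable M" and h: "h \<in> Lp_space M (conj_exponent p)"
    and i: "\<And>n. integrable M (\<lambda>x. f n x * h x)" "integrable M (\<lambda>x. g x * h x)"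
    and l: "(\<lambda>n. lp_norm M (ennreal p) (\<lambda>x. f n x - g x)) \<longlonglongrightarrow> 0"
  shows "(\<lambda>n. \<integral>x. f n x * h x \<partial>M) \<longlonglongrightarrow> (\<integral>x. g x * h x \<partial>M)"
proof (rule tendsto_integral_pairing[OF i _ l])
  show "lp_norm M (conj_exponent p) h < \<infinity>" using h by (simp add: Lp_space_def)
  show "(\<integral>\<^sup>+x. ennreal (norm ((f n x - g x) * h x)) \<partial>M) \<le> lp_norm M (ennreal p) (\<lambda>x. f n x - g x) * lp_norm M (conj_exponent p) h" for n
    using f g h by (intro Hoelder_lp_norm p) (auto simp: Lp_space_def)
qed

lemma tendsto_integral_Hoelder_conj:
  fixes f :: "nat \<Rightarrow> 'a \<Rightarrow> complex"
  assumes p: "1 \<le> p" and f: "\<And>n. f n \<in> borel_measurable M" and g: "g \<in> borel_measurable M" and h: "h \<in> Lp_space M (ennreal p)"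
    and i: "\<And>n. integrable M (\<lambda>x. f n x * h x)" "integrable M (\<lambda>x. g x * h x)"
    and l: "(\<lambda>n. lp_norm M (conj_exponent p) (\<lambda>x. f n x - g x)) \<longlonglongrightarrow> 0"
  shows "(\<lambda>n. \<integral>x. f n x * h x \<partial>M) \<longlonglongrightarrow> (\<integral>x. g x * h x \<partial>M)"
proof (rule tendsto_integral_pairing[OF i _ l])
  show "lp_norm M (ennreal p) h < \<infinity>" using h by (simp add: Lp_space_def)
  show "(\<integral>\<^sup>+x. ennreal (norm ((f n x - g x) * h x)) \<partial>M) \<le> lp_norm M (conj_exponent p) (\<lambda>x. f n x - g x) * lp_norm M (ennreal p) h" for n
    using Hoelder_lp_norm[OF p, of h M "\<lambda>x. f n x - g x"] f g h by (simp add: Lp_space_def mult.commute)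
qed

lemma integrable_bounded_lp_integral:
  assumes f: "integrable_bounded M f" and p: "1 \<le> p"
  shows "lp_integral M p f < \<infinity>"
proof -
  from f obtain B where i: "integrable M f" and B: "\<And>x. x \<in> space M \<Longrightarrow> norm (f x) \<le> B" by (auto simp: integrable_bounded_def)
  note [measurable] = borel_measurable_integrable[OF i]
  have "lp_integral M p f \<le> (\<integral>\<^sup>+x. ennreal (\<bar>B\<bar> powr (p - 1)) * ennreal (norm (f x)) \<partial>M)"
    unfolding lp_integral_def
  proof (rule nn_integral_mono)
    fix x assume "x \<in> space M"
    then have "norm (f x) \<le> \<bar>B\<bar>" using B by force
    then have "norm (f x) powr (p - 1) * norm (f x) \<le> \<bar>B\<bar> powr (p - 1) * norm (f x)"
      using p by (intro mult_right_mono powr_mono2) auto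
    moreover have "norm (f x) powr p = norm (f x) powr (p - 1) * norm (f x)" by (auto simp: powr_diff)
    ultimately show "ennreal (norm (f x) powr p) \<le> ennreal (\<bar>B\<bar> powr (p - 1)) * ennreal (norm (f x))"
      by (simp add: ennreal_mult[symmetric] ennreal_leI)
  qed
  also have "\<dots> = ennreal (\<bar>B\<bar> powr (p - 1)) * (\<integral>\<^sup>+x. ennreal (norm (f x)) \<partial>M)" by (rule nn_integral_cmult) measurable
  also have "\<dots> < \<infinity>" using i by (simp add: integrable_iff_bounded ennreal_mult_less_top)
  finally show ?thesis .
qed

lemma bounded_Lp_top:
  assumes "f \<in> borel_measurable M" "AE x in M. norm (f x) \<le> B"
  shows "f \<in> Lp_space M top"
proof -
  have "esssup M (\<lambda>x. ennreal (norm (f x))) \<le> ennreal B"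
    using assms by (intro esssup_I) (auto elim!: eventually_mono intro: ennreal_leI)
  then show ?thesis using assms(1) by (auto simp: Lp_space_def lp_norm_top less_top[symmetric] top_unique)
qed

lemma integrable_bounded_Lp_space:
  assumes f: "integrable_bounded M f" and p: "1 \<le> p"
  shows "f \<in> Lp_space M (ennreal p)" "f \<in> Lp_space M (conj_exponent p)"
proof -
  have m: "f \<in> borel_measurable M" using f by (auto intro: borel_measurable_integrable)
  show "f \<in> Lp_space M (ennreal p)"
    using m integrable_bounded_lp_integral[OF f p] p lp_norm_less_top_iff[of p M f] by (simp add: Lp_space_def)
  show "f \<in> Lp_space M (conj_exponent p)"
  proof (cases "p = 1")
    case True
    from f obtain B where "\<forall>x\<in>space M. norm (f x) \<le> B" by (auto simp: integrable_bounded_def)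
    then have "f \<in> Lp_space M top" by (intro bounded_Lp_top m AE_I2) auto
    then show ?thesis by (simp only: True conj_exponent_one)
  next
    case False
    with p have "1 < p" "1 \<le> p / (p - 1)" by (auto simp: field_simps)
    then show ?thesis
      using m integrable_bounded_lp_integral[OF f, of "p / (p - 1)"] lp_norm_less_top_iff[of "p / (p - 1)" M f]
      by (simp add: conj_exponent_gt Lp_space_def)
  qed
qed


section \<open>A Hausdorff--Young inequality by real interpolation\<close>

lemma nn_integral_powr_Icc:
  assumes "e > - 1" "0 \<le> c"
  shows "(\<integral>\<^sup>+t. ennreal (indicator {0..c} t * t powr e) \<partial>lborel) = ennreal (c powr (e + 1) / (e + 1))"
  by (rule nn_integral_has_integral_lebesgue[OF _ has_integral_powr_from_0[OF assms]]) simp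

context plancherel_kernel
begin

lemma bounded_on_mult_indicator:
  assumes f: "bounded_on M A f" and S: "{x \<in> space M. P x} \<in> sets M"
  shows "bounded_on M A (\<lambda>x. f x * indicator {x. P x} x)"
proof -
  have [measurable]: "f \<in> borel_measurable M" using f by (simp add: bounded_on_def)
  note [measurable] = S
  have "(\<lambda>x. f x * indicator {x \<in> space M. P x} x) \<in> borel_measurable M" by measurable
  then have "(\<lambda>x. f x * indicator {x. P x} x) \<in> borel_measurable M"
    by (rule measurable_cong[THEN iffD1, rotated]) (simp add: indicator_def)
  moreover have "norm (f x * indicator {x. P x} x) \<le> norm (f x)" for x by (simp add: indicator_def)
  moreover obtain B where "\<And>x. x \<in> space M \<Longrightarrow> norm (f x) \<le> B" using f unfolding bounded_on_def by blast
  ultimately show ?thesis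
    using f unfolding bounded_on_def by (intro conjI exI[of _ B] ballI) (auto intro: order_trans)
qed

text \<open>Split \<open>f\<close> at the height where \<open>t \<bar>f\<bar>\<^bsup>p-1\<^esup> = 2N\<close>. The upper part has \<open>L\<^sup>1\<close>-norm at most
\<open>t / 2\<close>, so its transform is at most \<open>t / 2\<close>. Where the transform of \<open>f\<close> reaches \<open>t\<close>, that of the
lower part must reach \<open>t / 2\<close>, which Chebyshev's inequality and the \<open>L\<^sup>2\<close> bound limit.\<close>

lemma truncated_level_bound:
  assumes f: "bounded_on M (E n) f" and p: "1 < p" and N: "lp_integral M p f \<le> ennreal N" "0 < N" and t: "0 < t"
  shows "(\<integral>\<^sup>+y. ennreal (indicator {0..norm (T f y)} t) \<partial>M) \<le>
     (\<integral>\<^sup>+x. ennreal (4 / t\<^sup>2 * (norm (f x))\<^sup>2 * indicator {x. t * norm (f x) powr (p - 1) \<le> 2 * N} x) \<partial>M)"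
proof -
  let ?P = "\<lambda>x. t * norm (f x) powr (p - 1) \<le> 2 * N"
  have fm[measurable]: "f \<in> borel_measurable M" using f by (simp add: bounded_on_def)
  define f1 where "f1 x = f x * indicator {x. \<not> ?P x} x" for x
  define f2 where "f2 x = f x * indicator {x. ?P x} x" for x
  have b1: "bounded_on M (E n) f1" unfolding f1_def by (rule bounded_on_mult_indicator[OF f]) measurable
  have b2: "bounded_on M (E n) f2" unfolding f2_def by (rule bounded_on_mult_indicator[OF f]) measurable
  have i1: "integrable M f1" and i2: "integrable M f2" using b1 b2 by (auto intro: bounded_on_integrable)
  have "(\<integral>\<^sup>+x. ennreal (norm (f1 x)) \<partial>M) \<le> (\<integral>\<^sup>+x. ennreal (t / (2 * N)) * ennreal (norm (f x) powr p) \<partial>M)"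
  proof (rule nn_integral_mono)
    fix x
    show "ennreal (norm (f1 x)) \<le> ennreal (t / (2 * N)) * ennreal (norm (f x) powr p)"
    proof (cases "?P x")
      case False
      then have "1 \<le> t / (2 * N) * norm (f x) powr (p - 1)" using N by (simp add: field_simps)
      from mult_right_mono[OF this, of "norm (f x)"]
      have "norm (f x) \<le> t / (2 * N) * (norm (f x) powr (p - 1) * norm (f x))" by (simp add: mult.assoc)
      also have "norm (f x) powr (p - 1) * norm (f x) = norm (f x) powr p" by (auto simp: powr_diff)
      finally have "norm (f1 x) \<le> t / (2 * N) * norm (f x) powr p" using False by (simp add: f1_def)
      then show ?thesis using t N by (simp add: ennreal_mult[symmetric] ennreal_leI)
    qed (simp add: f1_def)
  qed
  also have "\<dots> = ennreal (t / (2 * N)) * lp_integral M p f"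
    unfolding lp_integral_def by (rule nn_integral_cmult) measurable
  also have "\<dots> \<le> ennreal (t / (2 * N)) * ennreal N" by (intro mult_left_mono N) simp
  also have "\<dots> = ennreal (t / 2)" using t N by (simp add: ennreal_mult[symmetric])
  finally have "(\<integral>x. norm (f1 x) \<partial>M) \<le> t / 2"
    using i1 t by (subst (asm) nn_integral_eq_integral) auto
  then have T1: "norm (T f1 y) \<le> t / 2" if "y \<in> space M" for y
    using norm_T_le[OF i1 that] by linarith
  have f12: "T f y = T f1 y + T f2 y" if "y \<in> space M" for y
  proof -
    have "(\<lambda>x. f1 x + f2 x) = f" by (auto simp: f1_def f2_def indicator_def fun_eq_iff)
    with T_add[OF i1 i2 that] show ?thesis by simp
  qed
  have "(\<integral>\<^sup>+y. ennreal (indicator {0..norm (T f y)} t) \<partial>M) \<le> (\<integral>\<^sup>+y. ennreal (4 / t\<^sup>2) * ennreal ((norm (T f2 y))\<^sup>2) \<partial>M)"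
  proof (rule nn_integral_mono)
    fix y assume y: "y \<in> space M"
    show "ennreal (indicator {0..norm (T f y)} t) \<le> ennreal (4 / t\<^sup>2) * ennreal ((norm (T f2 y))\<^sup>2)"
    proof (cases "t \<le> norm (T f y)")
      case True
      then have "t / 2 \<le> norm (T f2 y)" using T1[OF y] f12[OF y] norm_triangle_ineq[of "T f1 y" "T f2 y"] by simp
      then have "(t / 2)\<^sup>2 \<le> (norm (T f2 y))\<^sup>2" using t by (intro power_mono) auto
      then have "1 \<le> 4 / t\<^sup>2 * (norm (T f2 y))\<^sup>2" using t by (simp add: power_divide field_simps)
      then have "ennreal 1 \<le> ennreal (4 / t\<^sup>2 * (norm (T f2 y))\<^sup>2)" by (rule ennreal_leI)
      then show ?thesis using True t by (simp add: ennreal_mult[symmetric])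
    qed simp
  qed
  also have "\<dots> = ennreal (4 / t\<^sup>2) * (\<integral>\<^sup>+y. ennreal ((norm (T f2 y))\<^sup>2) \<partial>M)"
    using borel_measurable_integrable[OF i2] by (intro nn_integral_cmult) measurable
  also have "\<dots> \<le> ennreal (4 / t\<^sup>2) * (\<integral>\<^sup>+x. ennreal ((norm (f2 x))\<^sup>2) \<partial>M)"
    by (intro mult_left_mono T_contraction[OF b2]) simp
  also have "\<dots> = (\<integral>\<^sup>+x. ennreal (4 / t\<^sup>2) * ennreal ((norm (f2 x))\<^sup>2) \<partial>M)"
    using borel_measurable_integrable[OF i2] by (intro nn_integral_cmult[symmetric]) measurable
  also have "\<dots> = (\<integral>\<^sup>+x. ennreal (4 / t\<^sup>2 * (norm (f x))\<^sup>2 * indicator {x. ?P x} x) \<partial>M)"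
    by (intro nn_integral_cong) (simp add: f2_def indicator_def ennreal_mult[symmetric])
  finally show ?thesis .
qed

text \<open>Write the \<open>q\<close>-th power as an integral over levels \<open>t\<close>, insert the level bound, and exchange the
integrals. The integral over \<open>t\<close> converges at \<open>0\<close> because \<open>q > 2\<close>, and the powers of \<open>\<bar>f\<bar>\<close>
combine to \<open>\<bar>f\<bar>\<^sup>p\<close> since \<open>(p - 1) (q - 2) = 2 - p\<close>. At \<open>p = 2\<close> the constant degenerates; that
case is the \<open>L\<^sup>2\<close> bound itself.\<close>

lemma Marcinkiewicz:
  assumes f: "bounded_on M (E n) f" and p: "1 < p" "p < 2" and N: "lp_integral M p f \<le> ennreal N" "0 < N"
  defines "q \<equiv> p / (p - 1)"
  shows "lp_integral M q (T f) \<le> ennreal (4 * q * 2 powr (q - 2) / (q - 2) * N powr (q - 1))"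
proof -
  interpret P: pair_sigma_finite lborel M
    by (intro pair_sigma_finite.intro sigma_finite_lborel sigma_finite_measure_axioms)
  have q: "q > 2" using p by (simp add: q_def field_simps)
  have fm[measurable]: "f \<in> borel_measurable M" using f by (simp add: bounded_on_def)
  have Tm[measurable]: "T f \<in> borel_measurable M" by measurable
  have layer: "ennreal (a powr q) = (\<integral>\<^sup>+t. ennreal (q * t powr (q - 1)) * ennreal (indicator {0..a} t) \<partial>lborel)" if "0 \<le> a" for a :: real
  proof -
    have "(\<integral>\<^sup>+t. ennreal (q * t powr (q - 1)) * ennreal (indicator {0..a} t) \<partial>lborel) =
       (\<integral>\<^sup>+t. ennreal q * ennreal (indicator {0..a} t * t powr (q - 1)) \<partial>lborel)"
      using q by (intro nn_integral_cong) (simp add: ennreal_mult[symmetric] mult_ac)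
    also have "\<dots> = ennreal q * ennreal (a powr (q - 1 + 1) / (q - 1 + 1))"
      using q that by (subst nn_integral_cmult) (simp_all add: nn_integral_powr_Icc)
    also have "\<dots> = ennreal (a powr q)" using q by (simp add: ennreal_mult[symmetric])
    finally show ?thesis by simp
  qed
  define L where "L t x = ennreal (4 * q * (norm (f x))\<^sup>2 * (indicator {0<..} t * t powr (q - 3)) * indicator {(t, x). t * norm (f x) powr (p - 1) \<le> 2 * N} (t, x))" for t x
  have "lp_integral M q (T f) = (\<integral>\<^sup>+y. \<integral>\<^sup>+t. ennreal (q * t powr (q - 1)) * ennreal (indicator {0..norm (T f y)} t) \<partial>lborel \<partial>M)"
    unfolding lp_integral_def by (intro nn_integral_cong layer) simp
  also have "\<dots> = (\<integral>\<^sup>+t. \<integral>\<^sup>+y. ennreal (q * t powr (q - 1)) * ennreal (indicator {0..norm (T f y)} t) \<partial>M \<partial>lborel)"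
  proof (rule P.Fubini')
    have "(\<lambda>(t, y). ennreal (q * t powr (q - 1)) * ennreal (if 0 \<le> t \<and> t \<le> norm (T f y) then 1 else 0)) \<in> borel_measurable (lborel \<Otimes>\<^sub>M M)"
      by measurable
    then show "(\<lambda>(t, y). ennreal (q * t powr (q - 1)) * ennreal (indicator {0..norm (T f y)} t)) \<in> borel_measurable (lborel \<Otimes>\<^sub>M M)"
      by (simp add: indicator_def if_distrib cong: if_cong)
  qed
  also have "\<dots> \<le> (\<integral>\<^sup>+t. \<integral>\<^sup>+x. L t x \<partial>M \<partial>lborel)"
  proof (rule nn_integral_mono)
    fix t :: real
    show "(\<integral>\<^sup>+y. ennreal (q * t powr (q - 1)) * ennreal (indicator {0..norm (T f y)} t) \<partial>M) \<le> (\<integral>\<^sup>+x. L t x \<partial>M)"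
    proof (cases "t > 0")
      case True
      have mi: "(\<lambda>y. ennreal (indicator {0..norm (T f y)} t)) \<in> borel_measurable M"
      proof -
        have "(\<lambda>y. ennreal (if 0 \<le> t \<and> t \<le> norm (T f y) then 1 else 0)) \<in> borel_measurable M" by measurable
        then show ?thesis by (simp add: indicator_def)
      qed
      have "(\<integral>\<^sup>+y. ennreal (q * t powr (q - 1)) * ennreal (indicator {0..norm (T f y)} t) \<partial>M) =
          ennreal (q * t powr (q - 1)) * (\<integral>\<^sup>+y. ennreal (indicator {0..norm (T f y)} t) \<partial>M)"
        by (rule nn_integral_cmult[OF mi])
      also have "\<dots> \<le> ennreal (q * t powr (q - 1)) *
         (\<integral>\<^sup>+x. ennreal (4 / t\<^sup>2 * (norm (f x))\<^sup>2 * indicator {x. t * norm (f x) powr (p - 1) \<le> 2 * N} x) \<partial>M)"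
        by (intro mult_left_mono truncated_level_bound[OF f p(1) N True]) simp
      also have "\<dots> = (\<integral>\<^sup>+x. ennreal (q * t powr (q - 1)) *
         ennreal (4 / t\<^sup>2 * (norm (f x))\<^sup>2 * indicator {x. t * norm (f x) powr (p - 1) \<le> 2 * N} x) \<partial>M)"
      proof (rule nn_integral_cmult[symmetric])
        have "(\<lambda>x. ennreal (4 / t\<^sup>2 * (norm (f x))\<^sup>2 * (if t * norm (f x) powr (p - 1) \<le> 2 * N then 1 else 0))) \<in> borel_measurable M"
          by measurable
        then show "(\<lambda>x. ennreal (4 / t\<^sup>2 * (norm (f x))\<^sup>2 * indicator {x. t * norm (f x) powr (p - 1) \<le> 2 * N} x)) \<in> borel_measurable M"
          by (simp add: indicator_def)
      qed
      also have "\<dots> = (\<integral>\<^sup>+x. L t x \<partial>M)"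
      proof (rule nn_integral_cong)
        fix x
        have e: "t powr (q - 1) / t\<^sup>2 = t powr (q - 3)"
        proof -
          have "t powr (q - 3) = t powr (q - 1 - 2)" by simp
          also have "\<dots> = t powr (q - 1) / t powr 2" by (rule powr_diff)
          finally show ?thesis using True by (simp add: powr_numeral)
        qed
        then have "q * t powr (q - 1) * (4 / t\<^sup>2 * (norm (f x))\<^sup>2) = 4 * q * (norm (f x))\<^sup>2 * t powr (q - 3)"
          unfolding e[symmetric] by simp
        then show "ennreal (q * t powr (q - 1)) *
         ennreal (4 / t\<^sup>2 * (norm (f x))\<^sup>2 * indicator {x. t * norm (f x) powr (p - 1) \<le> 2 * N} x) = L t x"
          using q True by (auto simp: L_def ennreal_mult[symmetric] indicator_def)
      qed
      finally show ?thesis .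
    next
      case False
      then have "ennreal (q * t powr (q - 1)) * ennreal (indicator {0..norm (T f y)} t) = 0" for y
        by (cases "t = 0") (auto simp: indicator_def)
      then show ?thesis by (simp only: nn_integral_0_iff_AE nn_integral_const) simp
    qed
  qed
  also have "\<dots> = (\<integral>\<^sup>+x. \<integral>\<^sup>+t. L t x \<partial>lborel \<partial>M)"
  proof (rule P.Fubini'[symmetric])
    have "(\<lambda>(t, x). ennreal (4 * q * (norm (f x))\<^sup>2 * ((if 0 < t then 1 else 0) * t powr (q - 3)) * (if t * norm (f x) powr (p - 1) \<le> 2 * N then 1 else 0)))
       \<in> borel_measurable (lborel \<Otimes>\<^sub>M M)" by measurable
    then show "(\<lambda>(t, x). L t x) \<in> borel_measurable (lborel \<Otimes>\<^sub>M M)"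
      by (simp add: L_def indicator_def if_distrib cong: if_cong)
  qed
  also have "\<dots> = (\<integral>\<^sup>+x. ennreal (4 * q * 2 powr (q - 2) / (q - 2) * N powr (q - 2)) * ennreal (norm (f x) powr p) \<partial>M)"
  proof (rule nn_integral_cong)
    fix x
    show "(\<integral>\<^sup>+t. L t x \<partial>lborel) = ennreal (4 * q * 2 powr (q - 2) / (q - 2) * N powr (q - 2)) * ennreal (norm (f x) powr p)"
    proof (cases "f x = 0")
      case True
      then show ?thesis by (simp add: L_def)
    next
      case False
      define r where "r = norm (f x)"
      have r: "r > 0" using False by (simp add: r_def)
      define c where "c = 2 * N / r powr (p - 1)"
      have c: "c > 0" using r N by (simp add: c_def)
      have ic: "t * r powr (p - 1) \<le> 2 * N \<longleftrightarrow> t \<le> c" for t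
        using r by (simp add: c_def field_simps)
      have "(\<integral>\<^sup>+t. L t x \<partial>lborel) = (\<integral>\<^sup>+t. ennreal (4 * q * r\<^sup>2) * ennreal (indicator {0..c} t * t powr (q - 3)) \<partial>lborel)"
        using q by (intro nn_integral_cong) (auto simp: L_def indicator_def r_def[symmetric] ic ennreal_mult[symmetric] not_less)
      also have "\<dots> = ennreal (4 * q * r\<^sup>2) * ennreal (c powr (q - 3 + 1) / (q - 3 + 1))"
        using q c by (subst nn_integral_cmult) (simp_all add: nn_integral_powr_Icc)
      also have "\<dots> = ennreal (4 * q * r\<^sup>2 * (c powr (q - 2) / (q - 2)))"
        using q by (simp add: ennreal_mult[symmetric])
      also have "4 * q * r\<^sup>2 * (c powr (q - 2) / (q - 2)) = 4 * q * 2 powr (q - 2) / (q - 2) * N powr (q - 2) * r powr p"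
      proof -
        have e: "(p - 1) * (q - 2) = 2 - p" using p by (simp add: q_def field_simps)
        have "c powr (q - 2) = 2 powr (q - 2) * N powr (q - 2) / r powr (2 - p)"
          using N r by (simp add: c_def powr_divide powr_mult powr_powr e)
        moreover have "r\<^sup>2 / r powr (2 - p) = r powr p"
          using r by (simp add: powr_diff powr_numeral)
        ultimately show ?thesis using r q by (simp add: field_simps)
      qed
      finally show ?thesis using q N by (simp add: ennreal_mult[symmetric] r_def)
    qed
  qed
  also have "\<dots> = ennreal (4 * q * 2 powr (q - 2) / (q - 2) * N powr (q - 2)) * lp_integral M p f"
    unfolding lp_integral_def by (rule nn_integral_cmult) measurable
  also have "\<dots> \<le> ennreal (4 * q * 2 powr (q - 2) / (q - 2) * N powr (q - 2)) * ennreal N"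
    by (intro mult_left_mono N) simp
  also have "\<dots> = ennreal (4 * q * 2 powr (q - 2) / (q - 2) * N powr (q - 1))"
  proof -
    have "N powr (q - 1) = N powr (q - 2 + 1)" by simp
    also have "\<dots> = N powr (q - 2) * N" using N by (simp only: powr_add) simp
    finally show ?thesis using q N by (simp add: ennreal_mult[symmetric] mult_ac)
  qed
  finally show ?thesis .
qed

lemma weak_Hausdorff_Young:
  assumes p: "1 < p" "p \<le> 2"
  defines "q \<equiv> p / (p - 1)"
  shows "\<exists>C\<ge>0. \<forall>n f N. bounded_on M (E n) f \<longrightarrow> 0 \<le> N \<longrightarrow> lp_integral M p f \<le> ennreal N \<longrightarrow>
    lp_integral M q (T f) \<le> ennreal (C * N powr (q - 1))"
proof -
  define C where "C = (if p = 2 then 1 else 4 * q * 2 powr (q - 2) / (q - 2))"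
  have q: "q \<ge> 2" using p by (simp add: q_def field_simps)
  have C: "C \<ge> 0" using q by (simp add: C_def)
  have "lp_integral M q (T f) \<le> ennreal (C * N powr (q - 1))"
    if f: "bounded_on M (E n) f" and N: "0 \<le> N" "lp_integral M p f \<le> ennreal N" for n f N
  proof -
    have fm[measurable]: "f \<in> borel_measurable M" using f by (simp add: bounded_on_def)
    consider "N = 0" | "N > 0" "p = 2" | "N > 0" "p < 2" using N p by linarith
    then show ?thesis
    proof cases
      case 1
      then have "AE x in M. f x = 0" using N by (simp add: lp_integral_eq_0_iff)
      then have "T f y = 0" for y
        unfolding T_def by (intro integral_eq_zero_AE) auto
      then have "lp_integral M q (T f) = 0" by (simp add: lp_integral_def)
      then show ?thesis by simp
    next
      case 2
      then have q2: "q = 2" by (simp add: q_def)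
      have s: "lp_integral M 2 h = (\<integral>\<^sup>+x. ennreal ((norm (h x))\<^sup>2) \<partial>M)" for h
        unfolding lp_integral_def by (intro nn_integral_cong) (simp add: powr_numeral)
      have "lp_integral M 2 (T f) \<le> lp_integral M 2 f" unfolding s by (rule T_contraction[OF f])
      with 2 q2 N show ?thesis by (auto simp: C_def intro: order_trans)
    next
      case 3
      then have "lp_integral M (p / (p - 1)) (T f) \<le> ennreal (4 * q * 2 powr (q - 2) / (q - 2) * N powr (q - 1))"
        unfolding q_def by (intro Marcinkiewicz[OF f p(1) _ N(2)])
      with 3 show ?thesis by (simp add: C_def q_def)
    qed
  qed
  with C show ?thesis by blast
qed

end


section \<open>Extension of the transform to Lebesgue spaces\<close>

text \<open>The sum of \<open>2\<^bsup>nq\<^esup> \<bar>u\<^sub>n\<^sub>+\<^sub>1 - u\<^sub>n\<bar>\<^sup>q\<close> has a finite integral. Hence it is finite almost everywhere, and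
there \<open>\<bar>u\<^sub>n\<^sub>+\<^sub>1 - u\<^sub>n\<bar>\<close> is eventually below \<open>2\<^bsup>-n\<^esup>\<close>.\<close>

lemma fast_Cauchy_AE_convergent:
  fixes u :: "nat \<Rightarrow> 'a \<Rightarrow> complex"
  assumes [measurable]: "\<And>n. u n \<in> borel_measurable M" and q: "0 < q"
    and Du: "\<And>n. lp_integral M q (\<lambda>y. u (Suc n) y - u n y) \<le> ennreal ((1 / 2) ^ n * (1 / 2) powr (real n * q))"
  shows "AE y in M. convergent (\<lambda>n. u n y)"
proof -
  define s where "s n y = ennreal (2 powr (real n * q) * norm (u (Suc n) y - u n y) powr q)" for n y
  have sm: "s n \<in> borel_measurable M" for n unfolding s_def by measurable
  have "(\<integral>\<^sup>+y. (\<Sum>n. s n y) \<partial>M) = (\<Sum>n. \<integral>\<^sup>+y. s n y \<partial>M)" by (rule nn_integral_suminf[OF sm])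
  also have "\<dots> \<le> (\<Sum>n. ennreal ((1 / 2) ^ n))"
  proof (rule suminf_le)
    fix n
    have "(\<integral>\<^sup>+y. s n y \<partial>M) = ennreal (2 powr (real n * q)) * lp_integral M q (\<lambda>y. u (Suc n) y - u n y)"
      unfolding s_def lp_integral_def by (subst nn_integral_cmult[symmetric]) (auto simp: ennreal_mult)
    also have "\<dots> \<le> ennreal (2 powr (real n * q)) * ennreal ((1 / 2) ^ n * (1 / 2) powr (real n * q))"
      by (intro mult_left_mono Du) simp
    also have "\<dots> = ennreal ((1 / 2) ^ n)"
    proof -
      have "2 powr (real n * q) * (1 / 2) powr (real n * q) = (2 * (1 / 2)) powr (real n * q)"
        by (subst powr_mult) auto
      then have "2 powr (real n * q) * ((1 / 2) ^ n * (1 / 2) powr (real n * q)) = (1 / 2) ^ n"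
        by (simp add: mult.left_commute)
      then show ?thesis by (simp only: ennreal_mult[symmetric] powr_ge_zero zero_le_mult_iff zero_le_power
          zero_le_divide_1_iff zero_le_numeral simp_thms)
    qed
    finally show "(\<integral>\<^sup>+y. s n y \<partial>M) \<le> ennreal ((1 / 2) ^ n)" .
  qed auto
  also have "\<dots> = ennreal (\<Sum>n. (1 / 2) ^ n)" by (intro suminf_ennreal2) (auto simp: summable_geometric)
  also have "\<dots> < \<infinity>" by simp
  finally have "(\<integral>\<^sup>+y. (\<Sum>n. s n y) \<partial>M) \<noteq> \<infinity>" by (rule less_imp_neq)
  then have "AE y in M. (\<Sum>n. s n y) \<noteq> \<infinity>" using sm by (intro nn_integral_noteq_infinite) auto
  then show ?thesis
  proof eventually_elim
    fix y assume y: "(\<Sum>n. s n y) \<noteq> \<infinity>"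
    have "summable (\<lambda>n. 2 powr (real n * q) * norm (u (Suc n) y - u n y) powr q)"
      using y unfolding s_def by (intro summable_suminf_not_top) auto
    from summable_LIMSEQ_zero[OF this]
    have "\<forall>\<^sub>F n in sequentially. 2 powr (real n * q) * norm (u (Suc n) y - u n y) powr q < 1"
      by (rule order_tendstoD) simp
    then have "\<forall>\<^sub>F n in sequentially. norm (u (Suc n) y - u n y) \<le> (1 / 2) ^ n"
    proof eventually_elim
      fix n assume a: "2 powr (real n * q) * norm (u (Suc n) y - u n y) powr q < 1"
      have "(2 ^ n * norm (u (Suc n) y - u n y)) powr q < 1 powr q"
        using a by (simp add: powr_mult powr_powr powr_realpow[symmetric])
      then have "\<not> 1 \<le> 2 ^ n * norm (u (Suc n) y - u n y)" using q by (auto dest: powr_mono2[of q 1, rotated 2])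
      then show "norm (u (Suc n) y - u n y) \<le> (1 / 2) ^ n" by (simp add: field_simps)
    qed
    then have "summable (\<lambda>n. u (Suc n) y - u n y)"
      by (rule summable_comparison_test_ev) (simp add: summable_geometric)
    then have "convergent (\<lambda>n. \<Sum>i<n. u (Suc i) y - u i y)" by (simp add: summable_iff_convergent)
    then have "convergent (\<lambda>n. u n y - u 0 y)" by (simp only: sum_lessThan_telescope[of "\<lambda>n. u n y"])
    then show "convergent (\<lambda>n. u n y)" by (simp add: convergent_diff_const_right_iff)
  qed
qed

text \<open>Fatou's lemma: a bound that holds from some index on survives in the limit.\<close>

lemma lp_integral_limit_le:
  fixes u :: "nat \<Rightarrow> 'a \<Rightarrow> complex"
  assumes q: "0 < q" and [measurable]: "\<And>n. u n \<in> borel_measurable M" "h \<in> borel_measurable M"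
    and le: "\<And>m. m \<ge> n \<Longrightarrow> lp_integral M q (\<lambda>y. u m y - h y) \<le> c"
    and ug: "AE y in M. (\<lambda>n. u n y) \<longlonglongrightarrow> g y"
  shows "lp_integral M q (\<lambda>y. g y - h y) \<le> c"
proof -
  have "lp_integral M q (\<lambda>y. g y - h y) = (\<integral>\<^sup>+y. liminf (\<lambda>m. ennreal (norm (u m y - h y) powr q)) \<partial>M)"
    unfolding lp_integral_def
  proof (rule nn_integral_cong_AE, use ug in eventually_elim)
    fix y assume "(\<lambda>n. u n y) \<longlonglongrightarrow> g y"
    then have "(\<lambda>m. ennreal (norm (u m y - h y) powr q)) \<longlonglongrightarrow> ennreal (norm (g y - h y) powr q)"
      using q by (intro tendsto_ennrealI tendsto_powr' tendsto_intros) auto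
    then show "ennreal (norm (g y - h y) powr q) = liminf (\<lambda>m. ennreal (norm (u m y - h y) powr q))"
      by (intro lim_imp_Liminf[symmetric]) auto
  qed
  also have "\<dots> \<le> liminf (\<lambda>m. lp_integral M q (\<lambda>y. u m y - h y))"
    unfolding lp_integral_def by (rule nn_integral_liminf) measurable
  also have "\<dots> \<le> liminf (\<lambda>m::nat. c)" using le by (intro Liminf_mono) (auto simp: eventually_sequentially)
  finally show ?thesis by (simp add: Liminf_const)
qed

context plancherel_kernel
begin

text \<open>The extension by continuity of the transform from \<open>L\<^sup>1 \<inter> L\<^sup>p\<close>, as a relation.\<close>

definition extends_transform :: "real \<Rightarrow> ('a \<Rightarrow> complex) \<Rightarrow> ('a \<Rightarrow> complex) \<Rightarrow> bool" where
  "extends_transform p \<phi> g \<longleftrightarrow> g \<in> Lp_space M (conj_exponent p) \<and>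
     (\<exists>\<phi>s :: nat \<Rightarrow> 'a \<Rightarrow> complex. (\<forall>n. \<phi>s n \<in> Lp_space M 1 \<inter> Lp_space M (ennreal p)) \<and>
        (\<lambda>n. lp_norm M (ennreal p) (\<lambda>x. \<phi>s n x - \<phi> x)) \<longlonglongrightarrow> 0 \<and>
        (\<lambda>n. lp_norm M (conj_exponent p) (\<lambda>\<xi>. T (\<phi>s n) \<xi> - g \<xi>)) \<longlonglongrightarrow> 0)"

lemma Lp_space_1_iff: "f \<in> Lp_space M 1 \<longleftrightarrow> integrable M f"
proof -
  have "lp_norm M (ennreal 1) f = (\<integral>\<^sup>+x. ennreal (norm (f x)) \<partial>M)"
    by (subst lp_norm_ennreal) (simp_all add: lp_integral_def)
  then show ?thesis by (simp add: Lp_space_def integrable_iff_bounded)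
qed

lemma lp_norm_zero: "0 < p \<Longrightarrow> lp_norm M (ennreal p) (\<lambda>x. 0) = 0"
  by (simp add: lp_norm_ennreal lp_integral_def)

lemma extends_transform_ex_1:
  assumes "\<psi> \<in> Lp_space M (ennreal 1)"
  shows "extends_transform 1 \<psi> (T \<psi>)"
proof -
  have i: "integrable M \<psi>" using assms by (simp add: Lp_space_1_iff)
  have [measurable]: "\<psi> \<in> borel_measurable M" using i by (rule borel_measurable_integrable)
  have "T \<psi> \<in> Lp_space M top"
    by (rule bounded_Lp_top[where B="\<integral>x. norm (\<psi> x) \<partial>M"]) (measurable, intro AE_I2 norm_T_le i)
  moreover have "lp_norm M top (\<lambda>x. 0::complex) = 0"
    unfolding lp_norm_top using esssup_I[of "\<lambda>x. 0::ennreal" M 0] by simp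
  moreover have "lp_norm M (ennreal 1) (\<lambda>x. 0::complex) = 0" by (rule lp_norm_zero) simp
  ultimately show ?thesis
    unfolding extends_transform_def conj_exponent_one using assms
    by (intro conjI exI[of _ "\<lambda>n. \<psi>"]) auto
qed

text \<open>Truncate \<open>\<psi>\<close> in height and support. By the Hausdorff--Young inequality with a constant, the
transforms of the truncations form a Cauchy sequence; a subsequence converges almost everywhere,
and Fatou's lemma shows that its limit is also the limit in \<open>L\<^sup>q\<close>.\<close>

lemma extends_transform_ex_gt_1:
  assumes p: "1 < p" "p \<le> 2" and \<psi>: "\<psi> \<in> Lp_space M (ennreal p)"
  shows "\<exists>g. extends_transform p \<psi> g"
proof -
  define q where "q = p / (p - 1)"
  have q: "q \<ge> 2" using p by (simp add: q_def field_simps)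
  have ce: "conj_exponent p = ennreal q" using p by (simp add: conj_exponent_gt q_def)
  have [measurable]: "\<psi> \<in> borel_measurable M" using \<psi> by (simp add: Lp_space_def)
  have J\<psi>: "lp_integral M p \<psi> < \<infinity>" using \<psi> p lp_norm_less_top_iff[of p M \<psi>] by (simp add: Lp_space_def)
  obtain C where C: "C \<ge> 0" and HY: "\<And>n f N. bounded_on M (E n) f \<Longrightarrow> 0 \<le> N \<Longrightarrow> lp_integral M p f \<le> ennreal N \<Longrightarrow>
      lp_integral M q (T f) \<le> ennreal (C * N powr (q - 1))"
    using weak_Hausdorff_Young[OF p] unfolding q_def by blast
  define A where "A n = {x \<in> space M. x \<in> E n \<and> norm (\<psi> x) \<le> real n}" for n
  have [measurable]: "A n \<in> sets M" for n unfolding A_def by measurable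
  have A_mono: "A m \<subseteq> A n" if "m \<le> n" for m n
    using E_mono[OF that] that by (auto simp: A_def)
  have A_ex: "\<exists>n. \<forall>m\<ge>n. x \<in> A m" if x: "x \<in> space M" for x
  proof -
    obtain n where n: "x \<in> E n" using x E_exhaust by auto
    obtain k where k: "norm (\<psi> x) \<le> real k" using real_arch_simple by blast
    have "x \<in> A (max n k)" using n k x E_mono[of n "max n k"] by (auto simp: A_def)
    then show ?thesis using A_mono by blast
  qed
  define \<psi>n where "\<psi>n n x = \<psi> x * indicator (A n) x" for n x
  have [measurable]: "\<psi>n n \<in> borel_measurable M" for n unfolding \<psi>n_def by measurable
  have bd: "bounded_on M (E k) (\<lambda>x. \<psi>n m x - \<psi>n n x)" if "m \<le> k" "n \<le> k" for m n k
    unfolding bounded_on_def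
  proof (intro conjI)
    show "\<exists>B. \<forall>x\<in>space M. norm (\<psi>n m x - \<psi>n n x) \<le> B"
    proof (intro exI ballI)
      fix x
      have "norm (\<psi>n m x) \<le> real m" "norm (\<psi>n n x) \<le> real n" by (auto simp: \<psi>n_def A_def indicator_def)
      then show "norm (\<psi>n m x - \<psi>n n x) \<le> real m + real n" using norm_triangle_ineq4[of "\<psi>n m x" "\<psi>n n x"] by linarith
    qed
    show "\<forall>x\<in>space M - E k. \<psi>n m x - \<psi>n n x = 0"
      using E_mono[OF that(1)] E_mono[OF that(2)] by (auto simp: \<psi>n_def A_def indicator_def)
  qed measurable
  have bd1: "bounded_on M (E n) (\<psi>n n)" for n
    unfolding bounded_on_def by (intro conjI exI[of _ "real n"]) (auto simp: \<psi>n_def A_def indicator_def)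
  have in1: "integrable M (\<psi>n n)" for n by (rule bounded_on_integrable[OF bd1])
  have Td: "T (\<lambda>x. \<psi>n m x - \<psi>n n x) y = T (\<psi>n m) y - T (\<psi>n n) y" if "y \<in> space M" for m n y
    by (rule T_diff[OF in1 in1 that])
  \<comment> \<open>The truncation sets increase, so \<open>\<delta> n\<close> also bounds the distance of any later truncation from the \<open>n\<close>-th.\<close>
  define \<delta> where "\<delta> n = enn2real (lp_integral M p (\<lambda>x. \<psi>n n x - \<psi> x))" for n
  have le: "lp_integral M p (\<lambda>x. \<psi>n n x - \<psi> x) \<le> lp_integral M p \<psi>" for n
    using p by (intro lp_integral_mono_AE) (auto simp: \<psi>n_def indicator_def)
  have \<delta>: "lp_integral M p (\<lambda>x. \<psi>n n x - \<psi> x) = ennreal (\<delta> n)" for n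
    using le[of n] J\<psi> unfolding \<delta>_def by (intro ennreal_enn2real[symmetric]) (auto intro: order.strict_trans1)
  have \<delta>0: "\<delta> n \<ge> 0" for n by (simp add: \<delta>_def)
  have ev: "\<forall>\<^sub>F n in sequentially. \<psi>n n x = \<psi> x" if "x \<in> space M" for x
  proof -
    from A_ex[OF that] obtain n where "\<And>m. m \<ge> n \<Longrightarrow> x \<in> A m" by blast
    then show ?thesis unfolding eventually_sequentially by (intro exI[of _ n]) (auto simp: \<psi>n_def)
  qed
  have J0: "(\<lambda>n. lp_integral M p (\<lambda>x. \<psi>n n x - \<psi> x)) \<longlonglongrightarrow> 0"
  proof -
    have "(\<lambda>n. lp_integral M p (\<lambda>x. \<psi>n n x - \<psi> x)) \<longlonglongrightarrow> (\<integral>\<^sup>+x. 0 \<partial>M)"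
      unfolding lp_integral_def
    proof (rule nn_integral_dominated_convergence[where w="\<lambda>x. ennreal (norm (\<psi> x) powr p)"])
      show "AE x in M. ennreal (norm (\<psi>n n x - \<psi> x) powr p) \<le> ennreal (norm (\<psi> x) powr p)" for n
        using p by (intro AE_I2 ennreal_leI powr_mono2) (auto simp: \<psi>n_def indicator_def)
      show "(\<integral>\<^sup>+x. ennreal (norm (\<psi> x) powr p) \<partial>M) < \<infinity>" using J\<psi> by (simp add: lp_integral_def)
      show "AE x in M. (\<lambda>n. ennreal (norm (\<psi>n n x - \<psi> x) powr p)) \<longlonglongrightarrow> 0"
      proof (intro AE_I2)
        fix x assume "x \<in> space M"
        from ev[OF this] have "\<forall>\<^sub>F n in sequentially. ennreal (norm (\<psi>n n x - \<psi> x) powr p) = 0"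
          by eventually_elim simp
        then show "(\<lambda>n. ennreal (norm (\<psi>n n x - \<psi> x) powr p)) \<longlonglongrightarrow> 0" by (rule tendsto_eventually)
      qed
    qed measurable
    then show ?thesis by simp
  qed
  have \<delta>lim: "\<delta> \<longlonglongrightarrow> 0"
  proof -
    have "(\<lambda>n. ennreal (\<delta> n)) \<longlonglongrightarrow> ennreal 0" using J0 by (simp add: \<delta>)
    then show ?thesis by (rule tendsto_ennrealD) (auto simp: \<delta>0)
  qed
  define D where "D n = C * \<delta> n powr (q - 1)" for n
  have D0: "D n \<ge> 0" for n using C by (simp add: D_def)
  have Dlim: "D \<longlonglongrightarrow> 0"
  proof -
    have "(\<lambda>n. \<delta> n powr (q - 1)) \<longlonglongrightarrow> 0 powr (q - 1)"
      using q \<delta>0 by (intro tendsto_powr'[OF \<delta>lim tendsto_const]) auto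
    then have "(\<lambda>n. C * \<delta> n powr (q - 1)) \<longlonglongrightarrow> C * 0" using q by (intro tendsto_mult tendsto_const) simp
    then show ?thesis by (simp add: D_def[abs_def])
  qed
  have TD: "lp_integral M q (\<lambda>y. T (\<psi>n m) y - T (\<psi>n n) y) \<le> ennreal (D n)" if "n \<le> m" for m n
  proof -
    have "lp_integral M p (\<lambda>x. \<psi>n m x - \<psi>n n x) \<le> lp_integral M p (\<lambda>x. \<psi>n n x - \<psi> x)"
      using p A_mono[OF that] by (intro lp_integral_mono_AE AE_I2) (auto simp: \<psi>n_def indicator_def)
    then have "lp_integral M q (T (\<lambda>x. \<psi>n m x - \<psi>n n x)) \<le> ennreal (D n)"
      unfolding D_def using that by (intro HY[OF bd[of m m n]] \<delta>0) (auto simp: \<delta>)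
    moreover have "lp_integral M q (T (\<lambda>x. \<psi>n m x - \<psi>n n x)) = lp_integral M q (\<lambda>y. T (\<psi>n m) y - T (\<psi>n n) y)"
      by (intro lp_integral_cong_AE AE_I2) (simp add: Td)
    ultimately show ?thesis by simp
  qed
  have "\<forall>n. \<exists>k. \<forall>m\<ge>k. D m < (1 / 2) ^ n * (1 / 2) powr (real n * q)"
  proof
    fix n
    have "0 < (1 / 2) ^ n * (1 / 2) powr (real n * q)" by simp
    from order_tendstoD(2)[OF Dlim this] show "\<exists>k. \<forall>m\<ge>k. D m < (1 / 2) ^ n * (1 / 2) powr (real n * q)"
      by (simp add: eventually_sequentially)
  qed
  then obtain k where k: "\<And>n m. m \<ge> k n \<Longrightarrow> D m < (1 / 2) ^ n * (1 / 2) powr (real n * q)" by metis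
  \<comment> \<open>A monotone choice of indices above all the thresholds \<open>k\<close>.\<close>
  define \<sigma> where "\<sigma> n = n + (\<Sum>i\<le>n. k i)" for n
  have \<sigma>k: "k n \<le> \<sigma> n" for n using member_le_sum[of n "{..n}" k] by (simp add: \<sigma>_def)
  have \<sigma>mono: "\<sigma> m \<le> \<sigma> n" if "m \<le> n" for m n
    unfolding \<sigma>_def using that by (intro add_mono sum_mono2) auto
  have \<sigma>n: "n \<le> \<sigma> n" for n by (simp add: \<sigma>_def)
  have \<sigma>lim: "filterlim \<sigma> at_top sequentially"
    by (rule filterlim_at_top_mono[OF filterlim_ident]) (auto intro: always_eventually \<sigma>n)
  define u where "u n = T (\<psi>n (\<sigma> n))" for n
  have [measurable]: "u n \<in> borel_measurable M" for n unfolding u_def by measurable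
  have Du: "lp_integral M q (\<lambda>y. u m y - u n y) \<le> ennreal (D (\<sigma> n))" if "n \<le> m" for m n
    unfolding u_def by (rule TD[OF \<sigma>mono[OF that]])
  have "AE y in M. convergent (\<lambda>n. u n y)"
  proof (rule fast_Cauchy_AE_convergent)
    fix n
    show "lp_integral M q (\<lambda>y. u (Suc n) y - u n y) \<le> ennreal ((1 / 2) ^ n * (1 / 2) powr (real n * q))"
      by (rule order_trans[OF Du ennreal_leI]) (use k[OF \<sigma>k, of n] in auto)
  qed (use q in auto)
  define g where "g y = lim (\<lambda>n. u n y)" for y
  have [measurable]: "g \<in> borel_measurable M" unfolding g_def by (rule borel_measurable_lim_metric) measurable
  have ug: "AE y in M. (\<lambda>n. u n y) \<longlonglongrightarrow> g y"
    using \<open>AE y in M. convergent (\<lambda>n. u n y)\<close> by eventually_elim (simp add: g_def convergent_LIMSEQ_iff)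
  note limit_le = lp_integral_limit_le[of q u M, OF _ _ _ _ ug]
  have gu: "lp_integral M q (\<lambda>y. g y - u n y) \<le> ennreal (D (\<sigma> n))" for n
    using q by (intro limit_le[where n=n] Du) auto
  have gfin: "lp_integral M q g < \<infinity>"
  proof -
    obtain N where N: "lp_integral M p \<psi> = ennreal N" "N \<ge> 0" using J\<psi> by (cases "lp_integral M p \<psi>") auto
    have "lp_integral M q (u m) \<le> ennreal (C * N powr (q - 1))" for m
      unfolding u_def
    proof (rule HY[OF bd1 N(2)])
      show "lp_integral M p (\<psi>n (\<sigma> m)) \<le> ennreal N"
        unfolding N(1)[symmetric] using p by (intro lp_integral_mono_AE) (auto simp: \<psi>n_def indicator_def)
    qed
    then have "lp_integral M q (\<lambda>y. g y - 0) \<le> ennreal (C * N powr (q - 1))"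
      using q by (intro limit_le[where n=0]) auto
    also have "\<dots> < \<infinity>" by simp
    finally show ?thesis by simp
  qed
  have "extends_transform p \<psi> g"
    unfolding extends_transform_def ce
  proof (intro conjI exI[of _ "\<lambda>n. \<psi>n (\<sigma> n)"] allI IntI)
    show "g \<in> Lp_space M (ennreal q)" using gfin q lp_norm_less_top_iff[of q M g] by (simp add: Lp_space_def)
    show "\<psi>n (\<sigma> n) \<in> Lp_space M 1" for n using in1 by (simp add: Lp_space_1_iff)
    show "\<psi>n (\<sigma> n) \<in> Lp_space M (ennreal p)" for n
    proof -
      have "lp_integral M p (\<psi>n (\<sigma> n)) \<le> lp_integral M p \<psi>"
        using p by (intro lp_integral_mono_AE) (auto simp: \<psi>n_def indicator_def)
      then have "lp_integral M p (\<psi>n (\<sigma> n)) < \<infinity>" using J\<psi> by (rule order.strict_trans1)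
      then show ?thesis using p lp_norm_less_top_iff[of p M] by (simp add: Lp_space_def)
    qed
    show "(\<lambda>n. lp_norm M (ennreal p) (\<lambda>x. \<psi>n (\<sigma> n) x - \<psi> x)) \<longlonglongrightarrow> 0"
      using p by (subst lp_norm_ennreal) (auto intro!: enn_powr_tendsto_0 filterlim_compose[OF J0 \<sigma>lim])
    have Dl: "(\<lambda>n. ennreal (D (\<sigma> n))) \<longlonglongrightarrow> ennreal 0" by (intro tendsto_ennrealI filterlim_compose[OF Dlim \<sigma>lim])
    have "(\<lambda>n. lp_integral M q (\<lambda>y. g y - u n y)) \<longlonglongrightarrow> 0"
    proof (rule tendsto_sandwich[OF _ _ tendsto_const])
      show "\<forall>\<^sub>F n in sequentially. lp_integral M q (\<lambda>y. g y - u n y) \<le> ennreal (D (\<sigma> n))"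
        by (intro always_eventually allI gu)
      show "(\<lambda>n. ennreal (D (\<sigma> n))) \<longlonglongrightarrow> 0" using Dl unfolding ennreal_0 .
    qed simp
    moreover have "lp_integral M q (\<lambda>y. g y - u n y) = lp_integral M q (\<lambda>y. T (\<psi>n (\<sigma> n)) y - g y)" for n
      unfolding u_def by (intro lp_integral_cong_AE AE_I2 norm_minus_commute)
    ultimately have "(\<lambda>n. lp_integral M q (\<lambda>y. T (\<psi>n (\<sigma> n)) y - g y)) \<longlonglongrightarrow> 0" by simp
    then show "(\<lambda>n. lp_norm M (ennreal q) (\<lambda>\<xi>. T (\<psi>n (\<sigma> n)) \<xi> - g \<xi>)) \<longlonglongrightarrow> 0"
      using q by (subst lp_norm_ennreal) (auto intro!: enn_powr_tendsto_0)
  qed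
  then show ?thesis by blast
qed

lemma extends_transform_ex:
  assumes "1 \<le> p" "p \<le> 2" "\<psi> \<in> Lp_space M (ennreal p)"
  shows "\<exists>g. extends_transform p \<psi> g"
  using assms extends_transform_ex_1[of \<psi>] extends_transform_ex_gt_1[of p \<psi>] by (cases "p = 1") auto

end


section \<open>Inversion and the bound for bandlimited functions\<close>

lemma lp_norm_indicator:
  assumes "S \<in> sets M" "0 < p"
  shows "lp_norm M (ennreal p) (indicator S) = enn_powr (emeasure M S) (1 / p)"
proof -
  have "lp_integral M p (indicator S) = (\<integral>\<^sup>+x. indicator S x \<partial>M)"
    unfolding lp_integral_def by (intro nn_integral_cong) (simp add: indicator_def)
  then show ?thesis using assms by (simp add: lp_norm_ennreal)
qed

context plancherel_kernel
begin

text \<open>Test against \<open>h = T k\<close> in \<open>G\<close>. By continuity and self-adjointness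
\<open>\<integral>\<psi> h = lim \<integral>\<phi>\<^sub>n (T k) = lim \<integral>(T \<phi>\<^sub>n) k = \<integral>g k = \<integral>g (T' h) = \<integral>(T' g) h\<close>.\<close>

lemma inversion:
  assumes p: "1 \<le> p" and \<psi>: "\<psi> \<in> Lp_space M (ennreal p)" and ext: "extends_transform p \<psi> g" and gi: "integrable M g"
  shows "AE x in M. \<psi> x = T' g x"
proof -
  from ext obtain \<phi>s where \<phi>1: "\<And>n. integrable M (\<phi>s n)" and \<phi>p: "\<And>n. \<phi>s n \<in> Lp_space M (ennreal p)"
    and l1: "(\<lambda>n. lp_norm M (ennreal p) (\<lambda>x. \<phi>s n x - \<psi> x)) \<longlonglongrightarrow> 0"
    and l2: "(\<lambda>n. lp_norm M (conj_exponent p) (\<lambda>\<xi>. T (\<phi>s n) \<xi> - g \<xi>)) \<longlonglongrightarrow> 0"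
    and g: "g \<in> Lp_space M (conj_exponent p)"
    unfolding extends_transform_def by (auto simp: Lp_space_1_iff)
  have [measurable]: "\<psi> \<in> borel_measurable M" "g \<in> borel_measurable M" "\<And>n. \<phi>s n \<in> borel_measurable M"
    using \<psi> g \<phi>p by (auto simp: Lp_space_def)
  have key: "integrable M (\<lambda>x. (\<psi> x - T' g x) * h x) \<and> (\<integral>x. (\<psi> x - T' g x) * h x \<partial>M) = 0" if h: "h \<in> G" for h
  proof -
    from G_inverted[OF h] obtain k where hb: "integrable_bounded M h" and kb: "integrable_bounded M k"
      and Tk: "\<And>x. x \<in> space M \<Longrightarrow> T k x = h x" and Th: "\<And>x. x \<in> space M \<Longrightarrow> T' h x = k x"
      by (auto simp: inverted_def)
    have hi: "integrable M h" and ki: "integrable M k" using hb kb by auto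
    have i\<psi>: "integrable M (\<lambda>x. \<psi> x * h x)" by (rule Hoelder_integrable[OF p \<psi> integrable_bounded_Lp_space(2)[OF hb p]])
    have i\<phi>: "integrable M (\<lambda>x. \<phi>s n x * h x)" for n by (rule Hoelder_integrable[OF p \<phi>p integrable_bounded_Lp_space(2)[OF hb p]])
    have igk: "integrable M (\<lambda>x. g x * k x)"
      using Hoelder_integrable[OF p integrable_bounded_Lp_space(1)[OF kb p] g] by (simp add: mult.commute)
    have iT: "integrable M (\<lambda>x. T' g x * h x)"
      by (rule Bochner_Integration.integrable_cong[THEN iffD1, OF refl _ integrable_cnj[OF integrable_T_mult[of "\<lambda>x. cnj (g x)" "\<lambda>x. cnj (h x)"]]])
         (use gi hi in \<open>auto simp: T'_conv_T\<close>)
    have c1: "(\<lambda>n. \<integral>x. \<phi>s n x * h x \<partial>M) \<longlonglongrightarrow> (\<integral>x. \<psi> x * h x \<partial>M)"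
      by (rule tendsto_integral_Hoelder[OF p _ _ integrable_bounded_Lp_space(2)[OF hb p] i\<phi> i\<psi> l1]) measurable
    have c2: "(\<lambda>n. \<integral>x. T (\<phi>s n) x * k x \<partial>M) \<longlonglongrightarrow> (\<integral>x. g x * k x \<partial>M)"
      by (rule tendsto_integral_Hoelder_conj[OF p _ _ integrable_bounded_Lp_space(1)[OF kb p] integrable_T_mult[OF \<phi>1 ki] igk l2]) measurable
    have "(\<integral>x. T (\<phi>s n) x * k x \<partial>M) = (\<integral>x. \<phi>s n x * h x \<partial>M)" for n
    proof -
      have "(\<integral>x. T (\<phi>s n) x * k x \<partial>M) = (\<integral>x. \<phi>s n x * T k x \<partial>M)" by (rule T_self_adjoint[OF \<phi>1 ki])
      also have "\<dots> = (\<integral>x. \<phi>s n x * h x \<partial>M)" by (rule Bochner_Integration.integral_cong) (auto simp: Tk)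
      finally show ?thesis .
    qed
    with c1 c2 have "(\<integral>x. \<psi> x * h x \<partial>M) = (\<integral>x. g x * k x \<partial>M)" by (simp add: LIMSEQ_unique)
    also have "\<dots> = (\<integral>x. g x * T' h x \<partial>M)" by (rule Bochner_Integration.integral_cong) (auto simp: Th)
    also have "\<dots> = (\<integral>x. T' g x * h x \<partial>M)" by (rule T'_self_adjoint[OF gi hi, symmetric])
    finally show ?thesis using i\<psi> iT by (simp add: left_diff_distrib)
  qed
  have "AE x in M. \<psi> x - T' g x = 0"
  proof (rule G_total)
    show "(\<lambda>x. \<psi> x - T' g x) \<in> borel_measurable M" by measurable
  qed (use key in auto)
  then show ?thesis by simp
qed

text \<open>This is how boundedness puts \<open>\<psi>\<close> into \<open>L\<^sup>2\<close> and \<open>L\<^sup>q\<close>.\<close>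

lemma lp_integral_bounded_interpolate:
  assumes "AE x in M. norm (f x) \<le> B" "p \<le> r" and [measurable]: "f \<in> borel_measurable M"
  shows "lp_integral M r f \<le> ennreal (B powr (r - p)) * lp_integral M p f"
proof -
  have "lp_integral M r f \<le> (\<integral>\<^sup>+x. ennreal (B powr (r - p)) * ennreal (norm (f x) powr p) \<partial>M)"
    unfolding lp_integral_def
  proof (rule nn_integral_mono_AE, use assms(1) in eventually_elim)
    fix x assume "norm (f x) \<le> B"
    then have "norm (f x) powr (r - p) * norm (f x) powr p \<le> B powr (r - p) * norm (f x) powr p"
      using assms by (intro mult_right_mono powr_mono2) auto
    moreover have "norm (f x) powr (r - p) * norm (f x) powr p = norm (f x) powr r"
      by (simp add: powr_add[symmetric])
    ultimately show "ennreal (norm (f x) powr r) \<le> ennreal (B powr (r - p)) * ennreal (norm (f x) powr p)"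
      by (simp add: ennreal_mult[symmetric] ennreal_leI)
  qed
  also have "\<dots> = ennreal (B powr (r - p)) * lp_integral M p f"
    unfolding lp_integral_def by (rule nn_integral_cmult) measurable
  finally show ?thesis .
qed

text \<open>The self-improving estimate for \<open>B = \<parallel>g\<parallel>\<^sub>1\<close>. The inversion formula makes \<open>\<psi>\<close> bounded, and with
\<open>\<psi> \<in> L\<^sup>p \<inter> L\<^sup>q\<close> and \<open>g \<in> L\<^sup>q \<inter> L\<^sup>p\<close> Plancherel's identity for the pair \<open>\<psi>\<close>, \<open>g\<close> follows by
pairing both with the approximating sequence. Raising \<open>B\<^sup>2 \<le> \<mu>(\<Sigma>) B\<^bsup>2-p\<^esup> \<parallel>\<psi>\<parallel>\<^sub>p\<^sup>p\<close> to a bound for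
\<open>B\<close> then needs \<open>B\<close> to be finite.\<close>

theorem bandlimited_bound:
  assumes p: "1 \<le> p" "p \<le> 2" and \<psi>: "\<psi> \<in> Lp_space M (ennreal p)" and ext: "extends_transform p \<psi> g"
    and S: "\<Sigma> \<in> sets M" "emeasure M \<Sigma> < \<infinity>" and gS: "AE x in M. g x = g x * indicator \<Sigma> x"
  shows "AE x in M. norm (\<psi> x) \<le> (measure M \<Sigma> * enn2real (lp_integral M p \<psi>)) powr (1 / p)"
proof -
  from ext obtain \<phi>s where \<phi>1: "\<And>n. integrable M (\<phi>s n)" and \<phi>p: "\<And>n. \<phi>s n \<in> Lp_space M (ennreal p)"
    and l1: "(\<lambda>n. lp_norm M (ennreal p) (\<lambda>x. \<phi>s n x - \<psi> x)) \<longlonglongrightarrow> 0"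
    and l2: "(\<lambda>n. lp_norm M (conj_exponent p) (\<lambda>\<xi>. T (\<phi>s n) \<xi> - g \<xi>)) \<longlonglongrightarrow> 0"
    and g: "g \<in> Lp_space M (conj_exponent p)"
    unfolding extends_transform_def by (auto simp: Lp_space_1_iff)
  have [measurable]: "\<psi> \<in> borel_measurable M" "g \<in> borel_measurable M" "\<And>n. \<phi>s n \<in> borel_measurable M"
    using \<psi> g \<phi>p by (auto simp: Lp_space_def)
  note [measurable] = S(1)
  have ind: "(indicator \<Sigma> :: 'a \<Rightarrow> complex) \<in> Lp_space M (ennreal p)"
    using S p by (simp add: Lp_space_def lp_norm_indicator enn_powr_less_top_iff del: infinity_ennreal_def)
  have gi: "integrable M g"
  proof (rule integrable_cong_AE_imp[OF Hoelder_integrable[OF p(1) ind g]])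
    show "AE x in M. indicator \<Sigma> x * g x = g x" using gS by eventually_elim (simp add: mult.commute)
  qed measurable
  have gp: "g \<in> Lp_space M (ennreal p)"
  proof (cases "p = 1")
    case True
    then show ?thesis using gi Lp_space_1_iff[of g] by simp
  next
    case False
    define q where "q = p / (p - 1)"
    have q: "p \<le> q" "1 < p" using p False by (auto simp: q_def field_simps)
    have Jq: "lp_integral M q g < \<infinity>"
      using g q lp_norm_less_top_iff[of q M g] by (simp add: Lp_space_def conj_exponent_gt q_def[symmetric])
    have "lp_integral M p g \<le> (\<integral>\<^sup>+x. indicator \<Sigma> x + ennreal (norm (g x) powr q) \<partial>M)"
      unfolding lp_integral_def
    proof (rule nn_integral_mono_AE, use gS in eventually_elim)
      fix x assume x: "g x = g x * indicator \<Sigma> x"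
      show "ennreal (norm (g x) powr p) \<le> indicator \<Sigma> x + ennreal (norm (g x) powr q)"
      proof (cases "x \<in> \<Sigma>")
        case True
        have "norm (g x) powr p \<le> 1 + norm (g x) powr q"
        proof (cases "norm (g x) \<le> 1")
          case True
          then have "norm (g x) powr p \<le> 1 powr p" using q by (intro powr_mono2) auto
          then show ?thesis by (simp add: add_increasing2)
        next
          case False
          then have "norm (g x) powr p \<le> norm (g x) powr q" using q by (intro powr_mono) auto
          then show ?thesis by simp
        qed
        from ennreal_leI[OF this] show ?thesis using True by simp
      qed (use x in simp)
    qed
    also have "\<dots> = emeasure M \<Sigma> + lp_integral M q g"
      unfolding lp_integral_def by (subst nn_integral_add) auto
    also have "\<dots> < \<infinity>" using S(2) Jq by simp
    finally show ?thesis using p lp_norm_less_top_iff[of p M g] by (simp add: Lp_space_def)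
  qed
  define B where "B = (\<integral>x. norm (g x) \<partial>M)"
  have B0: "B \<ge> 0" by (simp add: B_def)
  \<comment> \<open>A representative of \<open>\<psi>\<close> that is bounded everywhere.\<close>
  define u where "u = T' g"
  have [measurable]: "u \<in> borel_measurable M" unfolding u_def by measurable
  have \<psi>u: "AE x in M. \<psi> x = u x" unfolding u_def by (rule inversion[OF p(1) \<psi> ext gi])
  have uB: "norm (u x) \<le> B" if "x \<in> space M" for x unfolding u_def B_def by (rule norm_T'_le[OF gi that])
  have \<psi>B: "AE x in M. norm (\<psi> x) \<le> B" using \<psi>u AE_space[of M] by eventually_elim (simp add: uB)
  obtain N where N: "lp_integral M p \<psi> = ennreal N" "N \<ge> 0"
    using \<psi> p lp_norm_less_top_iff[of p M \<psi>] by (cases "lp_integral M p \<psi>") (auto simp: Lp_space_def)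
  have up: "lp_integral M p u = ennreal N"
    unfolding N(1)[symmetric] by (intro lp_integral_cong_AE) (use \<psi>u in auto)
  have uq: "u \<in> Lp_space M (conj_exponent p)"
  proof (cases "p = 1")
    case True
    have "u \<in> Lp_space M top" by (rule bounded_Lp_top[where B=B]) (auto simp: uB)
    with True show ?thesis by (simp add: conj_exponent_one)
  next
    case False
    define q where "q = p / (p - 1)"
    have q: "p \<le> q" "1 < p" using p False by (auto simp: q_def field_simps)
    have "lp_integral M q u \<le> ennreal (B powr (q - p)) * lp_integral M p u"
      using q uB by (intro lp_integral_bounded_interpolate AE_I2) auto
    also have "\<dots> < \<infinity>" by (simp add: up ennreal_mult_less_top)
    finally show ?thesis using q lp_norm_less_top_iff[of q M u] by (simp add: Lp_space_def conj_exponent_gt q_def[symmetric])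
  qed
  have cnjL: "(\<lambda>x. cnj (f x)) \<in> Lp_space M r" if "f \<in> Lp_space M r" for f r
    using that by (auto simp: Lp_space_def lp_norm_def intro!: measurable_compose[OF _ cnj_measurable])
  have i1: "integrable M (\<lambda>x. cnj (\<phi>s n x) * u x)" for n by (rule Hoelder_integrable[OF p(1) cnjL[OF \<phi>p] uq])
  have i2: "integrable M (\<lambda>x. cnj (\<psi> x) * u x)" by (rule Hoelder_integrable[OF p(1) cnjL[OF \<psi>] uq])
  have i3: "integrable M (\<lambda>x. cnj (T (\<phi>s n) x) * g x)" for n
    using integrable_T_mult[OF \<phi>1[of n], of "\<lambda>x. cnj (g x)"] gi
      integrable_cnj[of M "\<lambda>x. T (\<phi>s n) x * cnj (g x)"] by simp
  have i4: "integrable M (\<lambda>x. g x * cnj (g x))" by (rule Hoelder_integrable[OF p(1) gp cnjL[OF g]])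
  have n1: "norm (cnj a - cnj b) = norm (a - b)" for a b :: complex
    by (simp flip: complex_cnj_diff)
  have c1: "(\<lambda>n. \<integral>x. cnj (\<phi>s n x) * u x \<partial>M) \<longlonglongrightarrow> (\<integral>x. cnj (\<psi> x) * u x \<partial>M)"
  proof (rule tendsto_integral_Hoelder[OF p(1) _ _ uq i1 i2])
    show "(\<lambda>n. lp_norm M (ennreal p) (\<lambda>x. cnj (\<phi>s n x) - cnj (\<psi> x))) \<longlonglongrightarrow> 0"
      using l1 unfolding lp_norm_def n1 .
  qed measurable
  have c2: "(\<lambda>n. \<integral>x. cnj (T (\<phi>s n) x) * g x \<partial>M) \<longlonglongrightarrow> (\<integral>x. cnj (g x) * g x \<partial>M)"
  proof (rule tendsto_integral_Hoelder_conj[OF p(1) _ _ gp i3 i4[unfolded mult.commute[of "g _"]]])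
    show "(\<lambda>n. lp_norm M (conj_exponent p) (\<lambda>x. cnj (T (\<phi>s n) x) - cnj (g x))) \<longlonglongrightarrow> 0"
      using l2 unfolding lp_norm_def n1 .
  qed measurable
  have "(\<integral>x. cnj (\<phi>s n x) * u x \<partial>M) = (\<integral>x. cnj (T (\<phi>s n) x) * g x \<partial>M)" for n
    using T'_self_adjoint[of "\<lambda>x. cnj (\<phi>s n x)" g] \<phi>1[of n] gi by (simp add: u_def T'_conv_T[of "\<lambda>x. cnj (\<phi>s n x)"])
  with c1 c2 have "(\<integral>x. cnj (\<psi> x) * u x \<partial>M) = (\<integral>x. cnj (g x) * g x \<partial>M)" by (simp add: LIMSEQ_unique)
  also have "(\<integral>x. cnj (\<psi> x) * u x \<partial>M) = (\<integral>x. cnj (u x) * u x \<partial>M)"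
    by (rule integral_cong_AE) (use \<psi>u in auto)
  finally have Pl: "(\<integral>x. cnj (u x) * u x \<partial>M) = (\<integral>x. cnj (g x) * g x \<partial>M)" .
  have sq: "lp_integral M 2 f = ennreal (Re (\<integral>x. f x * cnj (f x) \<partial>M))" if "integrable M (\<lambda>x. f x * cnj (f x))" for f
    using nn_integral_norm_square[OF that] by (simp add: lp_integral_def powr_numeral)
  have iu: "integrable M (\<lambda>x. u x * cnj (u x))"
    by (rule integrable_cong_AE_imp[OF i2]) (use \<psi>u in \<open>auto simp: mult.commute\<close>)
  have "lp_integral M 2 g = lp_integral M 2 u" by (simp add: sq[OF iu] sq[OF i4] Pl mult.commute[of "u _"] mult.commute[of "g _"])
  also have "\<dots> \<le> ennreal (B powr (2 - p)) * lp_integral M p u"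
    using p uB by (intro lp_integral_bounded_interpolate AE_I2) auto
  finally have g2: "lp_integral M 2 g \<le> ennreal (B powr (2 - p) * N)"
    using N by (simp add: up ennreal_mult)
  have "(ennreal B)\<^sup>2 \<le> lp_integral M 2 g * emeasure M \<Sigma>"
  proof -
    have "ennreal B = (\<integral>\<^sup>+x. ennreal (norm (g x)) \<partial>M)"
      unfolding B_def using gi by (subst nn_integral_eq_integral) auto
    also have "\<dots> = (\<integral>\<^sup>+x. ennreal (norm (g x)) * indicator \<Sigma> x \<partial>M)"
    proof (rule nn_integral_cong_AE, use gS in eventually_elim)
      fix x assume "g x = g x * indicator \<Sigma> x"
      then show "ennreal (norm (g x)) = ennreal (norm (g x)) * indicator \<Sigma> x" by (cases "x \<in> \<Sigma>") auto
    qed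
    finally have "(ennreal B)\<^sup>2 \<le> (\<integral>\<^sup>+x. (ennreal (norm (g x)))\<^sup>2 \<partial>M) * (\<integral>\<^sup>+x. (indicator \<Sigma> x)\<^sup>2 \<partial>M)"
      using Cauchy_Schwarz_nn_integral[of "\<lambda>x. ennreal (norm (g x))" M "indicator \<Sigma>"] by simp
    also have "(\<integral>\<^sup>+x. (indicator \<Sigma> x)\<^sup>2 \<partial>M) = emeasure M \<Sigma>"
    proof -
      have "(\<integral>\<^sup>+x. (indicator \<Sigma> x)\<^sup>2 \<partial>M) = (\<integral>\<^sup>+x. indicator \<Sigma> x \<partial>M)"
        by (intro nn_integral_cong) (simp add: indicator_def)
      then show ?thesis by simp
    qed
    also have "(\<integral>\<^sup>+x. (ennreal (norm (g x)))\<^sup>2 \<partial>M) = lp_integral M 2 g"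
      unfolding lp_integral_def by (intro nn_integral_cong) (simp add: powr_numeral ennreal_power)
    finally show ?thesis .
  qed
  also have "\<dots> \<le> ennreal (B powr (2 - p) * N) * ennreal (measure M \<Sigma>)"
    using S(2) by (intro mult_mono g2) (auto simp: emeasure_eq_ennreal_measure less_top)
  finally have "ennreal (B\<^sup>2) \<le> ennreal (B powr (2 - p) * N * measure M \<Sigma>)"
    using B0 N by (simp add: ennreal_power ennreal_mult)
  then have BB: "B\<^sup>2 \<le> B powr (2 - p) * N * measure M \<Sigma>" using N by (subst (asm) ennreal_le_iff) auto
  have "B \<le> (measure M \<Sigma> * N) powr (1 / p)"
  proof (cases "B = 0")
    case False
    with B0 have Bp: "B > 0" by simp
    have "B\<^sup>2 = B powr (2 - p) * B powr p" using Bp by (simp add: powr_add[symmetric] powr_numeral)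
    with BB have "B powr (2 - p) * B powr p \<le> B powr (2 - p) * (N * measure M \<Sigma>)" by (simp add: mult.assoc)
    then have "B powr p \<le> measure M \<Sigma> * N" using Bp by (simp add: mult.commute)
    then have "(B powr p) powr (1 / p) \<le> (measure M \<Sigma> * N) powr (1 / p)" using p by (intro powr_mono2) auto
    then show ?thesis using p Bp by (simp add: powr_powr)
  qed simp
  with \<psi>B show ?thesis using N by (auto elim!: eventually_mono)
qed

end

section \<open>The uncertainty principle\<close>

lemma lp_norm_bounded_indicator_le:
  assumes [measurable]: "\<Omega> \<in> sets M" and p: "0 < p" and c: "0 \<le> c" "AE x in M. norm (f x) \<le> c" and fin: "emeasure M \<Omega> < \<infinity>"
  shows "lp_norm M (ennreal p) (\<lambda>x. f x * indicator \<Omega> x) \<le> ennreal (c * measure M \<Omega> powr (1 / p))"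
proof -
  have "lp_integral M p (\<lambda>x. f x * indicator \<Omega> x) \<le> (\<integral>\<^sup>+x. ennreal (c powr p) * indicator \<Omega> x \<partial>M)"
    unfolding lp_integral_def
  proof (rule nn_integral_mono_AE, use c(2) in eventually_elim)
    fix x assume "norm (f x) \<le> c"
    then have "norm (f x) powr p \<le> c powr p" using p by (intro powr_mono2) auto
    then show "ennreal (norm (f x * indicator \<Omega> x) powr p) \<le> ennreal (c powr p) * indicator \<Omega> x"
      by (simp add: indicator_def ennreal_leI)
  qed
  also have "\<dots> = ennreal (c powr p * measure M \<Omega>)"
    using fin by (simp add: nn_integral_cmult emeasure_eq_ennreal_measure less_top ennreal_mult)
  finally have "lp_norm M (ennreal p) (\<lambda>x. f x * indicator \<Omega> x) \<le> enn_powr (ennreal (c powr p * measure M \<Omega>)) (1 / p)"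
    using p by (subst lp_norm_ennreal) (auto intro!: enn_powr_mono)
  also have "\<dots> = ennreal (c * measure M \<Omega> powr (1 / p))"
    using p c by (simp add: enn_powr_ennreal powr_mult powr_powr)
  finally show ?thesis .
qed

theorem theoremD:
  fixes \<alpha> p \<epsilon>\<Omega> \<epsilon>\<Sigma> :: real
    and \<Omega> \<Sigma> :: "((real^'d::finite) \<times> real) set"
    and \<phi> :: "(real^'d) \<times> real \<Rightarrow> complex"
  assumes "\<alpha> > - 1 / 2"
    and "\<Omega> \<in> sets (weinstein_measure \<alpha>)"
    and "\<Sigma> \<in> sets (weinstein_measure \<alpha>)"
    and "1 \<le> p" and "p \<le> 2"
    and "0 \<le> \<epsilon>\<Omega>" and "0 \<le> \<epsilon>\<Sigma>"
    and "\<phi> \<in> Lp_space (weinstein_measure \<alpha>) (ennreal p)"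
    and "\<not> (AE x in weinstein_measure \<alpha>. \<phi> x = 0)"
    and "eps_concentrated \<alpha> p \<epsilon>\<Omega> \<Omega> \<phi>"
    and "eps_bandlimited \<alpha> p \<epsilon>\<Sigma> \<Sigma> \<phi>"
  shows "ereal (1 - \<epsilon>\<Omega> - \<epsilon>\<Sigma>) \<le>
    ereal (1 + \<epsilon>\<Sigma>) *
      enn2ereal (enn_powr (emeasure (weinstein_measure \<alpha>) \<Sigma>) (1 / p)) *
      enn2ereal (enn_powr (emeasure (weinstein_measure \<alpha>) \<Omega>) (1 / p))"
proof -
  let ?M = "weinstein_measure \<alpha> :: ((real^'d) \<times> real) measure"
  let ?N = "lp_norm ?M (ennreal p)"
  interpret plancherel_kernel ?M "weinstein_kernel \<alpha>" truncated_half_space gaussian_span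
    by (rule plancherel_kernel_weinstein[OF assms(1)])
  note [measurable] = assms(2,3)
  have p: "1 \<le> p" "p \<le> 2" "0 < p" using assms by auto
  have T: "T f = weinstein_transform_L1 \<alpha> f" for f
    by (simp add: fun_eq_iff T_def weinstein_transform_L1_def)
  have ext: "extends_transform p f g \<longleftrightarrow> is_weinstein_transform \<alpha> p f g" for f g
    by (simp add: extends_transform_def is_weinstein_transform_def T)
  have \<phi>m[measurable]: "\<phi> \<in> borel_measurable ?M" using assms(8) by (simp add: Lp_space_def)
  obtain a where a: "?N \<phi> = ennreal a" "0 \<le> a"
    using assms(8) by (cases "?N \<phi>") (auto simp: Lp_space_def)
  have "?N \<phi> \<noteq> 0"
    using assms(9) p by (simp add: lp_norm_ennreal enn_powr_eq_0_iff lp_integral_eq_0_iff)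
  with a have a0: "0 < a" by (cases "a = 0") auto
  from assms(11) obtain \<psi> where \<psi>: "\<psi> \<in> bandlimited_space \<alpha> p \<Sigma>"
    and \<psi>\<epsilon>: "?N (\<lambda>x. \<phi> x - \<psi> x) \<le> ennreal (\<epsilon>\<Sigma> * a)"
    unfolding eps_bandlimited_def by (auto simp: a ennreal_mult assms(7))
  have \<phi>\<epsilon>: "?N (\<lambda>x. \<phi> x - \<phi> x * indicator \<Omega> x) \<le> ennreal (\<epsilon>\<Omega> * a)"
    using assms(10) unfolding eps_concentrated_def time_limit_def by (simp add: a ennreal_mult assms(6))
  have \<psi>L: "\<psi> \<in> Lp_space ?M (ennreal p)" using \<psi> by (simp add: bandlimited_space_def)
  then have [measurable]: "\<psi> \<in> borel_measurable ?M" by (simp add: Lp_space_def)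
  define g where "g = weinstein_transform \<alpha> p \<psi>"
  have g: "extends_transform p \<psi> g"
    using extends_transform_ex[OF p(1,2) \<psi>L] unfolding g_def weinstein_transform_def ext by (rule someI_ex)
  have gS: "AE x in ?M. g x = g x * indicator \<Sigma> x"
    using \<psi> by (simp add: bandlimited_space_def is_weinstein_integral_operator_def g_def)
  obtain b where b: "?N \<psi> = ennreal b" "0 \<le> b"
    using \<psi>L by (cases "?N \<psi>") (auto simp: Lp_space_def)
  have b_le: "b \<le> (1 + \<epsilon>\<Sigma>) * a"
  proof -
    have "?N (\<lambda>x. \<psi> x - \<phi> x) = ?N (\<lambda>x. \<phi> x - \<psi> x)"
      unfolding lp_norm_def by (simp add: norm_minus_commute)
    moreover have "?N (\<lambda>x. \<phi> x + (\<psi> x - \<phi> x)) \<le> ?N \<phi> + ?N (\<lambda>x. \<psi> x - \<phi> x)"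
      by (intro Minkowski_lp_norm p) measurable
    ultimately have "ennreal b \<le> ennreal a + ?N (\<lambda>x. \<phi> x - \<psi> x)" by (simp add: a b)
    also have "\<dots> \<le> ennreal a + ennreal (\<epsilon>\<Sigma> * a)" by (intro add_left_mono \<psi>\<epsilon>)
    also have "\<dots> = ennreal ((1 + \<epsilon>\<Sigma>) * a)" using a assms(7) by (simp add: distrib_right flip: ennreal_plus)
    finally show ?thesis using a assms(7) by (subst (asm) ennreal_le_iff) auto
  qed
  have indicator_le: "?N (\<lambda>x. f x * indicator \<Omega> x) \<le> ?N f" for f
    using p by (simp add: lp_norm_ennreal) (intro enn_powr_mono lp_integral_mono_AE AE_I2, auto simp: indicator_def)
  have split: "ennreal a \<le> ennreal (\<epsilon>\<Omega> * a) + ennreal (\<epsilon>\<Sigma> * a) + ?N (\<lambda>x. \<psi> x * indicator \<Omega> x)"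
  proof -
    have "?N \<phi> = ?N (\<lambda>x. (\<phi> x - \<phi> x * indicator \<Omega> x) + ((\<phi> x - \<psi> x) * indicator \<Omega> x + \<psi> x * indicator \<Omega> x))"
      by (simp add: algebra_simps)
    also have "\<dots> \<le> ?N (\<lambda>x. \<phi> x - \<phi> x * indicator \<Omega> x) + ?N (\<lambda>x. (\<phi> x - \<psi> x) * indicator \<Omega> x + \<psi> x * indicator \<Omega> x)"
      by (intro Minkowski_lp_norm p) measurable
    also have "\<dots> \<le> ennreal (\<epsilon>\<Omega> * a) + (?N (\<lambda>x. (\<phi> x - \<psi> x) * indicator \<Omega> x) + ?N (\<lambda>x. \<psi> x * indicator \<Omega> x))"
      by (intro add_mono \<phi>\<epsilon> Minkowski_lp_norm p) measurable
    also have "\<dots> \<le> ennreal (\<epsilon>\<Omega> * a) + (ennreal (\<epsilon>\<Sigma> * a) + ?N (\<lambda>x. \<psi> x * indicator \<Omega> x))"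
      by (intro add_left_mono add_right_mono order_trans[OF indicator_le \<psi>\<epsilon>])
    finally show ?thesis by (simp add: a add.assoc)
  qed
  \<comment> \<open>If \<open>\<psi>\<close> vanishes on \<open>\<Omega>\<close>, the errors alone make up \<open>\<phi>\<close>. This covers the products \<open>0 * \<infinity>\<close>.\<close>
  have trivial_case: ?thesis if "?N (\<lambda>x. \<psi> x * indicator \<Omega> x) = 0"
  proof -
    have "ennreal a \<le> ennreal (\<epsilon>\<Omega> * a + \<epsilon>\<Sigma> * a)" using split that a assms(6,7) by (simp flip: ennreal_plus)
    then have "1 * a \<le> (\<epsilon>\<Omega> + \<epsilon>\<Sigma>) * a" using a assms(6,7) by (subst (asm) ennreal_le_iff) (auto simp: distrib_right)
    then have "1 \<le> \<epsilon>\<Omega> + \<epsilon>\<Sigma>" using a0 by (simp only: mult_le_cancel_right_pos)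
    then have "ereal (1 - \<epsilon>\<Omega> - \<epsilon>\<Sigma>) \<le> 0" by simp
    also have "0 \<le> ereal (1 + \<epsilon>\<Sigma>) * enn2ereal (enn_powr (emeasure ?M \<Sigma>) (1 / p)) * enn2ereal (enn_powr (emeasure ?M \<Omega>) (1 / p))"
      using assms(7) by (simp add: ereal_0_le_mult enn2ereal_nonneg)
    finally show ?thesis .
  qed
  have zero_case: ?thesis if "AE x in ?M. \<psi> x * indicator \<Omega> x = 0"
  proof (rule trivial_case)
    show "?N (\<lambda>x. \<psi> x * indicator \<Omega> x) = 0"
      using that p by (simp add: lp_norm_ennreal enn_powr_eq_0_iff lp_integral_eq_0_iff)
  qed
  have top_case: ?thesis if "emeasure ?M \<Sigma> = \<infinity> \<and> emeasure ?M \<Omega> \<noteq> 0 \<or> emeasure ?M \<Omega> = \<infinity> \<and> emeasure ?M \<Sigma> \<noteq> 0"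
  proof -
    have pos: "0 < enn2ereal (enn_powr t (1 / p))" if "t \<noteq> 0" for t
      using that enn_powr_eq_0_iff[of t "1 / p"] less_ennreal.rep_eq[of 0 "enn_powr t (1 / p)"]
      by (simp add: zero_ennreal.rep_eq zero_less_iff_neq_zero)
    have inf: "ereal (1 + \<epsilon>\<Sigma>) * enn2ereal (enn_powr (emeasure ?M \<Sigma>) (1 / p)) * enn2ereal (enn_powr (emeasure ?M \<Omega>) (1 / p)) = \<infinity>"
      using that pos[of "emeasure ?M \<Sigma>"] pos[of "emeasure ?M \<Omega>"] assms(7)
      by (auto simp: ereal_mult_eq_PInfty top_ennreal.rep_eq zero_less_mult_iff ereal_zero_less_0_iff)
    show ?thesis unfolding inf by simp
  qed
  show ?thesis
  proof (cases "emeasure ?M \<Sigma> = \<infinity>")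
    case True
    show ?thesis
    proof (cases "emeasure ?M \<Omega> = 0")
      case True
      then have "\<Omega> \<in> null_sets ?M" by (auto intro: null_setsI)
      from AE_not_in[OF this] have "AE x in ?M. \<psi> x * indicator \<Omega> x = 0" by eventually_elim simp
      then show ?thesis by (rule zero_case)
    qed (use True top_case in blast)
  next
    case False
    then have fin: "emeasure ?M \<Sigma> < \<infinity>" by (simp add: less_top)
    define c where "c = measure ?M \<Sigma> powr (1 / p) * b"
    have "b = enn2real (lp_integral ?M p \<psi>) powr (1 / p)"
      using b p \<psi>L lp_norm_less_top_iff[of p ?M \<psi>]
      by (cases "lp_integral ?M p \<psi>") (auto simp: Lp_space_def lp_norm_ennreal enn_powr_ennreal)
    then have c: "AE x in ?M. norm (\<psi> x) \<le> c"
      using bandlimited_bound[OF p(1,2) \<psi>L g assms(3) fin gS] by (simp add: c_def powr_mult)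
    have c0: "0 \<le> c" using b by (simp add: c_def)
    show ?thesis
    proof (cases "emeasure ?M \<Omega> = \<infinity>")
      case True
      show ?thesis
      proof (cases "emeasure ?M \<Sigma> = 0")
        case True
        then have "c = 0" by (simp add: c_def measure_def)
        with c have "AE x in ?M. \<psi> x * indicator \<Omega> x = 0" by (auto elim!: eventually_mono)
        then show ?thesis by (rule zero_case)
      qed (use True top_case in blast)
    next
      case False
      then have fin': "emeasure ?M \<Omega> < \<infinity>" by (simp add: less_top)
      define m where "m = measure ?M \<Sigma> powr (1 / p) * measure ?M \<Omega> powr (1 / p)"
      have m0: "m \<ge> 0" by (simp add: m_def)
      have "?N (\<lambda>x. \<psi> x * indicator \<Omega> x) \<le> ennreal (c * measure ?M \<Omega> powr (1 / p))"
        by (rule lp_norm_bounded_indicator_le[OF assms(2) p(3) c0 c fin'])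
      also have "c * measure ?M \<Omega> powr (1 / p) = m * b" by (simp add: c_def m_def)
      finally have "ennreal a \<le> ennreal (\<epsilon>\<Omega> * a) + ennreal (\<epsilon>\<Sigma> * a) + ennreal (m * b)"
        using split by (meson add_left_mono order_trans)
      also have "\<dots> = ennreal (\<epsilon>\<Omega> * a + \<epsilon>\<Sigma> * a + m * b)" using assms(6,7) a b m0 by (simp flip: ennreal_plus)
      finally have "a \<le> \<epsilon>\<Omega> * a + \<epsilon>\<Sigma> * a + m * b" using assms(6,7) a b m0 by (subst (asm) ennreal_le_iff) auto
      also have "m * b \<le> m * ((1 + \<epsilon>\<Sigma>) * a)" by (intro mult_left_mono b_le m0)
      finally have "(1 - \<epsilon>\<Omega> - \<epsilon>\<Sigma>) * a \<le> ((1 + \<epsilon>\<Sigma>) * m) * a" by (simp add: algebra_simps)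
      then have "1 - \<epsilon>\<Omega> - \<epsilon>\<Sigma> \<le> (1 + \<epsilon>\<Sigma>) * m" using a0 by (simp only: mult_le_cancel_right_pos)
      then have "ereal (1 - \<epsilon>\<Omega> - \<epsilon>\<Sigma>) \<le> ereal ((1 + \<epsilon>\<Sigma>) * m)" by simp
      also have "\<dots> = ereal (1 + \<epsilon>\<Sigma>) * enn2ereal (enn_powr (emeasure ?M \<Sigma>) (1 / p)) * enn2ereal (enn_powr (emeasure ?M \<Omega>) (1 / p))"
        using fin fin' by (simp add: emeasure_eq_ennreal_measure less_top enn_powr_ennreal m_def mult.assoc)
      finally show ?thesis .
    qed
  qed
qed

end
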